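(* Let $X_1,\dots,X_N$ be random vectors in $\mathbb{R}^d$ satisfying the contaminated data model with parameters $(\mu,\Sigma)$ and outlier set $\mathcal{O}$ (see context). Let $\{u_j:j=0,1,2,\dots,\log_2N\}$ be positive integers, the family of parameters used to construct the family of estimators $\hat\mu^{(j)}$, $j=0,1,\dots$, in the adaptive algorithm (see context). For all $K\in\{600|\mathcal{O}|,\dots,N\}$, with probability at least $$1-2\exp(-K/360000)-\sum_{j=0}^{\log_2(N/(K-1))}(1/10)^{u_j},$$ the output $\hat\mu^{(\hat J)}$ of the adaptive algorithm is such that $\|\hat\mu^{(\hat J)}-\mu\|_2\leq 3r_K^*$.
   Context: Contaminated data model: there is a partition $\mathcal{I}\sqcup\mathcal{O}=\{1,\dots,N\}$ such that (1) nothing is assumed on $(X_i)_{i\in\mathcal{O}}$; (2) $(X_i)_{i\in\mathcal{I}}$ are independent with mean $\mu$ and $\mathbb{E}[(X_i-\mu)(X_i-\mu)^\top]\preceq\Sigma$, where $\Sigma$ is a covariance matrix. $\|\cdot\|_{op}$ is the operator norm, $\mathrm{Tr}$ the trace, $\|\cdot\|_2$ the Euclidean norm, $\preceq$ the Loewner order; $\tilde{O}$ hides logarithmic factors. Adaptive algorithm (Lepski-type; it uses $\mathrm{Tr}(\Sigma)$ and $\|\Sigma\|_{op}$ but not $|\mathcal{O}|$). For $K\in\{1,\dots,N\}$ and $j\in\{0,1,\dots,\log_2N\}$ set $$r_K^*=808\left(1200\sqrt{\frac{\mathrm{Tr}(\Sigma)}{N}}+\sqrt{\frac{1200\|\Sigma\|_{op}K}{N}}\right),\qquad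 r^{(j)}=r^*_{\lceil N/2^j\rceil},$$ and let $\hat\mu^{(j)}$ be the output of covSDPofMeans$(X_1,\dots,X_N,K=\lceil N/2^j\rceil,u=u_j)$ described below. The algorithm computes $\hat\mu^{(0)},\hat\mu^{(1)},\dots$ successively, increasing $J$ as long as $\|\hat\mu^{(J)}-\hat\mu^{(j)}\|_2\le r^{(J)}+r^{(j)}$ for $j=J-1,\dots,0$. Its output is $\hat\mu^{(\hat J)}$, where $$\hat J=\max\Big\{J\in\{0,1,\dots,\log_2N\}:\ \hat\mu^{(J)}\in\bigcap_{j=0}^{J-1}B_2(\hat\mu^{(j)},r^{(J)}+r^{(j)})\Big\},$$ $B_2(x,r)$ being the Euclidean ball with center $x$ and radius $r$. Covering SDP. Given block means $\bar X_1,\dots,\bar X_K$, a point $x_c\in\mathbb{R}^d$ and $\rho>0$, let $(C_\rho)$ be: minimize $\mathrm{Tr}(M')+\|y'\|_1$ over $M'\succeq0$ ($d\times d$) and $y'\in\mathbb{R}^K$, $y'\ge0$, subject to $\rho(\bar X_k-x_c)^\top M'(\bar X_k-x_c)+\frac{9K}{10}y'_k\ge1$ for all $k$. Let $g(\rho)$ be its optimal value. $\mathrm{ALG}_\rho(u)$ is the randomized algorithm which runs independently $u+3\log d+10$ times the positive-SDP solver of Peng, Tangwongsan and Zhang (2012) on $(C_\rho)$ with fixed accuracy $\eta=0.0001$ and keeps the best output; in time $\tilde O(uKd)$ and with probability $>1-(1/10)^{u+10}/d$ it returns a feasible pair $(M',y')$ with $\mathrm{Tr}(M')+\|y'\|_1\le(1+\eta)g(\rho)$.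 Its "objective" is the value $\mathrm{Tr}(M')+\|y'\|_1$ of the returned pair. BinarySearch$(\bar X_1,\dots,\bar X_K,x_c,\rho_0,u,T)$: set $\rho_m=0$, $\rho_M=\rho_0$, $V=$ objective of $\mathrm{ALG}_{\rho_0}(u)$, $i=0$. While $V\notin[0.9981,1]$ and $i<T$: if $V<0.9981$ set $\rho_M\leftarrow(\rho_M+\rho_m)/2$, else set $\rho_m\leftarrow(\rho_M+\rho_m)/2$; then set $V\leftarrow$ objective of $\mathrm{ALG}_{(\rho_m+\rho_M)/2}(u)$ and $i\leftarrow i+1$. Return the pair given by $\mathrm{ALG}_{(\rho_m+\rho_M)/2}(u)$. SolveSDP$(\bar X_1,\dots,\bar X_K,x_c,u)$: let $m$ be the coordinate-wise median of $\bar X_1,\dots,\bar X_K$ and $\delta=\mathrm{Med}(\|\bar X_k-m\|_2:1\le k\le K)$. Run BinarySearch with $\rho_0=d/\delta^2$ and $T=\log_2(\tilde C d^4)$, where $\tilde C<10^6$ is an absolute constant, obtaining $(M',y')$. If $\mathrm{Tr}(M')+\|y'\|_1\in[0.9981,1]$, return (True, $M'/\mathrm{Tr}(M')$). Otherwise, if the objective of $\mathrm{ALG}_{1/(d\delta)^2}(u)$ is $<1$ return (False, $m$), else return (False, $x_c$). covSDPofMeans$(X_1,\dots,X_N,K,u)$: split $\{1,\dots,N\}$ into $K$ blocks $B_1,\dots,B_K$ of equal size (some data are removed if $K$ does not divide $N$); compute the block means $\bar X_k=|B_k|^{-1}\sum_{i\in B_k}X_i$ and their coordinate-wise median $m$;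 set $x_c=m$, Bool = True, $T=0$. While Bool is True and $T<\log(8\sqrt d)/\log(1/\sqrt{0.81})$: let (Bool, $A$) be the output of SolveSDP$(\bar X_1,\dots,\bar X_K,x_c,u)$; if Bool is True, compute a unit top eigenvector $v_1$ of $M=A$, put $\theta_c=-\mathrm{Med}(\langle\bar X_k-x_c,v_1\rangle:1\le k\le K)$, update $x_c\leftarrow x_c-\theta_cv_1$ and $T\leftarrow T+1$; if Bool is False, set $x_c\leftarrow A$. Return $x_c$. *)

theory Defs
  imports "HOL-Probability.Probability" "HOL-Library.While_Combinator"
begin

section \<open>Matrices and medians\<close>

definition psd :: "real^'n^'n \<Rightarrow> bool" where
  "psd A \<longleftrightarrow> transpose A = A \<and> (\<forall>v. 0 \<le> v \<bullet> (A *v v))"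

definition loewner_le :: "real^'n^'n \<Rightarrow> real^'n^'n \<Rightarrow> bool" where
  "loewner_le A B \<longleftrightarrow> psd (B - A)"

definition op_norm :: "real^'n^'n \<Rightarrow> real" where
  "op_norm A = onorm (\<lambda>v. A *v v)"

definition outer :: "real^'n \<Rightarrow> real^'n^'n" where
  "outer v = (\<chi> i j. v $ i * v $ j)"

definition unit_top_eigenvector :: "real^'n^'n \<Rightarrow> real^'n \<Rightarrow> bool" where
  "unit_top_eigenvector A v \<longleftrightarrow>
     norm v = 1 \<and>
     (\<exists>l. A *v v = l *\<^sub>R v \<and> (\<forall>l' w. w \<noteq> 0 \<and> A *v w = l' *\<^sub>R w \<longrightarrow> l' \<le> l))"

text \<open>For an even number of values the median is the mean of the two middle order statistics.\<close>

definition Med :: "nat \<Rightarrow> (nat \<Rightarrow> real) \<Rightarrow> real" where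
  "Med K a = (let xs = sort (map a [1..<Suc K]) in (xs ! ((K - 1) div 2) + xs ! (K div 2)) / 2)"

definition coord_median :: "nat \<Rightarrow> (nat \<Rightarrow> real^'n) \<Rightarrow> real^'n" where
  "coord_median K Xb = (\<chi> i. Med K (\<lambda>k. Xb k $ i))"


section \<open>Contaminated data\<close>

text \<open>Integrability of the outer product is stated explicitly, as a Bochner integral that
  does not exist has value 0.\<close>

definition contaminated_data ::
  "'w measure \<Rightarrow> nat \<Rightarrow> nat set \<Rightarrow> nat set \<Rightarrow> (nat \<Rightarrow> 'w \<Rightarrow> real^'n) \<Rightarrow> real^'n \<Rightarrow> real^'n^'n \<Rightarrow> bool"
where
  "contaminated_data M N In Out X \<mu> \<Sigma> \<longleftrightarrow>
     prob_space M \<and> psd \<Sigma> \<and>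
     In \<union> Out = {1..N} \<and> In \<inter> Out = {} \<and>
     (\<forall>i\<in>{1..N}. X i \<in> borel_measurable M) \<and>
     prob_space.indep_vars M (\<lambda>_. borel) X In \<and>
     (\<forall>i\<in>In. integrable M (X i) \<and> integral\<^sup>L M (X i) = \<mu> \<and>
        integrable M (\<lambda>\<omega>. outer (X i \<omega> - \<mu>)) \<and>
        loewner_le (integral\<^sup>L M (\<lambda>\<omega>. outer (X i \<omega> - \<mu>))) \<Sigma>)"

definition equal_blocks :: "nat \<Rightarrow> nat \<Rightarrow> (nat \<Rightarrow> nat set) \<Rightarrow> bool" where
  "equal_blocks N K B \<longleftrightarrow>
     (\<forall>k\<in>{1..K}. B k \<subseteq> {1..N} \<and> card (B k) = N div K) \<and> disjoint_family_on B {1..K}"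

text \<open>Families indexed by \<open>{1..K}\<close> are extensional, so that they are the points of the product
  \<open>\<sigma>\<close>-algebra over \<open>{1..K}\<close>.\<close>

definition block_means :: "nat \<Rightarrow> (nat \<Rightarrow> nat set) \<Rightarrow> (nat \<Rightarrow> real^'n) \<Rightarrow> nat \<Rightarrow> real^'n" where
  "block_means K B x = (\<lambda>k\<in>{1..K}. (1 / real (card (B k))) *\<^sub>R (\<Sum>i\<in>B k. x i))"


section \<open>The covering SDP and its randomized solver\<close>

definition cov_feasible ::
  "nat \<Rightarrow> (nat \<Rightarrow> real^'n) \<Rightarrow> real^'n \<Rightarrow> real \<Rightarrow> (real^'n^'n) \<times> (nat \<Rightarrow> real) \<Rightarrow> bool" where
  "cov_feasible K Xb xc \<rho> p \<longleftrightarrow>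
     psd (fst p) \<and>
     (\<forall>k\<in>{1..K}. 0 \<le> snd p k \<and>
        1 \<le> \<rho> * ((Xb k - xc) \<bullet> (fst p *v (Xb k - xc))) + 9 * real K / 10 * snd p k)"

definition objective :: "nat \<Rightarrow> (real^'n^'n) \<times> (nat \<Rightarrow> real) \<Rightarrow> real" where
  "objective K p = trace (fst p) + (\<Sum>k=1..K. \<bar>snd p k\<bar>)"

definition cov_opt :: "nat \<Rightarrow> (nat \<Rightarrow> real^'n) \<Rightarrow> real^'n \<Rightarrow> real \<Rightarrow> real" where
  "cov_opt K Xb xc \<rho> = Inf (objective K ` {p. cov_feasible K Xb xc \<rho> p})"

text \<open>
  A randomized solver is a function \<open>alg u K Xb xc \<rho> s\<close> of its input and of a random seed \<open>s\<close>
  with distribution \<open>S\<close>; one seed carries the randomness of all the independent repetitions made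
  in one call.  The accuracy is \<open>\<eta> = 0.0001\<close>.
\<close>

type_synonym ('n, 's) solver =
  "nat \<Rightarrow> nat \<Rightarrow> (nat \<Rightarrow> real^'n) \<Rightarrow> real^'n \<Rightarrow> real \<Rightarrow> 's \<Rightarrow> (real^'n^'n) \<times> (nat \<Rightarrow> real)"

definition covering_solver :: "'s measure \<Rightarrow> ('n::finite, 's) solver \<Rightarrow> bool" where
  "covering_solver S alg \<longleftrightarrow>
     prob_space S \<and>
     (\<forall>u K. (\<lambda>((Xb, xc, \<rho>), s). alg u K Xb xc \<rho> s)
        \<in> measurable ((PiM {1..K} (\<lambda>_. borel) \<Otimes>\<^sub>M (borel \<Otimes>\<^sub>M borel)) \<Otimes>\<^sub>M S)
            (borel \<Otimes>\<^sub>M PiM {1..K} (\<lambda>_. borel))) \<and>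
     (\<forall>u K Xb xc \<rho>. 1 \<le> K \<and> Xb \<in> extensional {1..K} \<and> 0 < \<rho> \<longrightarrow>
        measure S {s \<in> space S.
            cov_feasible K Xb xc \<rho> (alg u K Xb xc \<rho> s) \<and>
            objective K (alg u K Xb xc \<rho> s) \<le> (1 + 0.0001) * cov_opt K Xb xc \<rho>}
          > 1 - (1 / 10) ^ (u + 10) / real CARD('n))"


section \<open>Binary search\<close>

text \<open>
  \<open>run \<rho> s\<close> is one call of the solver with parameter \<open>\<rho>\<close> and seed \<open>s\<close>; the \<open>i\<close>-th call draws the
  fresh seed \<open>s i\<close>.  The state is \<open>(\<rho>\<^sub>m, \<rho>\<^sub>M, p, i)\<close>, where \<open>p\<close> is the last pair computed, so that
  \<open>V = objective K p\<close>.  After at least one pass through the loop \<open>p\<close> is already the output of the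
  solver at \<open>(\<rho>\<^sub>m + \<rho>\<^sub>M) / 2\<close> and is returned without a new call; after none, the solver has only
  been called at \<open>\<rho>\<^sub>0\<close> and is called at the midpoint.  The second component of the result is the
  number of calls made.
\<close>

definition binary_search ::
  "(real \<Rightarrow> 's \<Rightarrow> (real^'n^'n) \<times> (nat \<Rightarrow> real)) \<Rightarrow> nat \<Rightarrow> real \<Rightarrow> real \<Rightarrow> (nat \<Rightarrow> 's)
    \<Rightarrow> ((real^'n^'n) \<times> (nat \<Rightarrow> real)) \<times> nat" where
  "binary_search run K \<rho>0 T s =
     (let (\<rho>m, \<rho>M, p, i) =
        while (\<lambda>(\<rho>m, \<rho>M, p, i). objective K p \<notin> {0.9981..1} \<and> real i < T)
          (\<lambda>(\<rho>m, \<rho>M, p, i).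
             let (\<rho>m', \<rho>M') =
               (if objective K p < 0.9981 then (\<rho>m, (\<rho>M + \<rho>m) / 2) else ((\<rho>M + \<rho>m) / 2, \<rho>M))
             in (\<rho>m', \<rho>M', run ((\<rho>m' + \<rho>M') / 2) (s (Suc i)), Suc i))
          (0, \<rho>0, run \<rho>0 (s 0), 0)
      in if i = 0 then (run ((\<rho>m + \<rho>M) / 2) (s 1), 2) else (p, Suc i))"


section \<open>SolveSDP and covSDPofMeans\<close>

text \<open>
  The result (True, A) is encoded as \<open>Inl A\<close>, the result (False, x) as \<open>Inr x\<close>.  For \<open>\<delta> = 0\<close>
  both parameters passed to the solver are 0 by the convention \<open>x / 0 = 0\<close>, and nothing is known
  about the solver's output; the estimator still stays at the coordinate-wise median then, since
  all the one-dimensional medians in the main loop vanish.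
\<close>

definition solve_sdp ::
  "('n::finite, 's) solver \<Rightarrow> real \<Rightarrow> nat \<Rightarrow> (nat \<Rightarrow> real^'n) \<Rightarrow> real^'n \<Rightarrow> nat \<Rightarrow> (nat \<Rightarrow> 's)
    \<Rightarrow> real^'n^'n + real^'n" where
  "solve_sdp alg C K Xb xc u s =
     (let d = real CARD('n);
          m = coord_median K Xb;
          \<delta> = Med K (\<lambda>k. norm (Xb k - m));
          run = alg u K Xb xc;
          (p, n) = binary_search run K (d / \<delta>\<^sup>2) (log 2 (C * d ^ 4)) s
      in if objective K p \<in> {0.9981..1} then Inl ((1 / trace (fst p)) *\<^sub>R fst p)
         else if objective K (run (1 / (d * \<delta>)\<^sup>2) (s n)) < 1 then Inr m
         else Inr xc)"

text \<open>\<open>eigv\<close> is the routine computing a unit top eigenvector; the \<open>t\<close>-th pass through the loop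
  draws the seeds \<open>s t 0, s t 1, \<dots>\<close>.\<close>

definition cov_sdp_of_means ::
  "('n::finite, 's) solver \<Rightarrow> (real^'n^'n \<Rightarrow> real^'n) \<Rightarrow> real \<Rightarrow> (nat \<Rightarrow> nat set)
    \<Rightarrow> (nat \<Rightarrow> real^'n) \<Rightarrow> nat \<Rightarrow> nat \<Rightarrow> (nat \<Rightarrow> nat \<Rightarrow> 's) \<Rightarrow> real^'n" where
  "cov_sdp_of_means alg eigv C B x K u s =
     (let Xb = block_means K B x;
          (b, xc, t) =
            while (\<lambda>(b, xc, t). b \<and> real t < ln (8 * sqrt (real CARD('n))) / ln (1 / sqrt 0.81))
              (\<lambda>(b, xc, t).
                 case solve_sdp alg C K Xb xc u (s t) of
                   Inl A \<Rightarrow>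
                     (let v = eigv A; \<theta> = - Med K (\<lambda>k. (Xb k - xc) \<bullet> v)
                      in (True, xc - \<theta> *\<^sub>R v, Suc t))
                 | Inr z \<Rightarrow> (False, z, t))
              (True, coord_median K Xb, 0)
      in xc)"


section \<open>The adaptive algorithm\<close>

definition r_star :: "real^'n^'n \<Rightarrow> nat \<Rightarrow> nat \<Rightarrow> real" where
  "r_star \<Sigma> N K =
     808 * (1200 * sqrt (trace \<Sigma> / real N) + sqrt (1200 * op_norm \<Sigma> * real K / real N))"

definition num_blocks :: "nat \<Rightarrow> nat \<Rightarrow> nat" where
  "num_blocks N j = nat \<lceil>real N / 2 ^ j\<rceil>"

text \<open>\<open>B K\<close> is the family of the \<open>K\<close> blocks, and \<open>s (j, t, i)\<close> is the seed of the \<open>i\<close>-th solver call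
  in the \<open>t\<close>-th pass through the main loop in the computation of the \<open>j\<close>-th estimator.\<close>

definition mu_hat ::
  "('n::finite, 's) solver \<Rightarrow> (real^'n^'n \<Rightarrow> real^'n) \<Rightarrow> real \<Rightarrow> (nat \<Rightarrow> nat \<Rightarrow> nat set)
    \<Rightarrow> (nat \<Rightarrow> nat) \<Rightarrow> nat \<Rightarrow> (nat \<Rightarrow> real^'n) \<Rightarrow> (nat \<times> nat \<times> nat \<Rightarrow> 's) \<Rightarrow> nat \<Rightarrow> real^'n" where
  "mu_hat alg eigv C B u N x s j =
     cov_sdp_of_means alg eigv C (B (num_blocks N j)) x (num_blocks N j) (u j) (\<lambda>t i. s (j, t, i))"

definition J_hat :: "real^'n^'n \<Rightarrow> nat \<Rightarrow> (nat \<Rightarrow> real^'n) \<Rightarrow> nat" where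
  "J_hat \<Sigma> N m =
     Max {J. real J \<le> log 2 (real N) \<and>
             m J \<in> (\<Inter>j\<in>{..<J}. cball (m j)
                      (r_star \<Sigma> N (num_blocks N J) + r_star \<Sigma> N (num_blocks N j)))}"

definition adaptive_estimator ::
  "('n::finite, 's) solver \<Rightarrow> (real^'n^'n \<Rightarrow> real^'n) \<Rightarrow> real \<Rightarrow> (nat \<Rightarrow> nat \<Rightarrow> nat set)
    \<Rightarrow> (nat \<Rightarrow> nat) \<Rightarrow> real^'n^'n \<Rightarrow> nat \<Rightarrow> (nat \<Rightarrow> real^'n) \<Rightarrow> (nat \<times> nat \<times> nat \<Rightarrow> 's) \<Rightarrow> real^'n" where
  "adaptive_estimator alg eigv C B u \<Sigma> N x s =
     (let m = mu_hat alg eigv C B u N x s in m (J_hat \<Sigma> N m))"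

text \<open>All seeds are independent of each other and of the data.\<close>

definition with_seeds :: "'w measure \<Rightarrow> 's measure \<Rightarrow> ('w \<times> (nat \<times> nat \<times> nat \<Rightarrow> 's)) measure" where
  "with_seeds M S = M \<Otimes>\<^sub>M PiM UNIV (\<lambda>_. S)"

end

theory Submission
  imports Defs
begin

text \<open>
  With high probability, in every direction all but one percent of the block means lie within a
  radius \<open>R\<close> of \<open>\<mu>\<close>, where \<open>R\<close> is a small fraction of \<open>r\<^sup>*\<close>. A PAC-Bayesian argument with a
  Gaussian prior gives this bound for all directions at once. Rounding a positive
  semidefinite matrix of trace one to a random unit vector transfers it to matrices. On this event
  a nearly optimal solution of the covering program is almost of rank one in the direction of
  \<open>xc - \<mu>\<close> while \<open>xc\<close> is far from \<open>\<mu>\<close>, so that each median step contracts the distance. A solver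
  call fails with a probability not depending on its input, because its seed is fresh. The resulting
  error is so much smaller than \<open>r\<^sup>*\<close> that the Lepski selection can afford the factor lost between
  consecutive dyadic numbers of blocks.
\<close>

section \<open>Symmetric matrices\<close>

text \<open>The constants interlock. With \<open>R = 5 * rate\<close> the main loop ends within
  \<open>49 * R = 245 * rate\<close> of \<open>\<mu>\<close>, while
  \<open>r_star = 808 * rate\<close>. If a stage after the last one with at least \<open>K\<close>
  blocks is selected, the error is at most 808 + (808 + 245) * 1.42 < 3 * 808 rates; an error of 808
  in place of 245 would exceed this. The inputs of the solver depend on its earlier outputs, and the
  numbers of passes and of calls grow with the dimension \<open>d\<close>. Bounding both logarithms
  by multiples of the square root of \<open>d\<close> leaves at most \<open>6318 * d\<close> calls
  per stage, so \<open>d\<close> cancels the \<open>1 / d\<close> in the failure probability of a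
  call and the factor 10^(-10) absorbs the rest. A binary search can miss its target interval.
  Rescaling a feasible matrix shows that the optimal value varies slowly with \<open>\<rho>\<close>,
  so a miss forces a wide final bracket. After so many halvings, and for \<open>xc\<close> far from
  \<open>\<mu>\<close>, this is possible only if \<open>\<delta>\<close> is at most of order
  \<open>R / d\<close>, and then the coordinate-wise median is a good answer.\<close>

lemma matrix_inner_sym:
  fixes A :: "real^'n^'n"
  assumes "transpose A = A"
  shows "(A *v x) \<bullet> y = x \<bullet> (A *v y)"
  by (metis assms dot_lmul_matrix matrix_vector_mult_def transpose_matrix_vector inner_commute)

lemma quad_form_linear: "linear (\<lambda>x. (A :: real^'n^'n) *v x)"
  by simp

text \<open>At a maximiser the first variation of the quadratic form vanishes in every direction
  orthogonal to \<open>E\<close>.\<close>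

lemma max_quadratic_form_eigenvector:
  fixes A :: "real^'n^'n"
  assumes sym: "transpose A = A" and x: "norm x = 1" "\<And>b. b \<in> E \<Longrightarrow> x \<bullet> b = 0"
    and inv: "\<And>b. b \<in> E \<Longrightarrow> \<exists>l. A *v b = l *\<^sub>R b"
    and max: "\<And>y. norm y = 1 \<Longrightarrow> (\<And>b. b \<in> E \<Longrightarrow> y \<bullet> b = 0) \<Longrightarrow> y \<bullet> (A *v y) \<le> x \<bullet> (A *v x)"
  shows "A *v x = (x \<bullet> (A *v x)) *\<^sub>R x"
proof -
  define l where "l = x \<bullet> (A *v x)"
  define z where "z = A *v x - l *\<^sub>R x"
  have xx: "x \<bullet> x = 1" using x by (simp add: dot_square_norm)
  have quad: "y \<bullet> (A *v y) \<le> l * (y \<bullet> y)" if "\<And>b. b \<in> E \<Longrightarrow> y \<bullet> b = 0" for y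
  proof (cases "y = 0")
    case False
    have "(y /\<^sub>R norm y) \<bullet> (A *v (y /\<^sub>R norm y)) \<le> l"
      unfolding l_def using that False by (intro max) auto
    then show ?thesis using False
      by (simp add: matrix_vector_mult_scaleR field_simps dot_square_norm power2_eq_square)
  qed simp
  have zE: "z \<bullet> b = 0" if b: "b \<in> E" for b
  proof -
    obtain m where m: "A *v b = m *\<^sub>R b" using inv[OF b] by blast
    have "(A *v x) \<bullet> b = x \<bullet> (m *\<^sub>R b)" using matrix_inner_sym[OF sym] m by simp
    then show ?thesis using x(2)[OF b] by (simp add: z_def inner_diff_left)
  qed
  have zx: "z \<bullet> x = 0" using xx by (simp add: z_def inner_diff_left l_def inner_commute[of "A *v x" x])
  have zAx: "z \<bullet> (A *v x) = z \<bullet> z"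
  proof -
    have "A *v x = z + l *\<^sub>R x" by (simp add: z_def)
    then show ?thesis by (simp add: inner_add_right zx)
  qed
  \<comment> \<open>Maximality is tested at \<open>x + t *\<^sub>R z\<close>: the gain of first
    order in \<open>t\<close> must be dominated by a term of order \<open>t^2\<close>, which forces
    \<open>z = 0\<close>.\<close>
  have key: "2 * t * (z \<bullet> z) \<le> t^2 * (l * (z \<bullet> z) - z \<bullet> (A *v z))" for t
  proof -
    have "(x + t *\<^sub>R z) \<bullet> (A *v (x + t *\<^sub>R z)) \<le> l * ((x + t *\<^sub>R z) \<bullet> (x + t *\<^sub>R z))"
      using x zE by (intro quad) (auto simp: inner_add_left)
    moreover have "x \<bullet> (A *v z) = z \<bullet> z"
      using matrix_inner_sym[OF sym, of x z] zAx by (simp add: inner_commute)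
    moreover have "x \<bullet> z = 0" using zx by (simp add: inner_commute)
    ultimately show ?thesis
      using zAx xx zx by (simp add: matrix_vector_right_distrib matrix_vector_mult_scaleR inner_add_left
        inner_add_right power2_eq_square algebra_simps l_def[symmetric])
  qed
  have "z \<bullet> z = 0"
  proof (rule ccontr)
    assume "z \<bullet> z \<noteq> 0"
    then have pos: "z \<bullet> z > 0" by simp
    define c where "c = \<bar>l * (z \<bullet> z) - z \<bullet> (A *v z)\<bar> + 1"
    \<comment> \<open>This choice makes the upper bound \<open>t^2 * c\<close> half of the left side
      of \<open>key\<close>.\<close>
    define t where "t = (z \<bullet> z) / c"
    have c: "c > 0" "l * (z \<bullet> z) - z \<bullet> (A *v z) \<le> c" by (auto simp: c_def)
    have t: "t > 0" using pos c by (simp add: t_def)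
    have "2 * t * (z \<bullet> z) \<le> t^2 * c"
      using key[of t] mult_left_mono[OF c(2), of "t^2"] by simp
    also have "\<dots> = t * (z \<bullet> z)" using c by (simp add: t_def power2_eq_square)
    finally show False using t pos by simp
  qed
  then show ?thesis by (simp add: z_def l_def)
qed

section \<open>Orthonormal eigenbases and positive semidefinite matrices\<close>

definition orthonormal_basis :: "'a::euclidean_space set \<Rightarrow> bool" where
  "orthonormal_basis E \<longleftrightarrow>
     finite E \<and> pairwise orthogonal E \<and> (\<forall>b\<in>E. norm b = 1) \<and> span E = UNIV"

text \<open>An orthonormal family of eigenvectors of maximal size spans. Otherwise the quadratic
  form attains its maximum on the compact unit sphere of the orthogonal complement, and the
  maximiser is a further eigenvector.\<close>

lemma spectral_theorem:
  fixes A :: "real^'n^'n"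
  assumes sym: "transpose A = A"
  obtains E where "orthonormal_basis E" "\<forall>b\<in>E. A *v b = (b \<bullet> (A *v b)) *\<^sub>R b"
proof -
  define P where "P E \<longleftrightarrow> finite E \<and> pairwise orthogonal E \<and> (\<forall>b\<in>E. norm b = 1) \<and>
    (\<forall>b\<in>E. \<exists>l. A *v b = l *\<^sub>R b)" for E :: "(real^'n) set"
  have P0: "P {}" by (simp add: P_def)
  have bound: "card E \<le> DIM(real^'n)" if "P E" for E
  proof -
    have "0 \<notin> E" using that unfolding P_def by force
    then have "independent E" using that pairwise_orthogonal_independent unfolding P_def by blast
    then show ?thesis using independent_bound by blast
  qed
  obtain E where E: "P E" and Emax: "\<And>F. P F \<Longrightarrow> card F \<le> card E"
    using ex_has_greatest_nat[of P "{}" card "Suc (DIM(real^'n))", OF P0] bound by (metis less_Suc_eq_le)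
  have "span E = UNIV"
  proof (rule ccontr)
    assume "span E \<noteq> UNIV"
    then obtain a where a: "a \<noteq> 0" "\<And>x. x \<in> span E \<Longrightarrow> a \<bullet> x = 0"
      using span_not_UNIV_orthogonal by blast
    define T where "T = sphere 0 1 \<inter> (\<Inter>b\<in>E. {x. b \<bullet> x = 0})"
    have "compact T"
      unfolding T_def by (intro compact_Int_closed closed_INT ballI closed_hyperplane compact_sphere)
    moreover have "a /\<^sub>R norm a \<in> T"
      using a span_base[of _ E] by (auto simp: T_def inner_commute)
    ultimately obtain x where x: "x \<in> T" "\<And>y. y \<in> T \<Longrightarrow> y \<bullet> (A *v y) \<le> x \<bullet> (A *v x)"
      using continuous_attains_sup[of T "\<lambda>y. y \<bullet> (A *v y)"]
      by (force intro: continuous_intros linear_continuous_on)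
    have x1: "norm x = 1" "\<And>b. b \<in> E \<Longrightarrow> x \<bullet> b = 0"
      using x(1) by (auto simp: T_def inner_commute)
    have ev: "A *v x = (x \<bullet> (A *v x)) *\<^sub>R x"
      using E x1 x(2) by (intro max_quadratic_form_eigenvector[where E = E] sym)
        (auto simp: P_def T_def inner_commute)
    have "x \<notin> E" using x1 by force
    moreover have "P (insert x E)"
      using E ev x1 unfolding P_def
      by (auto simp: pairwise_insert orthogonal_def inner_commute)
    ultimately show False using Emax[of "insert x E"] E by (auto simp: P_def)
  qed
  moreover have "A *v b = (b \<bullet> (A *v b)) *\<^sub>R b" if "b \<in> E" for b
  proof -
    obtain l where "A *v b = l *\<^sub>R b" using E \<open>b \<in> E\<close> unfolding P_def by blast
    moreover have "b \<bullet> b = 1" using E \<open>b \<in> E\<close> by (simp add: P_def dot_square_norm)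
    ultimately show ?thesis by simp
  qed
  ultimately show ?thesis using that[of E] E unfolding P_def orthonormal_basis_def by blast
qed

lemma orthonormal_expansion:
  fixes x :: "'a::euclidean_space"
  assumes E: "orthonormal_basis E"
  shows "x = (\<Sum>b\<in>E. (x \<bullet> b) *\<^sub>R b)"
proof -
  have bb: "b \<bullet> c = (if c = b then 1 else 0)" if "b \<in> E" "c \<in> E" for b c
    using E that by (auto simp: orthonormal_basis_def pairwise_def orthogonal_def dot_square_norm)
  define z where "z = x - (\<Sum>b\<in>E. (x \<bullet> b) *\<^sub>R b)"
  have "z \<bullet> c = 0" if "c \<in> E" for c
  proof -
    have "(\<Sum>b\<in>E. (x \<bullet> b) * (b \<bullet> c)) = (\<Sum>b\<in>E. if c = b then x \<bullet> b else 0)"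
      using bb that by (intro sum.cong) auto
    then show ?thesis using that E by (simp add: orthonormal_basis_def z_def inner_diff_left inner_sum_left)
  qed
  then have "orthogonal z y" if "y \<in> span E" for y
    using orthogonal_to_span[OF that, of z] by (auto simp: orthogonal_def)
  then have "z = 0" using E by (metis UNIV_I orthogonal_self orthonormal_basis_def)
  then show ?thesis by (simp add: z_def)
qed

lemma orthonormal_parseval:
  fixes x :: "'a::euclidean_space"
  assumes "orthonormal_basis E"
  shows "x \<bullet> x = (\<Sum>b\<in>E. (x \<bullet> b)\<^sup>2)"
proof -
  have "x \<bullet> x = x \<bullet> (\<Sum>b\<in>E. (x \<bullet> b) *\<^sub>R b)"
    using orthonormal_expansion[OF assms, of x] by simp
  then show ?thesis by (simp add: inner_sum_right power2_eq_square)
qed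

lemma trace_eq_sum_axis: "trace (A :: real^'n^'n) = (\<Sum>i\<in>UNIV. axis i 1 \<bullet> (A *v axis i 1))"
  by (simp add: trace_def matrix_vector_mult_basis column_def inner_axis')

lemma psd_spectral:
  fixes A :: "real^'n^'n"
  assumes "psd A"
  obtains E l where "orthonormal_basis E" "\<forall>b\<in>E. A *v b = l b *\<^sub>R b" "\<forall>b\<in>E. 0 \<le> l b"
    "\<forall>x. x \<bullet> (A *v x) = (\<Sum>b\<in>E. l b * (x \<bullet> b)\<^sup>2)" "trace A = sum l E"
proof -
  have sym: "transpose A = A" using assms by (simp add: psd_def)
  obtain E where E: "orthonormal_basis E" and ev: "\<forall>b\<in>E. A *v b = (b \<bullet> (A *v b)) *\<^sub>R b"
    by (rule spectral_theorem[OF sym])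
  then have E1: "\<And>b. b \<in> E \<Longrightarrow> norm b = 1" by (simp add: orthonormal_basis_def)
  define l where "l b = b \<bullet> (A *v b)" for b
  have quad: "x \<bullet> (A *v x) = (\<Sum>b\<in>E. l b * (x \<bullet> b)\<^sup>2)" for x
  proof -
    have "x \<bullet> (A *v x) = x \<bullet> (A *v (\<Sum>b\<in>E. (x \<bullet> b) *\<^sub>R b))"
      using orthonormal_expansion[OF E, of x] by simp
    also have "\<dots> = (\<Sum>b\<in>E. (x \<bullet> b) * (x \<bullet> (A *v b)))"
      by (simp add: linear_sum[OF quad_form_linear] matrix_vector_mult_scaleR inner_sum_right)
    also have "\<dots> = (\<Sum>b\<in>E. l b * (x \<bullet> b)\<^sup>2)"
    proof (rule sum.cong)
      fix b assume "b \<in> E"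
      then have "x \<bullet> (A *v b) = x \<bullet> (l b *\<^sub>R b)" using ev by (simp add: l_def)
      then show "(x \<bullet> b) * (x \<bullet> (A *v b)) = l b * (x \<bullet> b)\<^sup>2" by (simp add: power2_eq_square)
    qed simp
    finally show ?thesis .
  qed
  have "trace A = (\<Sum>i\<in>UNIV. \<Sum>b\<in>E. l b * (axis i 1 \<bullet> b)\<^sup>2)"
    by (simp add: trace_eq_sum_axis quad)
  also have "\<dots> = (\<Sum>b\<in>E. l b * (\<Sum>i\<in>UNIV. (axis i 1 \<bullet> b)\<^sup>2))"
    by (subst sum.swap) (simp add: sum_distrib_left)
  also have "\<dots> = (\<Sum>b\<in>E. l b)"
  proof (rule sum.cong)
    fix b assume "b \<in> E"
    have "(\<Sum>i\<in>UNIV. (axis i 1 \<bullet> b)\<^sup>2) = b \<bullet> b"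
      by (simp add: inner_vec_def[of b b] cart_eq_inner_axis power2_eq_square inner_commute)
    then show "l b * (\<Sum>i\<in>UNIV. (axis i 1 \<bullet> b)\<^sup>2) = l b" using E1[OF \<open>b \<in> E\<close>] by (simp add: dot_square_norm)
  qed simp
  finally have tr: "trace A = sum l E" .
  have nn: "0 \<le> l b" for b using assms by (simp add: l_def psd_def)
  have ev': "\<forall>b\<in>E. A *v b = l b *\<^sub>R b" using ev unfolding l_def .
  show ?thesis by (rule that[OF E ev' _ _ tr]) (use nn quad in blast)+
qed

lemma psd_trace_nonneg: "psd A \<Longrightarrow> 0 \<le> trace A"
proof -
  assume A: "psd A"
  obtain E l where "orthonormal_basis E" "\<forall>b\<in>E. A *v b = l b *\<^sub>R b" "\<forall>b\<in>E. 0 \<le> l b"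
    "\<forall>x. x \<bullet> (A *v x) = (\<Sum>b\<in>E. l b * (x \<bullet> b)\<^sup>2)" "trace A = sum l E"
    by (rule psd_spectral[OF A])
  then show ?thesis by (simp add: sum_nonneg)
qed

lemma psd_quad_le_trace:
  assumes "psd A" shows "x \<bullet> (A *v x) \<le> trace A * (x \<bullet> x)"
proof -
  obtain E l where E: "orthonormal_basis E" and l1: "\<forall>b\<in>E. A *v b = l b *\<^sub>R b"
    and l: "\<forall>b\<in>E. 0 \<le> l b" "\<forall>x. x \<bullet> (A *v x) = (\<Sum>b\<in>E. l b * (x \<bullet> b)\<^sup>2)" "trace A = sum l E"
    by (rule psd_spectral[OF assms])
  then have E1: "\<And>b. b \<in> E \<Longrightarrow> norm b = 1" by (simp add: orthonormal_basis_def)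
  have "(\<Sum>b\<in>E. l b * (x \<bullet> b)\<^sup>2) \<le> (\<Sum>b\<in>E. l b * (x \<bullet> x))"
  proof (intro sum_mono mult_left_mono)
    fix b assume b: "b \<in> E"
    have "b \<bullet> b = 1" using E1[OF b] by (simp add: dot_square_norm)
    then show "(x \<bullet> b)\<^sup>2 \<le> x \<bullet> x" using Cauchy_Schwarz_ineq[of x b] by simp
  qed (use l in auto)
  then show ?thesis by (simp add: l sum_distrib_right)
qed

text \<open>Bessel's inequality for the orthogonal pair \<open>v\<close>, \<open>z\<close>, applied
  to each eigenvector \<open>b\<close> and weighted with its eigenvalue. Multiplying by
  \<open>z \<bullet> z\<close> covers \<open>z = 0\<close>.\<close>

lemma psd_two_directions:
  assumes "psd A" "norm v = 1" "v \<bullet> z = 0"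
  shows "(v \<bullet> (A *v v)) * (z \<bullet> z) + z \<bullet> (A *v z) \<le> trace A * (z \<bullet> z)"
proof -
  obtain E l where E: "orthonormal_basis E" and l1: "\<forall>b\<in>E. A *v b = l b *\<^sub>R b"
    and l: "\<forall>b\<in>E. 0 \<le> l b" "\<forall>x. x \<bullet> (A *v x) = (\<Sum>b\<in>E. l b * (x \<bullet> b)\<^sup>2)" "trace A = sum l E"
    by (rule psd_spectral[OF assms(1)])
  then have E1: "\<And>b. b \<in> E \<Longrightarrow> norm b = 1" by (simp add: orthonormal_basis_def)
  have vv: "v \<bullet> v = 1" using assms by (simp add: dot_square_norm)
  have "(v \<bullet> b)\<^sup>2 * (z \<bullet> z) + (z \<bullet> b)\<^sup>2 \<le> z \<bullet> z" if b: "b \<in> E" for b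
  proof -
    have bb: "b \<bullet> b = 1" using E1[OF b] by (simp add: dot_square_norm)
    define y where "y = b - (v \<bullet> b) *\<^sub>R v"
    have yy: "y \<bullet> y = 1 - (v \<bullet> b)\<^sup>2"
      by (simp add: y_def inner_diff_left inner_diff_right vv bb power2_eq_square inner_commute algebra_simps)
    have "(z \<bullet> b)\<^sup>2 = (z \<bullet> y)\<^sup>2" using assms(3) by (simp add: y_def inner_diff_right inner_commute)
    also have "\<dots> \<le> (z \<bullet> z) * (1 - (v \<bullet> b)\<^sup>2)" using Cauchy_Schwarz_ineq[of z y] yy by simp
    finally show ?thesis by (simp add: algebra_simps)
  qed
  then have "(\<Sum>b\<in>E. l b * ((v \<bullet> b)\<^sup>2 * (z \<bullet> z) + (z \<bullet> b)\<^sup>2)) \<le> (\<Sum>b\<in>E. l b * (z \<bullet> z))"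
    by (intro sum_mono mult_left_mono) (use l in auto)
  then show ?thesis
    by (simp add: l sum_distrib_right sum.distrib distrib_left mult.assoc)
qed

lemma top_eigenvalue_ge_quad:
  assumes A: "psd A" and lmax: "\<And>l' w. w \<noteq> 0 \<Longrightarrow> A *v w = l' *\<^sub>R w \<Longrightarrow> l' \<le> l"
  shows "x \<bullet> (A *v x) \<le> l * (x \<bullet> x)"
proof -
  obtain E m where E: "orthonormal_basis E" and m1: "\<forall>b\<in>E. A *v b = m b *\<^sub>R b"
    and m0: "\<forall>b\<in>E. 0 \<le> m b" "\<forall>x. x \<bullet> (A *v x) = (\<Sum>b\<in>E. m b * (x \<bullet> b)\<^sup>2)" "trace A = sum m E"
    by (rule psd_spectral[OF A])
  then have E1: "\<And>b. b \<in> E \<Longrightarrow> norm b = 1" by (simp add: orthonormal_basis_def)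
  have "(\<Sum>b\<in>E. m b * (x \<bullet> b)\<^sup>2) \<le> (\<Sum>b\<in>E. l * (x \<bullet> b)\<^sup>2)"
  proof (intro sum_mono mult_right_mono)
    fix b assume b: "b \<in> E"
    then have "b \<noteq> 0" using E1 by force
    then show "m b \<le> l" using lmax m1 b by blast
  qed auto
  then show ?thesis by (simp add: m0 orthonormal_parseval[OF E, of x] sum_distrib_left)
qed

text \<open>Split \<open>w = z + c *\<^sub>R v\<close> with \<open>z\<close> orthogonal to
  \<open>v\<close>. The cross terms vanish because \<open>v\<close> is an eigenvector, and trace one
  leaves at most \<open>1 - l\<close> for the form on \<open>z\<close>, where
  \<open>l \<ge> w \<bullet> (A *v w)\<close>. The bound is informative once the form at
  \<open>w\<close> exceeds 1/2: then \<open>v\<close> is correlated with \<open>w\<close>.\<close>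

lemma top_eigenvector_alignment:
  assumes A: "psd A" "trace A = 1" and v: "unit_top_eigenvector A v" and w: "norm w = 1"
  shows "2 * (w \<bullet> (A *v w)) - 1 \<le> (w \<bullet> (A *v w)) * (w \<bullet> v)\<^sup>2"
proof -
  obtain l where v1: "norm v = 1" and l: "A *v v = l *\<^sub>R v" 
    and lmax: "\<And>l' w. w \<noteq> 0 \<Longrightarrow> A *v w = l' *\<^sub>R w \<Longrightarrow> l' \<le> l"
    using v unfolding unit_top_eigenvector_def by blast
  have sym: "transpose A = A" using A by (simp add: psd_def)
  have vv: "v \<bullet> v = 1" and ww: "w \<bullet> w = 1" using v1 w by (auto simp: dot_square_norm)
  have vAv: "v \<bullet> (A *v v) = l" by (simp add: l vv)
  define s where "s = w \<bullet> (A *v w)"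
  define c where "c = w \<bullet> v"
  define z where "z = w - c *\<^sub>R v"
  have vz: "v \<bullet> z = 0" by (simp add: z_def c_def inner_diff_right vv inner_commute)
  have zz: "z \<bullet> z = 1 - c\<^sup>2"
    by (simp add: z_def inner_diff_left inner_diff_right vv ww c_def inner_commute power2_eq_square algebra_simps)
  have sl: "s \<le> l" using top_eigenvalue_ge_quad[OF A(1), of l w] lmax by (simp add: ww s_def)
  have l1: "l \<le> 1" using psd_quad_le_trace[OF A(1), of v] by (simp add: vAv vv A)
  have zAv: "z \<bullet> (A *v v) = 0" using vz by (simp add: l inner_commute)
  have vAz: "v \<bullet> (A *v z) = 0" using matrix_inner_sym[OF sym, of v z] zAv by (simp add: inner_commute)
  have "w = z + c *\<^sub>R v" by (simp add: z_def)
  then have "s = (z + c *\<^sub>R v) \<bullet> (A *v (z + c *\<^sub>R v))" by (simp add: s_def)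
  also have "\<dots> = z \<bullet> (A *v z) + c\<^sup>2 * l"
    using zAv vAz vAv by (simp add: matrix_vector_right_distrib matrix_vector_mult_scaleR
      inner_add_left inner_add_right power2_eq_square algebra_simps)
  finally have "s = z \<bullet> (A *v z) + c\<^sup>2 * l" .
  moreover have "l * (1 - c\<^sup>2) + z \<bullet> (A *v z) \<le> 1 - c\<^sup>2"
    using psd_two_directions[OF A(1) v1 vz] by (simp add: vAv zz A)
  ultimately have *: "s \<le> (1 - l) * (1 - c\<^sup>2) + c\<^sup>2 * l" by (simp add: algebra_simps)
  have "0 \<le> 1 - c\<^sup>2" using zz by (metis inner_ge_zero)
  then have "(1 - l) * (1 - c\<^sup>2) \<le> (1 - s) * (1 - c\<^sup>2)" using sl by (intro mult_right_mono) auto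
  moreover have "c\<^sup>2 * l \<le> c\<^sup>2" using l1 by (simp add: mult_left_le)
  ultimately have "s \<le> (1 - s) * (1 - c\<^sup>2) + c\<^sup>2" using * by linarith
  then show ?thesis by (simp add: s_def[symmetric] c_def[symmetric] algebra_simps)
qed

section \<open>Medians and random signs\<close>

lemma sorted_nth_le_iff:
  fixes xs :: "'a::linorder list"
  assumes "sorted xs" "i < length xs"
  shows "xs ! i \<le> c \<longleftrightarrow> i < length (filter (\<lambda>x. x \<le> c) xs)"
  using assms
proof (induction xs arbitrary: i)
  case (Cons x xs)
  show ?case
  proof (cases "x \<le> c")
    case True
    then show ?thesis using Cons by (cases i) auto
  next
    case False
    then have none: "\<forall>y\<in>set (x # xs). \<not> y \<le> c" using Cons.prems(1) by (force simp: not_le)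
    then have "filter (\<lambda>x. x \<le> c) (x # xs) = []" by (simp only: filter_empty_conv)
    then show ?thesis using none nth_mem[OF Cons.prems(2)] by (metis list.size(3) not_less_zero)
  qed
qed simp

text \<open>The facts about \<open>Med\<close> below, including its measurability, reduce to this
  count.\<close>

lemma order_statistic_le_iff:
  fixes a :: "nat \<Rightarrow> real"
  assumes "i < K"
  shows "sort (map a [1..<Suc K]) ! i \<le> c \<longleftrightarrow> i < card {k\<in>{1..K}. a k \<le> c}"
proof -
  have "length (filter (\<lambda>x. x \<le> c) (sort (map a [1..<Suc K]))) = length (filter (\<lambda>k. a k \<le> c) [1..<Suc K])"
    by (simp add: filter_sort filter_map o_def del: upt_Suc)
  also have "\<dots> = card {k\<in>{1..K}. a k \<le> c}"
    by (subst distinct_length_filter) (auto simp del: upt_Suc intro!: arg_cong[where f = card])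
  finally show ?thesis using assms sorted_nth_le_iff[of "sort (map a [1..<Suc K])" i c] by simp
qed

lemma Med_le:
  assumes "K < 2 * card {k\<in>{1..K}. a k \<le> U}"
  shows "Med K a \<le> U"
proof -
  have "card {k\<in>{1..K}. a k \<le> U} \<le> card {1..K}" by (intro card_mono) auto
  then have "0 < K" using assms by simp
  then have "sort (map a [1..<Suc K]) ! ((K - 1) div 2) \<le> U" "sort (map a [1..<Suc K]) ! (K div 2) \<le> U"
    using assms by (subst order_statistic_le_iff; linarith)+
  then show ?thesis unfolding Med_def Let_def by simp
qed

lemma Med_ge:
  assumes "K < 2 * card {k\<in>{1..K}. L \<le> a k}"
  shows "L \<le> Med K a"
proof -
  have le: "card {k\<in>{1..K}. L \<le> a k} \<le> card {1..K}" by (intro card_mono) auto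
  then have K: "0 < K" using assms by simp
  \<comment> \<open>Both middle indices \<open>(K - 1) div 2\<close> and \<open>K div 2\<close>
    satisfy the two bounds on \<open>i\<close>, whatever the parity of \<open>K\<close>.\<close>
  have *: "L \<le> sort (map a [1..<Suc K]) ! i" if i: "i < K" "K \<le> 2 * i + 2" for i
  proof (rule ccontr)
    let ?c = "sort (map a [1..<Suc K]) ! i"
    assume "\<not> L \<le> ?c"
    then have "card {k\<in>{1..K}. a k \<le> ?c} + card {k\<in>{1..K}. L \<le> a k}
      = card ({k\<in>{1..K}. a k \<le> ?c} \<union> {k\<in>{1..K}. L \<le> a k})"
      by (intro card_Un_disjoint[symmetric]) auto
    also have "\<dots> \<le> card {1..K}" by (intro card_mono) auto
    finally have "2 * card {k\<in>{1..K}. a k \<le> ?c} < K" using assms unfolding card_atLeastAtMost by linarith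
    moreover have "i < card {k\<in>{1..K}. a k \<le> ?c}" using order_statistic_le_iff[OF i(1), of a ?c] by simp
    ultimately show False using i by linarith
  qed
  have "L \<le> sort (map a [1..<Suc K]) ! ((K - 1) div 2)" "L \<le> sort (map a [1..<Suc K]) ! (K div 2)"
    using K by (intro *; linarith)+
  then show ?thesis unfolding Med_def Let_def by simp
qed

lemma Med_close:
  assumes "K < 2 * card {k\<in>{1..K}. \<bar>a k - c\<bar> \<le> r}"
  shows "\<bar>Med K a - c\<bar> \<le> r"
proof -
  have "card {k\<in>{1..K}. \<bar>a k - c\<bar> \<le> r} \<le> card {k\<in>{1..K}. a k \<le> c + r}"
    "card {k\<in>{1..K}. \<bar>a k - c\<bar> \<le> r} \<le> card {k\<in>{1..K}. c - r \<le> a k}"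
    by (intro card_mono; force)+
  then show ?thesis using assms Med_le[of K a "c + r"] Med_ge[of K "c - r" a] by linarith
qed

lemma half_le_Med:
  assumes "0 < K"
  shows "K \<le> 2 * card {k\<in>{1..K}. a k \<le> Med K a}"
proof -
  let ?xs = "sort (map a [1..<Suc K])"
  have "?xs ! ((K - 1) div 2) \<le> ?xs ! (K div 2)"
    using assms by (intro sorted_nth_mono) (auto simp: div_le_mono simp del: upt_Suc)
  then have "?xs ! ((K - 1) div 2) \<le> Med K a" unfolding Med_def Let_def by simp
  then have "(K - 1) div 2 < card {k\<in>{1..K}. a k \<le> Med K a}"
    using assms by (subst (asm) order_statistic_le_iff) auto
  then show ?thesis by linarith
qed

lemma Med_nonneg:
  assumes "0 < K" "\<And>k. 0 \<le> a k"
  shows "0 \<le> Med K a"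
proof -
  have "{k\<in>{1..K}. 0 \<le> a k} = {1..K}" using assms(2) by auto
  then show ?thesis using assms(1) by (intro Med_ge) simp
qed

text \<open>If the mean of two nonnegative middle values is 0, the upper one is 0 too. This gives a
  strict majority, where \<open>half_le_Med\<close> only reaches one half for even
  \<open>K\<close>.\<close>

lemma Med_zero_imp_majority_zero:
  assumes "0 < K" and a: "\<And>k. 0 \<le> a k" and 0: "Med K a = 0"
  shows "K < 2 * card {k\<in>{1..K}. a k \<le> 0}"
proof -
  let ?xs = "sort (map a [1..<Suc K])"
  have "(K - 1) div 2 < length ?xs" using assms(1) by simp
  then have "?xs ! ((K - 1) div 2) \<in> set ?xs" by (rule nth_mem)
  then have "0 \<le> ?xs ! ((K - 1) div 2)" using a by (auto simp del: upt_Suc)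
  then have "?xs ! (K div 2) \<le> 0" using 0 unfolding Med_def Let_def by simp
  then have "K div 2 < card {k\<in>{1..K}. a k \<le> 0}"
    using assms by (subst (asm) order_statistic_le_iff) auto
  then show ?thesis by linarith
qed

lemma borel_measurable_Med [measurable (raw)]:
  assumes K: "0 < K" and a: "\<And>k. k \<in> {1..K} \<Longrightarrow> (\<lambda>w. a w k) \<in> borel_measurable M"
  shows "(\<lambda>w. Med K (a w)) \<in> borel_measurable M"
proof -
  have *: "(\<lambda>w. sort (map (a w) [1..<Suc K]) ! i) \<in> borel_measurable M" if i: "i < K" for i
  proof (rule borel_measurableI_le)
    fix c
    have "sort (map (a w) [1..<Suc K]) ! i \<le> c \<longleftrightarrow> real i < (\<Sum>k\<in>{1..K}. if a w k \<le> c then 1 else 0)" for w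
      unfolding order_statistic_le_iff[OF i] by (simp add: sum.If_cases Int_def)
    then have "{w \<in> space M. sort (map (a w) [1..<Suc K]) ! i \<le> c} =
      {w \<in> space M. real i < (\<Sum>k\<in>{1..K}. if a w k \<le> c then 1 else 0)}"
      by (simp only:)
    also have "\<dots> \<in> sets M" using a by measurable
    finally show "{w \<in> space M. sort (map (a w) [1..<Suc K]) ! i \<le> c} \<in> sets M" .
  qed
  have "(K - 1) div 2 < K" "K div 2 < K" using K by auto
  then show ?thesis unfolding Med_def Let_def using *
    by (intro borel_measurable_divide borel_measurable_add borel_measurable_const) auto
qed

section \<open>Random signs and the rounding of matrices to unit vectors\<close>

definition random_sign :: "'a set \<Rightarrow> 'a \<Rightarrow> real" where
  "random_sign F b = (if b \<in> F then 1 else - 1)"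

text \<open>Signs are encoded by the set \<open>F\<close> of the indices with sign 1, so
  expectations are averages over \<open>Pow E\<close>. In the induction the two signs of the new
  index are paired, and the odd powers cancel.\<close>

lemma rademacher_moments:
  assumes "finite E"
  shows "(\<Sum>F\<in>Pow E. (\<Sum>b\<in>E. random_sign F b * c b)\<^sup>2) = 2 ^ card E * (\<Sum>b\<in>E. (c b)\<^sup>2)"
    and "(\<Sum>F\<in>Pow E. (\<Sum>b\<in>E. random_sign F b * c b) ^ 4) \<le> 3 * 2 ^ card E * (\<Sum>b\<in>E. (c b)\<^sup>2)\<^sup>2"
proof -
  define S where "S F E = (\<Sum>b\<in>E. random_sign F b * c b)" for F E
  have "(\<Sum>F\<in>Pow E. (S F E)\<^sup>2) = 2 ^ card E * (\<Sum>b\<in>E. (c b)\<^sup>2) \<and>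
    (\<Sum>F\<in>Pow E. (S F E) ^ 4) \<le> 3 * 2 ^ card E * (\<Sum>b\<in>E. (c b)\<^sup>2)\<^sup>2"
    using assms
  proof (induction E rule: finite_induct)
    case (insert x E)
    have split: "(\<Sum>F\<in>Pow (insert x E). f (S F (insert x E))) =
        (\<Sum>F\<in>Pow E. f (S F E - c x) + f (S F E + c x))" for f :: "real \<Rightarrow> real"
    proof -
      have minus: "S F (insert x E) = S F E - c x" if "F \<in> Pow E" for F
        using insert.hyps that by (auto simp: S_def random_sign_def)
      have plus: "S (insert x F) (insert x E) = S F E + c x" if "F \<in> Pow E" for F
      proof -
        have "S (insert x F) E = S F E"
          unfolding S_def using insert.hyps by (intro sum.cong) (auto simp: random_sign_def)
        then show ?thesis using insert.hyps by (simp add: S_def random_sign_def)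
      qed
      have "inj_on (insert x) (Pow E)" using insert.hyps by (intro inj_onI) (auto dest: insert_ident)
      moreover have "Pow E \<inter> insert x ` Pow E = {}" using insert.hyps by auto
      ultimately show ?thesis
        using insert.hyps by (simp add: Pow_insert sum.union_disjoint sum.reindex minus plus sum.distrib)
    qed
    have c: "card (Pow E) = 2 ^ card E" using insert.hyps by (simp add: card_Pow)
    have e2: "(s - t)\<^sup>2 + (s + t)\<^sup>2 = 2 * s\<^sup>2 + 2 * t\<^sup>2" for s t :: real by algebra
    have e4: "(s - t) ^ 4 + (s + t) ^ 4 = 2 * s ^ 4 + 12 * t\<^sup>2 * s\<^sup>2 + 2 * t ^ 4" for s t :: real by algebra
    define V where "V = (\<Sum>b\<in>E. (c b)\<^sup>2)"
    define P :: real where "P = 2 ^ card E"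
    have IH: "(\<Sum>F\<in>Pow E. (S F E)\<^sup>2) = P * V" "(\<Sum>F\<in>Pow E. (S F E) ^ 4) \<le> 3 * P * V\<^sup>2"
      using insert.IH by (auto simp: V_def P_def)
    have "(\<Sum>F\<in>Pow (insert x E). (S F (insert x E)) ^ 4) = 2 * (\<Sum>F\<in>Pow E. (S F E) ^ 4)
        + 12 * (c x)\<^sup>2 * (P * V) + 2 * P * (c x) ^ 4"
      by (simp only: split[of "\<lambda>s. s ^ 4"] e4 sum.distrib sum_distrib_left[symmetric] IH(1)) (simp add: c P_def)
    also have "\<dots> \<le> 3 * (2 * P) * ((c x)\<^sup>2 + V)\<^sup>2"
    proof -
      have "0 \<le> P * (c x) ^ 4" by (simp add: P_def)
      moreover have "3 * (2 * P) * ((c x)\<^sup>2 + V)\<^sup>2 = 6 * P * V\<^sup>2 + 12 * (c x)\<^sup>2 * (P * V) + 6 * (P * (c x) ^ 4)"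
        by algebra
      ultimately show ?thesis using IH(2) by (simp add: mult.assoc)
    qed
    finally have 4: "(\<Sum>F\<in>Pow (insert x E). (S F (insert x E)) ^ 4) \<le> 3 * (2 * P) * ((c x)\<^sup>2 + V)\<^sup>2" .
    have "(\<Sum>F\<in>Pow (insert x E). (S F (insert x E))\<^sup>2) = 2 * P * ((c x)\<^sup>2 + V)"
      by (simp only: split[of "\<lambda>s. s\<^sup>2"] e2 sum.distrib sum_distrib_left[symmetric] IH(1)) (simp add: c P_def algebra_simps)
    with 4 show ?case using insert.hyps by (simp add: V_def P_def)
  qed (simp add: S_def)
  then show "(\<Sum>F\<in>Pow E. (\<Sum>b\<in>E. random_sign F b * c b)\<^sup>2) = 2 ^ card E * (\<Sum>b\<in>E. (c b)\<^sup>2)"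
    and "(\<Sum>F\<in>Pow E. (\<Sum>b\<in>E. random_sign F b * c b) ^ 4) \<le> 3 * 2 ^ card E * (\<Sum>b\<in>E. (c b)\<^sup>2)\<^sup>2"
    by (auto simp: S_def)
qed

text \<open>A Paley--Zygmund bound: \<open>0.11 (y - 1/64) (6 - y)\<close> is a quadratic minorant of the indicator
  of \<open>y > 1/64\<close>.\<close>

lemma rademacher_anticoncentration:
  assumes "finite E" and R: "64 * R\<^sup>2 < (\<Sum>b\<in>E. (c b)\<^sup>2)"
  shows "0.32 * 2 ^ card E \<le> real (card {F\<in>Pow E. R < \<bar>\<Sum>b\<in>E. random_sign F b * c b\<bar>})"
proof -
  define V where "V = (\<Sum>b\<in>E. (c b)\<^sup>2)"
  define P :: real where "P = 2 ^ card E"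
  define S where "S F = (\<Sum>b\<in>E. random_sign F b * c b)" for F
  define y where "y F = (S F)\<^sup>2 / V" for F
  have V: "0 < V" using R le_less_trans[of 0 "64 * R\<^sup>2"] by (simp add: V_def)
  have m2: "(\<Sum>F\<in>Pow E. y F) = P"
    using rademacher_moments(1)[OF assms(1), of c] V
    by (simp add: y_def S_def P_def V_def sum_divide_distrib[symmetric])
  have "(\<Sum>F\<in>Pow E. (y F)\<^sup>2) = (\<Sum>F\<in>Pow E. S F ^ 4) / V\<^sup>2"
    by (simp add: y_def power_divide sum_divide_distrib flip: power_mult)
  also have "\<dots> \<le> 3 * P"
    using rademacher_moments(2)[OF assms(1), of c] V
    by (simp add: S_def P_def V_def divide_le_eq)
  finally have m4: "(\<Sum>F\<in>Pow E. (y F)\<^sup>2) \<le> 3 * P" .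
  have "0.11 * ((y F - 1/64) * (6 - y F)) \<le> (if R < \<bar>S F\<bar> then 1 else 0)" for F
  proof (cases "R < \<bar>S F\<bar>")
    case True
    \<comment> \<open>The completed square shows a maximum below 9, so the factor 0.11 keeps the
      minorant below 1.\<close>
    have "(y F - 1/64) * (6 - y F) = (383/128)\<^sup>2 - (y F - 385/128)\<^sup>2"
      by (simp add: power2_eq_square field_simps)
    also have "\<dots> \<le> 9" using zero_le_power2[of "y F - 385/128"] unfolding power2_eq_square[of "383/128"] by linarith
    finally have "0.11 * ((y F - 1/64) * (6 - y F)) \<le> 0.11 * 9" by (intro mult_left_mono) auto
    also have "\<dots> \<le> (1::real)" by simp
    finally show ?thesis using True by (simp only: if_True)
  next
    case False
    then have "(S F)\<^sup>2 \<le> R\<^sup>2" by (simp add: abs_le_square_iff[symmetric])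
    then have "64 * (S F)\<^sup>2 < V" using R by (simp add: V_def)
    then have "y F < 1/64" using V by (simp add: y_def field_simps)
    then have "(y F - 1/64) * (6 - y F) \<le> 0" by (intro mult_nonpos_nonneg) auto
    from mult_nonneg_nonpos[OF _ this, of "0.11"] have "0.11 * ((y F - 1/64) * (6 - y F)) \<le> 0" by simp_all
    then show ?thesis using False by (simp only: if_False)
  qed
  then have "(\<Sum>F\<in>Pow E. 0.11 * ((y F - 1/64) * (6 - y F))) \<le> (\<Sum>F\<in>Pow E. if R < \<bar>S F\<bar> then 1 else 0)"
    by (intro sum_mono)
  moreover have "(\<Sum>F\<in>Pow E. if R < \<bar>S F\<bar> then 1 else 0) = real (card {F\<in>Pow E. R < \<bar>S F\<bar>})"
    using assms(1) by (simp add: sum.If_cases Int_def)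
  \<comment> \<open>As \<open>y\<close> has mean 1 and second moment at most 3, the average of the
    minorant is at least 0.11 * (6 + 1/64 - 3 - 6/64) > 0.32.\<close>
  moreover have "(\<Sum>F\<in>Pow E. 0.11 * ((y F - 1/64) * (6 - y F)))
      = 0.11 * ((6 + 1/64) * (\<Sum>F\<in>Pow E. y F) - (\<Sum>F\<in>Pow E. (y F)\<^sup>2) - 6/64 * P)"
  proof -
    have "(y F - 1/64) * (6 - y F) = (6 + 1/64) * y F - (y F)\<^sup>2 - 6/64" for F
      by (simp add: power2_eq_square field_simps)
    then show ?thesis
      using assms(1) by (simp only: sum_distrib_left[symmetric] sum_subtractf) (simp add: card_Pow P_def)
  qed
  moreover have "0 < P" by (simp add: P_def)
  ultimately show ?thesis using m2 m4 by (simp add: S_def P_def)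
qed

text \<open>Rounding: \<open>\<Sum> \<plusminus> sqrt l\<^sub>b b\<close> with random signs is a unit vector with second moment \<open>A\<close>.\<close>

lemma psd_rounding:
  fixes Y :: "'i \<Rightarrow> real^'n"
  assumes A: "psd A" "trace A = 1" and I: "finite I" and R: "0 \<le> R"
    and q: "\<And>v. norm v = 1 \<Longrightarrow> real (card {k\<in>I. R < \<bar>Y k \<bullet> v\<bar>}) \<le> q"
  shows "0.32 * real (card {k\<in>I. 64 * R\<^sup>2 < Y k \<bullet> (A *v Y k)}) \<le> q"
proof -
  obtain E l where E: "orthonormal_basis E" and "\<forall>b\<in>E. A *v b = l b *\<^sub>R b"
    and l: "\<forall>b\<in>E. 0 \<le> l b" "\<forall>x. x \<bullet> (A *v x) = (\<Sum>b\<in>E. l b * (x \<bullet> b)\<^sup>2)" "trace A = sum l E"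
    by (rule psd_spectral[OF A(1)])
  have fin: "finite E" using E by (simp add: orthonormal_basis_def)
  have bb: "b \<bullet> c = (if c = b then 1 else 0)" if "b \<in> E" "c \<in> E" for b c
    using E that by (auto simp: orthonormal_basis_def pairwise_def orthogonal_def dot_square_norm)
  define v where "v F = (\<Sum>b\<in>E. (random_sign F b * sqrt (l b)) *\<^sub>R b)" for F
  have inner_v: "y \<bullet> v F = (\<Sum>b\<in>E. random_sign F b * (sqrt (l b) * (y \<bullet> b)))" for y F
    by (simp add: v_def inner_sum_right mult.assoc)
  have norm_v: "norm (v F) = 1" for F
  proof -
    have "v F \<bullet> b = random_sign F b * sqrt (l b)" if "b \<in> E" for b
    proof -
      have "v F \<bullet> b = (\<Sum>c\<in>E. if c = b then random_sign F c * sqrt (l c) else 0)"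
        unfolding v_def inner_sum_left using bb that by (intro sum.cong) auto
      then show ?thesis using fin that by simp
    qed
    then have "v F \<bullet> v F = (\<Sum>b\<in>E. (random_sign F b * sqrt (l b))\<^sup>2)"
      using orthonormal_parseval[OF E, of "v F"] by simp
    also have "\<dots> = (\<Sum>b\<in>E. l b)"
      using l(1) by (intro sum.cong) (auto simp: power_mult_distrib random_sign_def)
    finally show ?thesis using l(3) A(2) by (simp add: norm_eq_1)
  qed
  define J where "J = {k\<in>I. 64 * R\<^sup>2 < Y k \<bullet> (A *v Y k)}"
  have J: "finite J" "J \<subseteq> I" using I by (auto simp: J_def)
  \<comment> \<open>For the coefficients \<open>sqrt (l b) * (Y k \<bullet> b)\<close> the sum of
    squares is \<open>Y k \<bullet> (A *v Y k)\<close>, so anticoncentration applies to each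
    \<open>k\<close> in \<open>J\<close>.\<close>
  have many: "0.32 * 2 ^ card E \<le> (\<Sum>F\<in>Pow E. if R < \<bar>Y k \<bullet> v F\<bar> then 1 else 0 :: real)" if k: "k \<in> J" for k
  proof -
    have "(\<Sum>b\<in>E. (sqrt (l b) * (Y k \<bullet> b))\<^sup>2) = (\<Sum>b\<in>E. l b * (Y k \<bullet> b)\<^sup>2)"
      using l(1) by (intro sum.cong) (auto simp: power_mult_distrib)
    then have "64 * R\<^sup>2 < (\<Sum>b\<in>E. (sqrt (l b) * (Y k \<bullet> b))\<^sup>2)" using k l(2) by (simp add: J_def)
    from rademacher_anticoncentration[OF fin this] show ?thesis
      using fin by (simp add: inner_v sum.If_cases Int_def)
  qed
  \<comment> \<open>Double counting of the pairs \<open>(k, F)\<close>: each \<open>k\<close> in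
    \<open>J\<close> is large for many sign patterns, and each pattern gives a unit vector with at
    most \<open>q\<close> large indices.\<close>
  have "real (card J) * (0.32 * 2 ^ card E) \<le> (\<Sum>k\<in>J. \<Sum>F\<in>Pow E. if R < \<bar>Y k \<bullet> v F\<bar> then 1 else 0)"
    using sum_mono[of J "\<lambda>_. 0.32 * 2 ^ card E", OF many] by simp
  also have "\<dots> = (\<Sum>F\<in>Pow E. real (card {k\<in>J. R < \<bar>Y k \<bullet> v F\<bar>}))"
    using J by (subst sum.swap) (simp add: sum.If_cases Int_def)
  also have "\<dots> \<le> (\<Sum>F\<in>Pow E. q)"
  proof (rule sum_mono)
    fix F
    have "card {k\<in>J. R < \<bar>Y k \<bullet> v F\<bar>} \<le> card {k\<in>I. R < \<bar>Y k \<bullet> v F\<bar>}"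
      using J I by (intro card_mono) auto
    then show "real (card {k\<in>J. R < \<bar>Y k \<bullet> v F\<bar>}) \<le> q" using q[OF norm_v[of F]] by linarith
  qed
  also have "\<dots> = 2 ^ card E * q" using fin by (simp add: card_Pow)
  finally have "2 ^ card E * (0.32 * real (card J)) \<le> 2 ^ card E * q" by (simp add: mult_ac)
  then show ?thesis by (simp add: J_def)
qed

section \<open>Concentration of the block means\<close>

definition gauss_weight :: "real \<Rightarrow> 'a::euclidean_space \<Rightarrow> real" where
  "gauss_weight \<beta> x = exp (- \<beta> * (x \<bullet> x) / 2)"

lemma gauss_weight_pos [simp]: "0 < gauss_weight \<beta> x" "0 \<le> gauss_weight \<beta> x"
    "gauss_weight \<beta> x \<noteq> 0"
  by (auto simp: gauss_weight_def)

lemma gauss_weight_measurable [measurable]: "gauss_weight \<beta> \<in> borel_measurable borel"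
  unfolding gauss_weight_def by measurable

lemma nn_integral_lborel_translate:
  fixes f :: "'a::euclidean_space \<Rightarrow> ennreal"
  assumes [measurable]: "f \<in> borel_measurable borel"
  shows "(\<integral>\<^sup>+x. f (v + x) \<partial>lborel) = (\<integral>\<^sup>+x. f x \<partial>lborel)"
proof -
  have "(\<integral>\<^sup>+x. f x \<partial>lborel) = (\<integral>\<^sup>+x. f x \<partial>distr lborel borel ((+) v))"
    by (simp only: lborel_distr_plus)
  also have "\<dots> = (\<integral>\<^sup>+x. f (v + x) \<partial>lborel)" by (subst nn_integral_distr) auto
  finally show ?thesis by simp
qed

lemma nn_integral_lborel_reflect:
  fixes f :: "'a::euclidean_space \<Rightarrow> ennreal"
  assumes [measurable]: "f \<in> borel_measurable borel"
  shows "(\<integral>\<^sup>+x. f (v - x) \<partial>lborel) = (\<integral>\<^sup>+x. f x \<partial>lborel)"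
proof -
  have "(lborel :: 'a measure) = distr lborel borel (\<lambda>x. v - x)"
    using lborel_affine[of "- 1" v] by (simp add: density_1)
  then have "(\<integral>\<^sup>+x. f x \<partial>lborel) = (\<integral>\<^sup>+x. f x \<partial>distr lborel borel (\<lambda>x. v - x))" by simp
  also have "\<dots> = (\<integral>\<^sup>+x. f (v - x) \<partial>lborel)" by (subst nn_integral_distr) auto
  finally show ?thesis by simp
qed

lemma gauss_weight_integral_finite:
  assumes "0 < \<beta>"
  shows "(\<integral>\<^sup>+x. ennreal (gauss_weight \<beta> (x :: 'a::euclidean_space)) \<partial>lborel) < \<infinity>"
proof -
  have 1: "(\<integral>\<^sup>+t. ennreal (exp (- \<beta> * t\<^sup>2 / 2)) \<partial>lborel) < \<infinity>"
  proof -
    define \<sigma> where "\<sigma> = 1 / sqrt \<beta>"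
    have \<sigma>: "0 < \<sigma>" "\<sigma>\<^sup>2 = 1 / \<beta>" using assms by (auto simp: \<sigma>_def power_divide)
    have "exp (- \<beta> * t\<^sup>2 / 2) = sqrt (2 * pi * \<sigma>\<^sup>2) * normal_density 0 \<sigma> t" for t
      using \<sigma> assms by (simp add: normal_density_def field_simps)
    then have "(\<integral>\<^sup>+t. ennreal (exp (- \<beta> * t\<^sup>2 / 2)) \<partial>lborel) =
      ennreal (sqrt (2 * pi * \<sigma>\<^sup>2)) * (\<integral>\<^sup>+t. ennreal (normal_density 0 \<sigma> t) \<partial>lborel)"
      by (simp add: ennreal_mult nn_integral_cmult)
    moreover have "(\<integral>\<^sup>+t. ennreal (normal_density 0 \<sigma> t) \<partial>lborel) = 1"
      using integrable_normal_density[OF \<sigma>(1), of 0] integral_normal_density[OF \<sigma>(1), of 0]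
      by (subst nn_integral_eq_integral) auto
    ultimately show ?thesis by simp
  qed
  have "gauss_weight \<beta> x = (\<Prod>b\<in>Basis. exp (- \<beta> * (x \<bullet> b)\<^sup>2 / 2))" for x :: 'a
    by (subst exp_sum[symmetric])
      (auto simp: gauss_weight_def euclidean_inner[of x x] sum_distrib_left sum_divide_distrib power2_eq_square
        intro!: arg_cong[where f = exp])
  then have "(\<integral>\<^sup>+x. ennreal (gauss_weight \<beta> (x :: 'a)) \<partial>lborel) =
    (\<integral>\<^sup>+x. (\<Prod>b\<in>(Basis :: 'a set). ennreal (exp (- \<beta> * (x \<bullet> b)\<^sup>2 / 2))) \<partial>lborel)"
    by (simp add: prod_ennreal)
  also have "\<dots> = (\<Prod>b\<in>(Basis :: 'a set). \<integral>\<^sup>+t. ennreal (exp (- \<beta> * t\<^sup>2 / 2)) \<partial>lborel)"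
    by (subst nn_integral_lborel_prod) auto
  also have "\<dots> < \<infinity>" using 1 by (simp add: power_less_top_ennreal)
  finally show ?thesis .
qed

text \<open>The normalising constant of the weight; the type argument carries the dimension on which
  it depends. Only finiteness and positivity are established, because it cancels in every
  comparison.\<close>

definition gauss_mass :: "'a::euclidean_space itself \<Rightarrow> real \<Rightarrow> real" where
  "gauss_mass _ \<beta> = enn2real (\<integral>\<^sup>+x. ennreal (gauss_weight \<beta> (x :: 'a)) \<partial>lborel)"

lemma gauss_mass:
  assumes "0 < \<beta>"
  shows "(\<integral>\<^sup>+x. ennreal (gauss_weight \<beta> (x :: 'a::euclidean_space)) \<partial>lborel) = ennreal (gauss_mass TYPE('a) \<beta>)"
    and "0 < gauss_mass TYPE('a) \<beta>"
proof -
  show *: "(\<integral>\<^sup>+x. ennreal (gauss_weight \<beta> (x :: 'a)) \<partial>lborel) = ennreal (gauss_mass TYPE('a) \<beta>)"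
    using gauss_weight_integral_finite[OF assms, where 'a = 'a] by (simp add: gauss_mass_def)
  have "(\<integral>\<^sup>+x. ennreal (gauss_weight \<beta> (x :: 'a)) \<partial>lborel) \<noteq> 0"
  proof
    assume "(\<integral>\<^sup>+x. ennreal (gauss_weight \<beta> (x :: 'a)) \<partial>lborel) = 0"
    then have "AE x in (lborel :: 'a measure). False"
      by (subst (asm) nn_integral_0_iff_AE) auto
    then show False by (simp add: eventually_False ae_filter_eq_bot_iff)
  qed
  then show "0 < gauss_mass TYPE('a) \<beta>" unfolding * by (simp add: ennreal_eq_0_iff)
qed

text \<open>The second moment is read off from translation invariance: averaging the weight over the
  translates by \<open>u\<close> and \<open>- u\<close> multiplies it by \<open>exp (- \<beta> \<bar>u\<bar>\<^sup>2 / 2) cosh (\<beta> (u \<bullet> x))\<close>.\<close>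

lemma gauss_second_moment:
  fixes a :: "'a::euclidean_space"
  assumes \<beta>: "0 < \<beta>"
  shows "(\<integral>\<^sup>+x. ennreal ((x \<bullet> a)\<^sup>2 * gauss_weight \<beta> x) \<partial>lborel)
    \<le> ennreal (2 / \<beta> * (a \<bullet> a) * gauss_mass TYPE('a) \<beta>)"
proof (cases "a = 0")
  case False
  define Z where "Z = gauss_mass TYPE('a) \<beta>"
  \<comment> \<open>With this length \<open>\<beta> * (u \<bullet> u) = 2\<close>, which turns the
    prefactor of the averaged translates into \<open>exp (- 1)\<close>.\<close>
  define c where "c = sqrt (2 / \<beta>) / norm a"
  define u where "u = c *\<^sub>R a"
  have c: "c > 0" "c\<^sup>2 * (a \<bullet> a) = 2 / \<beta>"
    using False \<beta> by (auto simp: c_def power_divide dot_square_norm)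
  have "u \<bullet> u = c\<^sup>2 * (a \<bullet> a)" by (simp add: u_def power2_eq_square)
  then have uu: "\<beta> * (u \<bullet> u) = 2" using c \<beta> by simp
  define J where "J = (\<integral>\<^sup>+x. ennreal ((x \<bullet> a)\<^sup>2 * gauss_weight \<beta> x) \<partial>lborel)"
  have pt: "exp (- 1) * (2 + \<beta>\<^sup>2 * c\<^sup>2 * (x \<bullet> a)\<^sup>2) * gauss_weight \<beta> x
      \<le> gauss_weight \<beta> (u + x) + gauss_weight \<beta> (u - x)" for x
  proof -
    define y where "y = \<beta> * c * (x \<bullet> a)"
    have "gauss_weight \<beta> (u + x) + gauss_weight \<beta> (u - x) = exp (- 1) * gauss_weight \<beta> x * (exp (- y) + exp y)"
    proof -
      have "- \<beta> * ((u + x) \<bullet> (u + x)) / 2 = - 1 + (- \<beta> * (x \<bullet> x) / 2) + (- y)"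
      proof -
        have "(u + x) \<bullet> (u + x) = u \<bullet> u + 2 * (c * (x \<bullet> a)) + x \<bullet> x"
          by (simp add: inner_add_left inner_add_right u_def inner_commute[of a x] algebra_simps)
        then have "\<beta> * ((u + x) \<bullet> (u + x)) = 2 + 2 * y + \<beta> * (x \<bullet> x)"
          using uu by (simp add: y_def distrib_left)
        then show ?thesis by simp
      qed
      moreover have "- \<beta> * ((u - x) \<bullet> (u - x)) / 2 = - 1 + (- \<beta> * (x \<bullet> x) / 2) + y"
      proof -
        have "(u - x) \<bullet> (u - x) = u \<bullet> u - 2 * (c * (x \<bullet> a)) + x \<bullet> x"
          by (simp add: inner_diff_left inner_diff_right u_def inner_commute[of a x] algebra_simps)
        then have "\<beta> * ((u - x) \<bullet> (u - x)) = 2 - 2 * y + \<beta> * (x \<bullet> x)"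
          using uu by (simp add: y_def distrib_left right_diff_distrib)
        then show ?thesis by simp
      qed
      ultimately show ?thesis unfolding gauss_weight_def by (simp only: exp_add) (simp add: algebra_simps)
    qed
    \<comment> \<open>The difference \<open>exp t + exp (- t) - 2\<close> is the square of
      \<open>exp (t/2) - exp (- (t/2))\<close>, and for \<open>0 \<le> t\<close> the latter is at
      least \<open>t\<close>.\<close>
    moreover have "2 + y\<^sup>2 \<le> exp (- y) + exp y"
    proof -
      have "2 + t\<^sup>2 \<le> exp (- t) + exp t" if "0 \<le> t" for t :: real
      proof -
        have "2 + t\<^sup>2 \<le> 2 + (exp (t/2) - exp (- (t/2)))\<^sup>2"
        proof -
          have "t \<le> exp (t/2) - exp (- (t/2))"
            using real_le_x_sinh[of "t / 2"] that by (simp add: exp_minus)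
          then have "t\<^sup>2 \<le> (exp (t/2) - exp (- (t/2)))\<^sup>2" using that by (intro power_mono) auto
          then show ?thesis by simp
        qed
        also have "\<dots> = exp (- t) + exp t"
          by (simp add: power2_eq_square algebra_simps flip: exp_add)
        finally show ?thesis .
      qed
      from this[of y] this[of "- y"] show ?thesis by (cases "0 \<le> y") auto
    qed
    ultimately show ?thesis
      using mult_left_mono[of "2 + y\<^sup>2" "exp (- y) + exp y" "exp (- 1) * gauss_weight \<beta> x"]
      by (simp add: y_def power_mult_distrib mult_ac)
  qed
  have "(\<integral>\<^sup>+x. ennreal (exp (- 1) * (2 + \<beta>\<^sup>2 * c\<^sup>2 * (x \<bullet> a)\<^sup>2) * gauss_weight \<beta> x) \<partial>lborel)
    \<le> (\<integral>\<^sup>+x. ennreal (gauss_weight \<beta> (u + x)) + ennreal (gauss_weight \<beta> (u - x)) \<partial>lborel)"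
    by (intro nn_integral_mono) (auto simp flip: ennreal_plus intro!: ennreal_leI pt)
  also have "\<dots> = ennreal Z + ennreal Z"
    using nn_integral_lborel_translate[of "\<lambda>x. ennreal (gauss_weight \<beta> x)" u]
      nn_integral_lborel_reflect[of "\<lambda>x. ennreal (gauss_weight \<beta> x)" u] gauss_mass[OF \<beta>, where 'a = 'a]
    by (subst nn_integral_add) (simp_all add: Z_def)
  also have "\<dots> = ennreal (2 * Z)" using gauss_mass(2)[OF \<beta>, where 'a = 'a] by (simp add: Z_def flip: ennreal_plus)
  also have "(\<integral>\<^sup>+x. ennreal (exp (- 1) * (2 + \<beta>\<^sup>2 * c\<^sup>2 * (x \<bullet> a)\<^sup>2) * gauss_weight \<beta> x) \<partial>lborel)
    = (\<integral>\<^sup>+x. ennreal (2 * exp (- 1)) * ennreal (gauss_weight \<beta> x)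
        + ennreal (exp (- 1) * \<beta>\<^sup>2 * c\<^sup>2) * ennreal ((x \<bullet> a)\<^sup>2 * gauss_weight \<beta> x) \<partial>lborel)"
    by (intro nn_integral_cong) (auto simp flip: ennreal_plus ennreal_mult intro!: arg_cong[where f = ennreal] simp: algebra_simps)
  also have "\<dots> = ennreal (2 * exp (- 1)) * ennreal Z + ennreal (exp (- 1) * \<beta>\<^sup>2 * c\<^sup>2) * J"
    using gauss_mass[OF \<beta>, where 'a = 'a] by (simp add: nn_integral_add nn_integral_cmult J_def Z_def)
  finally have le: "ennreal (2 * exp (- 1)) * ennreal Z + ennreal (exp (- 1) * \<beta>\<^sup>2 * c\<^sup>2) * J \<le> ennreal (2 * Z)" .
  have Zpos: "0 < Z" using gauss_mass(2)[OF \<beta>] by (simp add: Z_def)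
  have k: "0 < exp (- 1) * \<beta>\<^sup>2 * c\<^sup>2" using \<beta> c by simp
  \<comment> \<open>Finiteness of \<open>J\<close> must come first: only then can the mass term be
    subtracted in the real numbers.\<close>
  have "J \<noteq> \<top>"
  proof
    assume "J = \<top>"
    then show False using le \<beta> c by (simp add: ennreal_mult_top top_unique)
  qed
  then obtain j where j: "J = ennreal j" "0 \<le> j" by (cases J) auto
  have "2 * exp (- 1) * Z + exp (- 1) * \<beta>\<^sup>2 * c\<^sup>2 * j \<le> 2 * Z"
    using le j Zpos k by (simp flip: ennreal_plus ennreal_mult)
  then have "exp (1::real) * (2 * exp (- 1) * Z + exp (- 1) * \<beta>\<^sup>2 * c\<^sup>2 * j) \<le> exp 1 * (2 * Z)"
    by (intro mult_left_mono) auto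
  moreover have "exp (1::real) * (2 * exp (- 1) * Z + exp (- 1) * \<beta>\<^sup>2 * c\<^sup>2 * j) = 2 * Z + \<beta>\<^sup>2 * c\<^sup>2 * j"
    by (simp add: exp_minus field_simps)
  ultimately have "2 * Z + \<beta>\<^sup>2 * c\<^sup>2 * j \<le> exp 1 * (2 * Z)" by simp
  \<comment> \<open>Replacing \<open>exp 1\<close> by 3 produces the factor 2 in
    \<open>2 / \<beta>\<close>; the exact second moment has the factor 1.\<close>
  also have "\<dots> \<le> 3 * (2 * Z)" using exp_le Zpos by (intro mult_right_mono) auto
  finally have "\<beta>\<^sup>2 * c\<^sup>2 * j \<le> 4 * Z" by simp
  then have "(\<beta>\<^sup>2 * c\<^sup>2 * j) * (a \<bullet> a) \<le> (4 * Z) * (a \<bullet> a)" by (intro mult_right_mono) auto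
  moreover have "(\<beta>\<^sup>2 * c\<^sup>2 * j) * (a \<bullet> a) = \<beta> * (2 * j)"
  proof -
    have "(\<beta>\<^sup>2 * c\<^sup>2 * j) * (a \<bullet> a) = \<beta>\<^sup>2 * j * (c\<^sup>2 * (a \<bullet> a))" by simp
    also have "\<dots> = \<beta>\<^sup>2 * j * (2 / \<beta>)" by (simp only: c(2))
    also have "\<dots> = \<beta> * (2 * j)" using \<beta> by (simp add: power2_eq_square)
    finally show ?thesis .
  qed
  ultimately have "\<beta> * (2 * j) \<le> 4 * Z * (a \<bullet> a)" by simp
  then have "j \<le> 2 / \<beta> * (a \<bullet> a) * Z" using \<beta> by (simp add: field_simps)
  then show ?thesis by (simp add: J_def[symmetric] j Z_def[symmetric] ennreal_leI)
qed simp

text \<open>Markov's inequality for the square. The radius 0 occurs for a vanishing covariance, and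
  then \<open>Z\<close> is 0 almost surely.\<close>

lemma (in prob_space) second_moment_tail:
  assumes [measurable]: "Z \<in> borel_measurable M" and int: "integrable M (\<lambda>w. (Z w)\<^sup>2)"
    and R: "0 \<le> R" and a: "0 \<le> a" and le: "expectation (\<lambda>w. (Z w)\<^sup>2) \<le> a * R\<^sup>2"
  shows "prob {w \<in> space M. R < \<bar>Z w\<bar>} \<le> a"
proof (cases "R = 0")
  case True
  then have "expectation (\<lambda>w. (Z w)\<^sup>2) = 0" using le by (simp add: antisym)
  then have "AE w in M. (Z w)\<^sup>2 = 0" using int by (subst (asm) integral_nonneg_eq_0_iff_AE) auto
  then have "AE w in M. \<not> R < \<bar>Z w\<bar>" using True by (auto elim: eventually_mono)
  then have "prob {w \<in> space M. R < \<bar>Z w\<bar>} = 0" by (subst prob_eq_0) auto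
  then show ?thesis using a by simp
next
  case False
  have "prob {w \<in> space M. R < \<bar>Z w\<bar>} \<le> prob {w \<in> space M. R\<^sup>2 \<le> (Z w)\<^sup>2}"
    using R by (intro finite_measure_mono) (auto simp: abs_le_square_iff[symmetric])
  also have "\<dots> \<le> expectation (\<lambda>w. (Z w)\<^sup>2) / R\<^sup>2"
    using False R int by (intro integral_Markov_inequality_measure[where A = "{}"]) auto
  also have "\<dots> \<le> a" using le False R by (simp add: divide_le_eq)
  finally show ?thesis .
qed


text \<open>A PAC-Bayesian tail count: the exponential moment of the number of large inner products is
  integrated against a Gaussian weight truncated to directions of small variance. The bound for a
  fixed direction \<open>v\<close> follows by translating the weight by \<open>v\<close> and by \<open>- v\<close>, since one of
  \<open>y \<bullet> (v + g)\<close>, \<open>y \<bullet> (v - g)\<close> is at least as large as \<open>y \<bullet> v\<close>.\<close>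

lemma (in prob_space) uniform_tail_count:
  fixes Y :: "'i \<Rightarrow> 'a \<Rightarrow> 'b::euclidean_space"
  assumes I: "finite I" "real (card I) \<le> L" and L: "0 < L" and R: "0 \<le> R"
    and indep: "indep_vars (\<lambda>_. borel) Y I"
    and E: "finite E" "\<And>e. e \<in> E \<Longrightarrow> 0 \<le> l e"
    and Q: "\<And>x. Q x = (\<Sum>e\<in>E. l e * (x \<bullet> e)\<^sup>2)"
    and int: "\<And>k x. k \<in> I \<Longrightarrow> integrable M (\<lambda>w. (Y k w \<bullet> x)\<^sup>2)"
    and mom: "\<And>k x. k \<in> I \<Longrightarrow> expectation (\<lambda>w. (Y k w \<bullet> x)\<^sup>2) \<le> Q x"
    and op: "\<And>v. norm v = 1 \<Longrightarrow> Q v \<le> R\<^sup>2 / 15000"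
    and tr: "1000 / L * (\<Sum>e\<in>E. l e * (e \<bullet> e)) \<le> R\<^sup>2 / 18000"
  obtains A where "A \<in> events" "prob A \<ge> 1 - exp (- L / 2000)"
    "\<And>w v. w \<in> A \<Longrightarrow> norm v = 1 \<Longrightarrow> real (card {k\<in>I. R < \<bar>Y k w \<bullet> v\<bar>}) \<le> 2 + 0.0046 * L"
proof -
  \<comment> \<open>A larger \<open>\<beta>\<close> shrinks the variance \<open>Q\<close> of the
    random direction but enters the final count additively as \<open>\<beta>\<close>. The value fits
    the hypothesis \<open>tr\<close>, since \<open>2 / \<beta> = 1000 / L\<close>.\<close>
  define \<beta> where "\<beta> = L / 500"
  have \<beta>: "0 < \<beta>" using L by (simp add: \<beta>_def)
  define Z where "Z = gauss_mass TYPE('b) \<beta>"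
  have Z: "0 < Z" "(\<integral>\<^sup>+x. ennreal (gauss_weight \<beta> (x :: 'b)) \<partial>lborel) = ennreal Z"
    using gauss_mass[OF \<beta>, where 'a = 'b] by (auto simp: Z_def)
  define n where "n w x = (\<Sum>k\<in>I. if R < \<bar>Y k w \<bullet> x\<bar> then 1 else 0 :: real)" for w x
  have n_card: "n w x = real (card {k\<in>I. R < \<bar>Y k w \<bullet> x\<bar>})" for w x
    using I(1) by (simp add: n_def sum.If_cases Int_def)
  \<comment> \<open>The three radii fit together: \<open>Q v \<le> R\<^sup>2 / 15000\<close>,
    \<open>Q g \<le> R\<^sup>2 / 9000\<close> on the set \<open>H\<close> below, and 2/15000 +
    2/9000 < 1/2500, so that \<open>v + g\<close> and \<open>v - g\<close> lie in
    \<open>D\<close>.\<close>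
  define D where "D = {x. Q x \<le> R\<^sup>2 / 2500}"
  have [measurable]: "Q \<in> borel_measurable borel" unfolding Q by measurable
  have [measurable]: "D \<in> sets borel" unfolding D_def by measurable
  have Ym [measurable]: "k \<in> I \<Longrightarrow> Y k \<in> borel_measurable M" for k
    using indep by (auto simp: indep_vars_def)
  have nm [measurable]: "(\<lambda>(w, x). n w x) \<in> borel_measurable (M \<Otimes>\<^sub>M borel)"
    unfolding n_def by measurable
  have nm1 [measurable]: "n w \<in> borel_measurable borel" for w
    unfolding n_def by measurable
  define W where "W w = (\<integral>\<^sup>+x. ennreal (exp (n w x) * gauss_weight \<beta> x) * indicator D x \<partial>lborel)" for w
  interpret P: pair_sigma_finite M lborel ..
  have Wm [measurable]: "W \<in> borel_measurable M"
    unfolding W_def by measurable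

  have Q_nonneg: "0 \<le> Q x" for x using E by (auto simp: Q intro!: sum_nonneg)
  \<comment> \<open>For fixed \<open>x\<close> in \<open>D\<close> the count is a sum of independent
    indicators of probability at most 1/2500, and \<open>exp 1 - 1 \<le> 2\<close>.\<close>
  have exp_mom: "(\<integral>\<^sup>+w. ennreal (exp (n w x)) \<partial>M) \<le> ennreal (exp (2 * L / 2500))" if x: "x \<in> D" for x
  proof -
    have "(\<integral>\<^sup>+w. ennreal (exp (n w x)) \<partial>M)
        = (\<integral>\<^sup>+w. (\<Prod>k\<in>I. ennreal (exp (if R < \<bar>Y k w \<bullet> x\<bar> then 1 else 0))) \<partial>M)"
      using I(1) by (simp add: n_def exp_sum prod_ennreal)
    also have "\<dots> = (\<Prod>k\<in>I. \<integral>\<^sup>+w. ennreal (exp (if R < \<bar>Y k w \<bullet> x\<bar> then 1 else 0)) \<partial>M)"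
      by (intro indep_vars_nn_integral I indep_vars_compose2[OF indep]) auto
    also have "\<dots> \<le> (\<Prod>k\<in>I. ennreal (exp (2 / 2500)))"
    proof (rule prod_mono_ennreal)
      fix k assume k: "k \<in> I"
      have [measurable]: "Y k \<in> borel_measurable M" using k by simp
      let ?B = "{w \<in> space M. R < \<bar>Y k w \<bullet> x\<bar>}"
      have "prob ?B \<le> 1 / 2500"
        using int[OF k] R mom[OF k, of x] x by (intro second_moment_tail) (auto simp: D_def)
      have "(\<integral>\<^sup>+w. ennreal (exp (if R < \<bar>Y k w \<bullet> x\<bar> then 1 else 0)) \<partial>M)
          \<le> (\<integral>\<^sup>+w. 1 + ennreal 2 * indicator ?B w \<partial>M)"
        using ennreal_leI[OF exp_le] by (intro nn_integral_mono) (auto simp: indicator_def)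
      also have "\<dots> = 1 + ennreal 2 * emeasure M ?B"
        by (simp add: nn_integral_add nn_integral_cmult emeasure_space_1)
      also have "\<dots> = ennreal (1 + 2 * prob ?B)"
        by (simp add: emeasure_eq_measure ennreal_mult ennreal_plus)
      also have "\<dots> \<le> ennreal (exp (2 / 2500))"
        using \<open>prob ?B \<le> 1 / 2500\<close> exp_ge_add_one_self[of "2 / 2500"] by (intro ennreal_leI) linarith
      finally show "(\<integral>\<^sup>+w. ennreal (exp (if R < \<bar>Y k w \<bullet> x\<bar> then 1 else 0)) \<partial>M) \<le> ennreal (exp (2 / 2500))" .
    qed
    also have "\<dots> = ennreal (exp (real (card I) * (2 / 2500)))"
      by (simp add: ennreal_power flip: exp_of_nat_mult)
    also have "\<dots> \<le> ennreal (exp (2 * L / 2500))" using I(2) by (intro ennreal_leI) simp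
    finally show ?thesis .
  qed
  have "(\<integral>\<^sup>+w. W w \<partial>M) = (\<integral>\<^sup>+x. \<integral>\<^sup>+w. ennreal (exp (n w x) * gauss_weight \<beta> x) * indicator D x \<partial>M \<partial>lborel)"
    unfolding W_def by (intro P.Fubini'[symmetric]) measurable
  also have "\<dots> = (\<integral>\<^sup>+x. (\<integral>\<^sup>+w. ennreal (exp (n w x)) \<partial>M) * (ennreal (gauss_weight \<beta> x) * indicator D x) \<partial>lborel)"
    by (intro nn_integral_cong) (simp add: nn_integral_multc ennreal_mult mult.assoc)
  also have "\<dots> \<le> (\<integral>\<^sup>+x. ennreal (exp (2 * L / 2500)) * ennreal (gauss_weight \<beta> (x :: 'b)) \<partial>lborel)"
    using exp_mom by (intro nn_integral_mono) (auto simp: indicator_def intro!: mult_right_mono)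
  also have "\<dots> = ennreal (exp (2 * L / 2500) * Z)"
    using Z by (simp add: nn_integral_cmult ennreal_mult)
  finally have EW: "(\<integral>\<^sup>+w. W w \<partial>M) \<le> ennreal (exp (2 * L / 2500) * Z)" .

  \<comment> \<open>A Markov threshold for \<open>W\<close>: it is exceeded with probability at most
    \<open>exp (- L / 2000)\<close>.\<close>
  define t where "t = Z * exp (2 * L / 2500 + L / 2000)"
  have t: "0 < t" using Z by (simp add: t_def)
  define A where "A = {w \<in> space M. W w < ennreal t}"
  have A: "A \<in> events" unfolding A_def by measurable
  have "ennreal t * emeasure M (space M - A) = (\<integral>\<^sup>+w. ennreal t * indicator (space M - A) w \<partial>M)"
    using A by (subst nn_integral_cmult_indicator) auto
  also have "\<dots> \<le> (\<integral>\<^sup>+w. W w \<partial>M)"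
    by (intro nn_integral_mono) (auto simp: A_def indicator_def)
  also note EW
  finally have "t * prob (space M - A) \<le> exp (2 * L / 2500) * Z"
    using t Z by (simp add: emeasure_eq_measure flip: ennreal_mult)
  also have "\<dots> = t * exp (- L / 2000)"
    unfolding t_def exp_add exp_minus by (simp add: exp_minus)
  finally have "prob (space M - A) \<le> exp (- L / 2000)" using t by simp
  then have pA: "1 - exp (- L / 2000) \<le> prob A"
    using A prob_compl[OF A] by simp

  define T where "T = (\<Sum>e\<in>E. l e * (e \<bullet> e))"
  have T0: "0 \<le> T" using E by (auto simp: T_def intro!: sum_nonneg)
  have QT: "Q x \<le> T * (x \<bullet> x)" for x
    unfolding Q T_def sum_distrib_right
  proof (rule sum_mono)
    fix e assume "e \<in> E"
    then show "l e * (x \<bullet> e)\<^sup>2 \<le> l e * (e \<bullet> e) * (x \<bullet> x)"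
      using mult_left_mono[OF Cauchy_Schwarz_ineq[of x e], of "l e"] E(2) by (simp add: mult_ac)
  qed
  define H where "H = {x. Q x \<le> R\<^sup>2 / 9000}"
  have [measurable]: "H \<in> sets borel" unfolding H_def by measurable
  \<comment> \<open>The average of \<open>Q\<close> under the normalised weight is at most
    \<open>R\<^sup>2 / 18000\<close>, half of the threshold defining \<open>H\<close>; by Markov's
    inequality \<open>H\<close> carries at least half of the mass.\<close>
  have mass: "ennreal (Z / 2) \<le> (\<integral>\<^sup>+x. ennreal (gauss_weight \<beta> x) * indicator H x \<partial>lborel)"
  proof -
    have QZ: "(\<integral>\<^sup>+x. ennreal (Q x * gauss_weight \<beta> x) \<partial>lborel) \<le> ennreal (R\<^sup>2 / 18000 * Z)"
    proof -
      have "(\<integral>\<^sup>+x. ennreal (Q x * gauss_weight \<beta> x) \<partial>lborel)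
          = (\<integral>\<^sup>+x. (\<Sum>e\<in>E. ennreal (l e) * ennreal ((x \<bullet> e)\<^sup>2 * gauss_weight \<beta> x)) \<partial>lborel)"
        using E by (intro nn_integral_cong)
          (simp add: Q sum_distrib_right ennreal_mult[symmetric] sum_ennreal mult.assoc)
      also have "\<dots> = (\<Sum>e\<in>E. ennreal (l e) * (\<integral>\<^sup>+x. ennreal ((x \<bullet> e)\<^sup>2 * gauss_weight \<beta> x) \<partial>lborel))"
        by (simp add: nn_integral_sum nn_integral_cmult)
      also have "\<dots> \<le> (\<Sum>e\<in>E. ennreal (l e) * ennreal (2 / \<beta> * (e \<bullet> e) * Z))"
        unfolding Z_def by (intro sum_mono mult_left_mono gauss_second_moment \<beta>) auto
      also have "\<dots> = ennreal (\<Sum>e\<in>E. l e * (2 / \<beta> * (e \<bullet> e) * Z))"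
        using E Z \<beta> by (simp add: ennreal_mult[symmetric] sum_ennreal)
      also have "(\<Sum>e\<in>E. l e * (2 / \<beta> * (e \<bullet> e) * Z)) = 1000 / L * T * Z"
        by (simp add: T_def \<beta>_def sum_distrib_left sum_distrib_right sum_divide_distrib mult_ac)
      also have "\<dots> \<le> R\<^sup>2 / 18000 * Z" using tr Z by (intro mult_right_mono) (auto simp: T_def)
      finally show ?thesis by (simp add: ennreal_leI)
    qed
    have "(\<integral>\<^sup>+x. ennreal (gauss_weight \<beta> x) * indicator (- H) x \<partial>lborel) \<le> ennreal (Z / 2)"
    proof (cases "R = 0")
      case True
      then have "1000 / L * T \<le> 0" using tr by (simp add: T_def)
      then have "T = 0" using T0 L by (simp add: mult_le_0_iff divide_le_0_iff)
      then have "H = UNIV" using QT True by (auto simp: H_def)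
      then show ?thesis by simp
    next
      case False
      have "(\<integral>\<^sup>+x. ennreal (gauss_weight \<beta> x) * indicator (- H) x \<partial>lborel)
          \<le> (\<integral>\<^sup>+x. ennreal (9000 / R\<^sup>2) * ennreal (Q x * gauss_weight \<beta> x) \<partial>lborel)"
      proof (intro nn_integral_mono)
        fix x :: 'b
        show "ennreal (gauss_weight \<beta> x) * indicator (- H) x \<le> ennreal (9000 / R\<^sup>2) * ennreal (Q x * gauss_weight \<beta> x)"
        proof (cases "x \<in> H")
          case False
          then have "1 \<le> 9000 / R\<^sup>2 * Q x" using \<open>R \<noteq> 0\<close> by (simp add: H_def field_simps)
          then have "gauss_weight \<beta> x \<le> 9000 / R\<^sup>2 * Q x * gauss_weight \<beta> x"
            using mult_right_mono[of 1 "9000 / R\<^sup>2 * Q x" "gauss_weight \<beta> x"] by simp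
          then show ?thesis using Q_nonneg by (simp add: ennreal_mult[symmetric] mult.assoc indicator_def ennreal_leI)
        qed simp
      qed
      also have "\<dots> \<le> ennreal (9000 / R\<^sup>2) * ennreal (R\<^sup>2 / 18000 * Z)"
        by (subst nn_integral_cmult) (simp, intro mult_left_mono QZ zero_le)
      also have "\<dots> = ennreal (Z / 2)" using False Z by (simp add: ennreal_mult[symmetric])
      finally show ?thesis .
    qed
    moreover have "ennreal Z = (\<integral>\<^sup>+x. ennreal (gauss_weight \<beta> x) * indicator H x \<partial>lborel)
        + (\<integral>\<^sup>+x. ennreal (gauss_weight \<beta> x) * indicator (- H) x \<partial>lborel)"
      unfolding Z(2)[symmetric]
      by (subst nn_integral_add[symmetric]) (auto intro!: nn_integral_cong simp: indicator_def)
    ultimately have "ennreal Z \<le> (\<integral>\<^sup>+x. ennreal (gauss_weight \<beta> x) * indicator H x \<partial>lborel) + ennreal (Z / 2)"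
      by (simp add: add_left_mono)
    then show ?thesis
      using Z(1) by (cases "\<integral>\<^sup>+x. ennreal (gauss_weight \<beta> x) * indicator H x \<partial>lborel")
        (auto simp flip: ennreal_plus)
  qed

  have "real (card {k\<in>I. R < \<bar>Y k w \<bullet> v\<bar>}) \<le> 2 + 0.0046 * L" if w: "w \<in> A" and v: "norm v = 1" for w v
  proof -
    define F where "F x = exp (n w x) * gauss_weight \<beta> x" for x
    have [measurable]: "F \<in> borel_measurable borel" unfolding F_def by measurable
    define c where "c = exp (n w v / 2 - \<beta> / 2)"
    have QHD: "v + g \<in> D" "v - g \<in> D" if g: "g \<in> H" for g
    proof -
      have "Q (v + s *\<^sub>R g) \<le> 2 * Q v + 2 * Q g" if s: "s\<^sup>2 = 1" for s
      proof -
        have "((v + s *\<^sub>R g) \<bullet> e)\<^sup>2 \<le> 2 * (v \<bullet> e)\<^sup>2 + 2 * (g \<bullet> e)\<^sup>2" for e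
        proof -
          have "0 \<le> (v \<bullet> e - s * (g \<bullet> e))\<^sup>2" by simp
          moreover have "(s * (g \<bullet> e))\<^sup>2 = (g \<bullet> e)\<^sup>2" using s by (simp add: power_mult_distrib)
          ultimately show ?thesis by (simp add: inner_add_left power2_sum power2_diff)
        qed
        then have "Q (v + s *\<^sub>R g) \<le> (\<Sum>e\<in>E. l e * (2 * (v \<bullet> e)\<^sup>2 + 2 * (g \<bullet> e)\<^sup>2))"
          unfolding Q using E by (intro sum_mono mult_left_mono) auto
        also have "\<dots> = 2 * Q v + 2 * Q g"
          by (simp add: Q sum_distrib_left sum.distrib distrib_left mult_ac)
        finally show ?thesis .
      qed
      from this[of 1] this[of "- 1"] have "Q (v + g) \<le> 2 * Q v + 2 * Q g" "Q (v - g) \<le> 2 * Q v + 2 * Q g"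
        by simp_all
      moreover have "Q g \<le> R\<^sup>2 / 9000" using g by (simp add: H_def)
      ultimately show "v + g \<in> D" "v - g \<in> D"
        using op[OF v] zero_le_power2[of R] unfolding D_def mem_Collect_eq by linarith+
    qed
    \<comment> \<open>The inequality between arithmetic and geometric means handles the sum of the
      two exponentials, and the parallelogram law removes the terms linear in \<open>g\<close> from
      the exponents.\<close>
    have pt: "2 * c * gauss_weight \<beta> g \<le> F (v + g) + F (v - g)" for g
    proof -
      have "n w v \<le> n w (v + g) + n w (v - g)"
        unfolding n_def sum.distrib[symmetric] by (intro sum_mono) (auto simp: inner_add_right inner_diff_right)
      define a b where "a = n w (v + g) - \<beta> * ((v + g) \<bullet> (v + g)) / 2" 
        and "b = n w (v - g) - \<beta> * ((v - g) \<bullet> (v - g)) / 2"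
      have "(v + g) \<bullet> (v + g) + (v - g) \<bullet> (v - g) = 2 + 2 * (g \<bullet> g)"
        using v by (simp add: inner_add_left inner_add_right inner_diff_left inner_diff_right inner_commute norm_eq_1)
      then have "\<beta> * ((v + g) \<bullet> (v + g)) + \<beta> * ((v - g) \<bullet> (v - g)) = 2 * \<beta> + 2 * (\<beta> * (g \<bullet> g))"
        by (metis distrib_left mult.left_commute mult.commute)
      then have ab: "n w v / 2 - \<beta> / 2 - \<beta> * (g \<bullet> g) / 2 \<le> (a + b) / 2"
        using \<open>n w v \<le> n w (v + g) + n w (v - g)\<close> by (simp add: a_def b_def)
      have "c * gauss_weight \<beta> g = exp (n w v / 2 - \<beta> / 2 - \<beta> * (g \<bullet> g) / 2)"
        by (simp add: c_def gauss_weight_def flip: exp_add)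
      also have "\<dots> \<le> exp ((a + b) / 2)" using ab by simp
      finally have "2 * (c * gauss_weight \<beta> g) \<le> 2 * exp ((a + b) / 2)" by simp
      also have "\<dots> \<le> exp a + exp b"
      proof -
        have "0 \<le> (exp (a / 2) - exp (b / 2))\<^sup>2" by simp
        also have "\<dots> = exp a + exp b - 2 * exp ((a + b) / 2)"
          by (simp add: power2_eq_square algebra_simps add_divide_distrib flip: exp_add)
        finally show ?thesis by simp
      qed
      also have "\<dots> = F (v + g) + F (v - g)"
        by (simp add: a_def b_def F_def gauss_weight_def flip: exp_add)
      finally show ?thesis by simp
    qed
    have W2: "W w = (\<integral>\<^sup>+x. ennreal (F (v + x)) * indicator D (v + x) \<partial>lborel)"
        "W w = (\<integral>\<^sup>+x. ennreal (F (v - x)) * indicator D (v - x) \<partial>lborel)"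
      unfolding W_def F_def[symmetric]
      using nn_integral_lborel_translate[of "\<lambda>x. ennreal (F x) * indicator D x" v]
        nn_integral_lborel_reflect[of "\<lambda>x. ennreal (F x) * indicator D x" v] by simp_all
    have "ennreal (2 * c) * ennreal (Z / 2) \<le> ennreal (2 * c) * (\<integral>\<^sup>+x. ennreal (gauss_weight \<beta> x) * indicator H x \<partial>lborel)"
      by (intro mult_left_mono mass) auto
    also have "\<dots> = (\<integral>\<^sup>+x. ennreal (2 * c) * (ennreal (gauss_weight \<beta> x) * indicator H x) \<partial>lborel)"
      by (subst nn_integral_cmult) auto
    also have "\<dots> \<le> (\<integral>\<^sup>+x. ennreal (F (v + x)) * indicator D (v + x) + ennreal (F (v - x)) * indicator D (v - x) \<partial>lborel)"
    proof (rule nn_integral_mono)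
      fix x :: 'b
      show "ennreal (2 * c) * (ennreal (gauss_weight \<beta> x) * indicator H x)
        \<le> ennreal (F (v + x)) * indicator D (v + x) + ennreal (F (v - x)) * indicator D (v - x)"
      proof (cases "x \<in> H")
        case True
        have "ennreal (2 * c * gauss_weight \<beta> x) \<le> ennreal (F (v + x) + F (v - x))"
          by (intro ennreal_leI pt)
        then show ?thesis using True QHD[OF True] by (simp add: ennreal_mult[symmetric] ennreal_plus F_def c_def)
      qed simp
    qed
    also have "\<dots> = W w + W w"
      by (subst nn_integral_add) (auto simp: W2[symmetric])
    also have "\<dots> \<le> ennreal t + ennreal t" using w by (intro add_mono) (auto simp: A_def)
    finally have "c * Z \<le> 2 * t"
      using t Z by (simp add: c_def ennreal_mult[symmetric] flip: ennreal_plus)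
    then have "c \<le> 2 * exp (2 * L / 2500 + L / 2000)" using Z by (simp add: t_def field_simps)
    also have "\<dots> \<le> exp 1 * exp (2 * L / 2500 + L / 2000)" using exp_ge_add_one_self[of 1] by (intro mult_right_mono) auto
    finally have "n w v / 2 - \<beta> / 2 \<le> 1 + (2 * L / 2500 + L / 2000)" by (simp add: c_def flip: exp_add)
    \<comment> \<open>Multiplication by 2 gives 2 + L/500 + 4L/2500 + L/1000 = 2 + 0.0046 L.\<close>
    then show ?thesis by (simp add: n_card \<beta>_def)
  qed
  then show ?thesis using that[OF A pA] by blast
qed


section \<open>Second moments of sums and the good event for the block means\<close>

lemma outer_quad: "x \<bullet> (outer v *v x) = (v \<bullet> x)\<^sup>2"
  by (simp add: outer_def matrix_vector_mult_def inner_vec_def power2_eq_square sum_product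
      sum_distrib_left sum_distrib_right mult_ac)

lemma bounded_linear_quad: "bounded_linear (\<lambda>A :: real^'n^'n. x \<bullet> (A *v x))"
proof -
  have "linear (\<lambda>A :: real^'n^'n. x \<bullet> (A *v x))"
    by (rule linearI) (simp_all add: matrix_vector_mult_add_rdistrib inner_add_right scaleR_matrix_vector_assoc[symmetric])
  then show ?thesis by (simp add: linear_conv_bounded_linear)
qed

text \<open>The mixed terms vanish by independence and centring, and the Loewner bound enters
  through the quadratic form at \<open>x\<close>.\<close>

lemma (in prob_space) sum_indep_second_moment:
  fixes X :: "'i \<Rightarrow> 'a \<Rightarrow> real^'n"
  assumes B: "finite B" and indep: "indep_vars (\<lambda>_. borel) X B"
    and int: "\<And>i. i \<in> B \<Longrightarrow> integrable M (X i)" and mean: "\<And>i. i \<in> B \<Longrightarrow> expectation (X i) = \<mu>"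
    and int2: "\<And>i. i \<in> B \<Longrightarrow> integrable M (\<lambda>w. outer (X i w - \<mu>))"
    and cov: "\<And>i. i \<in> B \<Longrightarrow> loewner_le (expectation (\<lambda>w. outer (X i w - \<mu>))) \<Sigma>"
  shows "integrable M (\<lambda>w. (\<Sum>i\<in>B. (X i w - \<mu>) \<bullet> x)\<^sup>2)"
    and "expectation (\<lambda>w. (\<Sum>i\<in>B. (X i w - \<mu>) \<bullet> x)\<^sup>2) \<le> real (card B) * (x \<bullet> (\<Sigma> *v x))"
proof -
  define Z where "Z i w = (X i w - \<mu>) \<bullet> x" for i w
  have intZ: "integrable M (Z i)" and EZ: "expectation (Z i) = 0" if "i \<in> B" for i
    using int[OF that] mean[OF that] by (auto simp: Z_def[abs_def] inner_diff_left prob_space)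
  have Z2: "(\<lambda>w. (Z i w)\<^sup>2) = (\<lambda>w. x \<bullet> (outer (X i w - \<mu>) *v x))" for i
    by (simp add: Z_def outer_quad)
  have intZ2: "integrable M (\<lambda>w. (Z i w)\<^sup>2)" if "i \<in> B" for i
    unfolding Z2 by (rule integrable_bounded_linear[OF bounded_linear_quad int2[OF that]])
  have EZ2: "expectation (\<lambda>w. (Z i w)\<^sup>2) \<le> x \<bullet> (\<Sigma> *v x)" if "i \<in> B" for i
  proof -
    have "expectation (\<lambda>w. (Z i w)\<^sup>2) = x \<bullet> (expectation (\<lambda>w. outer (X i w - \<mu>)) *v x)"
      unfolding Z2 by (rule integral_bounded_linear[OF bounded_linear_quad int2[OF that]])
    moreover have "0 \<le> x \<bullet> ((\<Sigma> - expectation (\<lambda>w. outer (X i w - \<mu>))) *v x)"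
      using cov[OF that] by (simp add: loewner_le_def psd_def)
    ultimately show ?thesis by (simp add: matrix_vector_mult_diff_rdistrib inner_diff_right)
  qed
  have indepZ: "indep_vars (\<lambda>_. borel) Z B"
    unfolding Z_def by (rule indep_vars_compose2[OF indep]) auto
  have cross: "integrable M (\<lambda>w. Z i w * Z j w) \<and> expectation (\<lambda>w. Z i w * Z j w) = 0"
    if "i \<in> B" "j \<in> B" "i \<noteq> j" for i j
  proof -
    have ind: "indep_vars (\<lambda>_. borel) Z {i, j}" by (rule indep_vars_subset[OF indepZ]) (use that in auto)
    have "integrable M (\<lambda>w. \<Prod>k\<in>{i, j}. Z k w)"
      by (rule indep_vars_integrable[OF _ ind]) (use that intZ in auto)
    moreover have "expectation (\<lambda>w. \<Prod>k\<in>{i, j}. Z k w) = (\<Prod>k\<in>{i, j}. expectation (Z k))"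
      by (rule indep_vars_lebesgue_integral[OF _ ind]) (use that intZ in auto)
    ultimately show ?thesis using that EZ by simp
  qed
  have sq: "(\<lambda>w. (\<Sum>i\<in>B. Z i w)\<^sup>2) = (\<lambda>w. \<Sum>i\<in>B. \<Sum>j\<in>B. Z i w * Z j w)"
    by (simp add: power2_eq_square sum_product)
  have int_prod: "integrable M (\<lambda>w. Z i w * Z j w)" if "i \<in> B" "j \<in> B" for i j
    using cross[OF that] intZ2[OF that(1)] by (cases "i = j") (auto simp: power2_eq_square)
  show "integrable M (\<lambda>w. (\<Sum>i\<in>B. (X i w - \<mu>) \<bullet> x)\<^sup>2)"
    unfolding Z_def[symmetric] sq by (intro Bochner_Integration.integrable_sum int_prod)
  have "expectation (\<lambda>w. (\<Sum>i\<in>B. Z i w)\<^sup>2) = (\<Sum>i\<in>B. \<Sum>j\<in>B. expectation (\<lambda>w. Z i w * Z j w))"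
    unfolding sq using int_prod by (simp add: integral_sum)
  also have "\<dots> = (\<Sum>i\<in>B. expectation (\<lambda>w. (Z i w)\<^sup>2))"
  proof (rule sum.cong)
    fix i assume i: "i \<in> B"
    have "(\<Sum>j\<in>B. expectation (\<lambda>w. Z i w * Z j w)) = (\<Sum>j\<in>B. if j = i then expectation (\<lambda>w. (Z i w)\<^sup>2) else 0)"
      using cross i by (intro sum.cong) (auto simp: power2_eq_square)
    then show "(\<Sum>j\<in>B. expectation (\<lambda>w. Z i w * Z j w)) = expectation (\<lambda>w. (Z i w)\<^sup>2)"
      using i B by simp
  qed simp
  also have "\<dots> \<le> (\<Sum>i\<in>B. x \<bullet> (\<Sigma> *v x))" by (intro sum_mono EZ2)
  finally show "expectation (\<lambda>w. (\<Sum>i\<in>B. (X i w - \<mu>) \<bullet> x)\<^sup>2) \<le> real (card B) * (x \<bullet> (\<Sigma> *v x))"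
    by (simp add: Z_def)
qed

text \<open>This is \<open>r_star\<close> divided by 808, the scale in which the accuracy of every
  stage is expressed.\<close>

definition rate :: "real^'n^'n \<Rightarrow> nat \<Rightarrow> nat \<Rightarrow> real" where
  "rate \<Sigma> N K = 1200 * sqrt (trace \<Sigma> / real N) + sqrt (1200 * op_norm \<Sigma> * real K / real N)"

lemma quad_le_op_norm: "x \<bullet> (A *v x) \<le> op_norm A * (x \<bullet> x)"
proof -
  have "x \<bullet> (A *v x) \<le> norm x * norm (A *v x)" by (rule norm_cauchy_schwarz)
  also have "\<dots> \<le> norm x * (op_norm A * norm x)"
    unfolding op_norm_def by (intro mult_left_mono onorm) (auto simp: linear_linear[symmetric])
  finally show ?thesis by (simp add: dot_square_norm power2_eq_square mult_ac)
qed

lemma op_norm_nonneg: "0 \<le> op_norm A"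
  unfolding op_norm_def by (intro onorm_pos_le) (simp add: linear_linear[symmetric])

lemma rate_nonneg: "psd \<Sigma> \<Longrightarrow> 0 \<le> rate \<Sigma> N K"
  unfolding rate_def by (intro add_nonneg_nonneg mult_nonneg_nonneg real_sqrt_ge_zero divide_nonneg_nonneg)
    (auto simp: psd_trace_nonneg op_norm_nonneg)

lemma rate_square:
  assumes "psd \<Sigma>"
  shows "1440000 * (trace \<Sigma> / real N) \<le> (rate \<Sigma> N K)\<^sup>2"
    and "1200 * op_norm \<Sigma> * real K / real N \<le> (rate \<Sigma> N K)\<^sup>2"
proof -
  define a where "a = 1200 * sqrt (trace \<Sigma> / real N)"
  define b where "b = sqrt (1200 * op_norm \<Sigma> * real K / real N)"
  have nn: "0 \<le> trace \<Sigma> / real N" "0 \<le> 1200 * op_norm \<Sigma> * real K / real N"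
    using psd_trace_nonneg[OF assms] op_norm_nonneg[of \<Sigma>] by auto
  have ab: "0 \<le> a" "0 \<le> b" using nn by (auto simp: a_def b_def)
  have "a\<^sup>2 = 1440000 * (trace \<Sigma> / real N)" "b\<^sup>2 = 1200 * op_norm \<Sigma> * real K / real N"
    using nn unfolding a_def b_def power_mult_distrib by simp_all
  moreover have "a\<^sup>2 \<le> (a + b)\<^sup>2" "b\<^sup>2 \<le> (a + b)\<^sup>2" using ab by (auto intro!: power_mono)
  moreover have "rate \<Sigma> N K = a + b" by (simp add: rate_def a_def b_def)
  ultimately show "1440000 * (trace \<Sigma> / real N) \<le> (rate \<Sigma> N K)\<^sup>2"
    "1200 * op_norm \<Sigma> * real K / real N \<le> (rate \<Sigma> N K)\<^sup>2" by simp_all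
qed

text \<open>The good event for the data: the analysis of the algorithm on a fixed sample uses no
  other property of the block means. The one percent is stated in natural numbers to suit
  counting.\<close>

definition central_blocks :: "nat \<Rightarrow> (nat \<Rightarrow> real^'n) \<Rightarrow> real^'n \<Rightarrow> real \<Rightarrow> bool" where
  "central_blocks K Xb \<mu> R \<longleftrightarrow>
     (\<forall>v. norm v = 1 \<longrightarrow> 100 * card {k\<in>{1..K}. R < \<bar>(Xb k - \<mu>) \<bullet> v\<bar>} \<le> K)"

text \<open>\<open>uniform_tail_count\<close> is applied to the blocks that avoid
  \<open>Out\<close>; these have independent means with second moment at most
  \<open>\<Sigma>\<close> divided by the block size. As the blocks are disjoint, at most
  \<open>card Out \<le> L / 600\<close> of them contain an outlier, and these are all counted as
  bad.\<close>

lemma central_blocks_probability: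
  fixes X :: "nat \<Rightarrow> 'w \<Rightarrow> real^'n"
  assumes data: "contaminated_data M N In Out X \<mu> \<Sigma>"
    and L: "600 \<le> L" "L \<le> N" "600 * card Out \<le> L" and B: "equal_blocks N L B"
  obtains A where "A \<in> sets M" "measure M A \<ge> 1 - exp (- real L / 2000)"
    "\<And>w. w \<in> A \<Longrightarrow> central_blocks L (block_means L B (\<lambda>i. X i w)) \<mu> (5 * rate \<Sigma> N L)"
proof -
  interpret prob_space M using data by (simp add: contaminated_data_def)
  have psd: "psd \<Sigma>" and InOut: "In \<union> Out = {1..N}" "In \<inter> Out = {}"
    and Xm: "\<And>i. i \<in> {1..N} \<Longrightarrow> X i \<in> borel_measurable M"
    and indep: "indep_vars (\<lambda>_. borel) X In"
    and In: "\<And>i. i \<in> In \<Longrightarrow> integrable M (X i)" "\<And>i. i \<in> In \<Longrightarrow> expectation (X i) = \<mu>"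
      "\<And>i. i \<in> In \<Longrightarrow> integrable M (\<lambda>w. outer (X i w - \<mu>))"
      "\<And>i. i \<in> In \<Longrightarrow> loewner_le (expectation (\<lambda>w. outer (X i w - \<mu>))) \<Sigma>"
    using data by (auto simp: contaminated_data_def)
  define n where "n = N div L"
  have n: "1 \<le> n" using L by (simp add: n_def div_greater_zero_iff Suc_le_eq)
  \<comment> \<open>Rounding the block size down costs at most a factor 2.\<close>
  have nN: "1 / real n \<le> 2 * real L / real N"
  proof -
    have "N = L * n + N mod L" by (simp add: n_def)
    moreover have "N mod L < L" using L by simp
    moreover have "L \<le> L * n" using n by simp
    ultimately have "N \<le> 2 * (L * n)" by linarith
    then have "real N \<le> 2 * (real L * real n)" by (metis of_nat_le_iff of_nat_mult of_nat_numeral)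
    then show ?thesis using n L by (simp add: field_simps)
  qed
  define I where "I = {k\<in>{1..L}. B k \<inter> Out = {}}"
  have Bk: "B k \<subseteq> {1..N}" "card (B k) = n" "finite (B k)" if "k \<in> {1..L}" for k
    proof -
    show "B k \<subseteq> {1..N}" "card (B k) = n" using B that by (auto simp: equal_blocks_def n_def)
    then show "finite (B k)" by (meson finite_atLeastAtMost finite_subset)
  qed
  have disj: "disjoint_family_on B {1..L}" using B by (simp add: equal_blocks_def)
  have BI: "B k \<subseteq> In" if "k \<in> I" for k using that Bk(1)[of k] InOut by (auto simp: I_def)
  have finOut: "finite Out" using InOut by (metis finite_Un finite_atLeastAtMost)
  have bad: "card ({1..L} - I) \<le> card Out"
  proof -
    \<comment> \<open>Choosing one outlier from every contaminated block is injective because the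
      blocks are disjoint.\<close>
    have "\<forall>k\<in>{1..L} - I. \<exists>i. i \<in> B k \<inter> Out" by (auto simp: I_def)
    then obtain f where f: "\<And>k. k \<in> {1..L} - I \<Longrightarrow> f k \<in> B k \<inter> Out" by metis
    have "inj_on f ({1..L} - I)"
    proof (rule inj_onI)
      fix k k' assume k: "k \<in> {1..L} - I" "k' \<in> {1..L} - I" "f k = f k'"
      then have "B k \<inter> B k' \<noteq> {}" using f[of k] f[of k'] by auto
      then show "k = k'" using disj k unfolding disjoint_family_on_def by blast
    qed
    then show ?thesis using f finOut by (intro card_inj_on_le[of f]) auto
  qed
  define Y where "Y k w = block_means L B (\<lambda>i. X i w) k - \<mu>" for k w
  have Y_mean: "Y k w = (1 / real n) *\<^sub>R (\<Sum>i\<in>B k. X i w) - \<mu>" if "k \<in> {1..L}" for k w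
    using that Bk(2)[OF that] by (simp add: Y_def block_means_def)
  have Y_sum: "Y k w \<bullet> x = (1 / real n) * (\<Sum>i\<in>B k. (X i w - \<mu>) \<bullet> x)" if "k \<in> {1..L}" for k w x
  proof -
    have "(\<Sum>i\<in>B k. (X i w - \<mu>) \<bullet> x) = (\<Sum>i\<in>B k. X i w) \<bullet> x - real n * (\<mu> \<bullet> x)"
      using Bk(2)[OF that] by (simp add: inner_diff_left sum_subtractf inner_sum_left)
    then show ?thesis using n by (simp add: Y_mean[OF that] inner_diff_left right_diff_distrib)
  qed
  have indepY: "indep_vars (\<lambda>_. borel) Y I"
  proof -
    have 1: "indep_vars (\<lambda>k. PiM (B k) (\<lambda>_. borel)) (\<lambda>k w. restrict (\<lambda>i. X i w) (B k)) I"
      using disj by (intro indep_vars_restrict[OF indep] BI) (auto simp: I_def disjoint_family_on_def)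
    have "indep_vars (\<lambda>_. borel) (\<lambda>k w. (1 / real n) *\<^sub>R (\<Sum>i\<in>B k. restrict (\<lambda>i. X i w) (B k) i) - \<mu>) I"
      by (rule indep_vars_compose2[OF 1]) measurable
    then show ?thesis
      by (rule indep_vars_cong[THEN iffD1, rotated 3]) (auto simp: Y_mean I_def fun_eq_iff)
  qed
  obtain E l where E: "orthonormal_basis E" and "\<forall>b\<in>E. \<Sigma> *v b = l b *\<^sub>R b"
    and l: "\<forall>b\<in>E. 0 \<le> l b" "\<forall>x. x \<bullet> (\<Sigma> *v x) = (\<Sum>b\<in>E. l b * (x \<bullet> b)\<^sup>2)" "trace \<Sigma> = sum l E"
    by (rule psd_spectral[OF psd])
  define R where "R = 5 * rate \<Sigma> N L"
  define Q where "Q x = (\<Sum>e\<in>E. l e / real n * (x \<bullet> e)\<^sup>2)" for x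
  have Qx: "Q x = (1 / real n) * (x \<bullet> (\<Sigma> *v x))" for x
    using l(2) by (simp add: Q_def sum_distrib_left sum_divide_distrib)
  have R2: "R\<^sup>2 = 25 * (rate \<Sigma> N L)\<^sup>2" by (simp add: R_def power_mult_distrib)
  have R0: "0 \<le> R" using rate_nonneg[OF psd] by (simp add: R_def)
  have moment: "integrable M (\<lambda>w. (Y k w \<bullet> x)\<^sup>2)" "expectation (\<lambda>w. (Y k w \<bullet> x)\<^sup>2) \<le> Q x" if k: "k \<in> I" for k x
  proof -
    have kL: "k \<in> {1..L}" using k by (simp add: I_def)
    note * = sum_indep_second_moment[of "B k" X \<mu> \<Sigma> x, OF Bk(3)[OF kL] indep_vars_subset[OF indep BI[OF k]]]
    have Bin: "i \<in> B k \<Longrightarrow> i \<in> In" for i using BI[OF k] by auto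
    have Ysq: "(\<lambda>w. (Y k w \<bullet> x)\<^sup>2) = (\<lambda>w. (1 / (real n)\<^sup>2) * (\<Sum>i\<in>B k. (X i w - \<mu>) \<bullet> x)\<^sup>2)"
      by (simp add: Y_sum[OF kL] power_mult_distrib power_divide)
    show "integrable M (\<lambda>w. (Y k w \<bullet> x)\<^sup>2)"
      unfolding Ysq using Bin In by (intro integrable_mult_right *) auto
    have "expectation (\<lambda>w. (Y k w \<bullet> x)\<^sup>2) = 1 / (real n)\<^sup>2 * expectation (\<lambda>w. (\<Sum>i\<in>B k. (X i w - \<mu>) \<bullet> x)\<^sup>2)"
      unfolding Ysq by simp
    also have "\<dots> \<le> 1 / (real n)\<^sup>2 * (real (card (B k)) * (x \<bullet> (\<Sigma> *v x)))"
      using Bin In by (intro mult_left_mono *) auto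
    also have "\<dots> = Q x" using n by (simp add: Qx Bk(2)[OF kL] power2_eq_square)
    finally show "expectation (\<lambda>w. (Y k w \<bullet> x)\<^sup>2) \<le> Q x" .
  qed
  have op: "Q v \<le> R\<^sup>2 / 15000" if v: "norm v = 1" for v
  proof -
    have "Q v \<le> 1 / real n * op_norm \<Sigma>"
      using quad_le_op_norm[of v \<Sigma>] v unfolding Qx by (intro mult_left_mono) (auto simp: norm_eq_1)
    also have "\<dots> \<le> (2 * real L / real N) * op_norm \<Sigma>" using nN op_norm_nonneg by (intro mult_right_mono) auto
    \<comment> \<open>The factor 5 in \<open>R\<close> matches here: 25/15000 = 1/600 =
      2/1200.\<close>
    also have "\<dots> = (1200 * op_norm \<Sigma> * real L / real N) / 600" by simp
    also have "\<dots> \<le> (rate \<Sigma> N L)\<^sup>2 / 600" by (intro divide_right_mono rate_square psd) simp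
    also have "\<dots> = R\<^sup>2 / 15000" by (simp add: R2)
    finally show ?thesis .
  qed
  have "(\<Sum>e\<in>E. l e / real n * (e \<bullet> e)) = trace \<Sigma> * (1 / real n)"
    using E by (simp add: l(3) sum_divide_distrib orthonormal_basis_def dot_square_norm)
  also have "\<dots> \<le> trace \<Sigma> * (2 * real L / real N)" using nN psd_trace_nonneg[OF psd] by (intro mult_left_mono)
  finally have "1000 / real L * (\<Sum>e\<in>E. l e / real n * (e \<bullet> e)) \<le> 1000 / real L * (trace \<Sigma> * (2 * real L / real N))"
    by (intro mult_left_mono) auto
  also have "\<dots> = 2000 * (trace \<Sigma> / real N)" using L by simp
  \<comment> \<open>Here \<open>R\<^sup>2 / 18000\<close> is the squared rate divided by 720, and
    1440000/720 = 2000.\<close>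
  also have "\<dots> \<le> R\<^sup>2 / 18000" unfolding R2 using rate_square(1)[OF psd, of N L] by linarith
  finally have tr: "1000 / real L * (\<Sum>e\<in>E. l e / real n * (e \<bullet> e)) \<le> R\<^sup>2 / 18000" .
  have "I \<subseteq> {1..L}" by (auto simp: I_def)
  then have I: "finite I" "real (card I) \<le> real L"
    using card_mono[of "{1..L}" I] by (auto intro: finite_subset)
  obtain A where A: "A \<in> events" "prob A \<ge> 1 - exp (- real L / 2000)"
    "\<And>w v. w \<in> A \<Longrightarrow> norm v = 1 \<Longrightarrow> real (card {k\<in>I. R < \<bar>Y k w \<bullet> v\<bar>}) \<le> 2 + 0.0046 * real L"
  proof (rule uniform_tail_count[OF I _ R0 indepY, of E "\<lambda>e. l e / real n" Q])
    show "finite E" using E by (simp add: orthonormal_basis_def)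
  qed (use L l moment op tr in \<open>auto simp: Q_def\<close>)
  have "central_blocks L (block_means L B (\<lambda>i. X i w)) \<mu> R" if w: "w \<in> A" for w
    unfolding central_blocks_def
  proof (intro allI impI)
    fix v :: "real^'n" assume v: "norm v = 1"
    have "card {k\<in>{1..L}. R < \<bar>Y k w \<bullet> v\<bar>} \<le> card ({k\<in>I. R < \<bar>Y k w \<bullet> v\<bar>} \<union> ({1..L} - I))"
      using I by (intro card_mono) auto
    also have "\<dots> \<le> card {k\<in>I. R < \<bar>Y k w \<bullet> v\<bar>} + card ({1..L} - I)" by (rule card_Un_le)
    finally have "real (card {k\<in>{1..L}. R < \<bar>Y k w \<bullet> v\<bar>}) \<le> 2 + 0.0046 * real L + real L / 600"
      using A(3)[OF w v] bad L(3) by simp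
    \<comment> \<open>For \<open>600 \<le> L\<close> the summand 2 is at most L/300, and 1/300 +
      0.0046 + 1/600 = 0.0096.\<close>
    also have "\<dots> \<le> real L / 100" using L by simp
    finally show "100 * card {k\<in>{1..L}. R < \<bar>(block_means L B (\<lambda>i. X i w) k - \<mu>) \<bullet> v\<bar>} \<le> L"
      by (simp add: Y_def)
  qed
  then show ?thesis using that[of A] A by (simp add: R_def)
qed

section \<open>The covering program around the mean\<close>

text \<open>The value of the covering program when the best vector \<open>y'\<close> for a given matrix is chosen.\<close>

definition relaxed_value :: "nat \<Rightarrow> (nat \<Rightarrow> real^'n) \<Rightarrow> real^'n \<Rightarrow> real \<Rightarrow> real^'n^'n \<Rightarrow> real" where
  "relaxed_value K Xb xc \<rho> A = trace A
     + (\<Sum>k=1..K. max 0 (1 - \<rho> * ((Xb k - xc) \<bullet> (A *v (Xb k - xc))))) / (9 * real K / 10)"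

text \<open>Near-optimality with \<open>\<eta> = 0.0001\<close> is tested against every matrix
  rather than against the infimum \<open>cov_opt\<close>. This makes it directly applicable to
  chosen test matrices and reducible to countably many matrices for measurability.\<close>

definition solved :: "nat \<Rightarrow> (nat \<Rightarrow> real^'n) \<Rightarrow> real^'n \<Rightarrow> real \<Rightarrow> (real^'n^'n) \<times> (nat \<Rightarrow> real) \<Rightarrow> bool" where
  "solved K Xb xc \<rho> p \<longleftrightarrow> cov_feasible K Xb xc \<rho> p \<and>
     (\<forall>A. psd A \<longrightarrow> objective K p \<le> 1.0001 * relaxed_value K Xb xc \<rho> A)"

lemma relaxed_value_le_objective:
  assumes "1 \<le> K" "cov_feasible K Xb xc \<rho> p"
  shows "relaxed_value K Xb xc \<rho> (fst p) \<le> objective K p"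
proof -
  have "(\<Sum>k=1..K. max 0 (1 - \<rho> * ((Xb k - xc) \<bullet> (fst p *v (Xb k - xc))))) \<le> (\<Sum>k=1..K. 9 * real K / 10 * \<bar>snd p k\<bar>)"
  proof (intro sum_mono)
    fix k assume "k \<in> {1..K}"
    then have "0 \<le> snd p k" "1 \<le> \<rho> * ((Xb k - xc) \<bullet> (fst p *v (Xb k - xc))) + 9 * real K / 10 * snd p k"
      using assms(2) by (auto simp: cov_feasible_def)
    then show "max 0 (1 - \<rho> * ((Xb k - xc) \<bullet> (fst p *v (Xb k - xc)))) \<le> 9 * real K / 10 * \<bar>snd p k\<bar>"
      by (auto simp: max_def)
  qed
  then have "(\<Sum>k=1..K. max 0 (1 - \<rho> * ((Xb k - xc) \<bullet> (fst p *v (Xb k - xc))))) / (9 * real K / 10)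
      \<le> (\<Sum>k=1..K. \<bar>snd p k\<bar>)"
    using assms(1) unfolding sum_distrib_left[symmetric] by (subst divide_le_eq) (simp add: mult.commute)
  then show ?thesis by (simp add: relaxed_value_def objective_def)
qed

lemma relaxed_value_attained:
  assumes "1 \<le> K" "psd A"
  obtains p where "cov_feasible K Xb xc \<rho> p" "objective K p = relaxed_value K Xb xc \<rho> A"
proof
  define y where "y k = max 0 (1 - \<rho> * ((Xb k - xc) \<bullet> (A *v (Xb k - xc)))) / (9 * real K / 10)" for k
  have "0 \<le> y k" for k using assms by (simp add: y_def)
  moreover have "9 * real K / 10 * y k = max 0 (1 - \<rho> * ((Xb k - xc) \<bullet> (A *v (Xb k - xc))))" for k
    using assms by (simp add: y_def)
  ultimately show "cov_feasible K Xb xc \<rho> (A, y)"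
    using assms unfolding cov_feasible_def by (auto simp: max_def)
  show "objective K (A, y) = relaxed_value K Xb xc \<rho> A"
    using \<open>\<And>k. 0 \<le> y k\<close> by (simp add: objective_def relaxed_value_def) (simp add: y_def sum_divide_distrib sum_distrib_right)
qed

lemma psd_scaleR: "psd A \<Longrightarrow> 0 \<le> c \<Longrightarrow> psd (c *\<^sub>R A)"
  by (simp add: psd_def transpose_scalar scaleR_matrix_vector_assoc[symmetric])

lemma trace_scaleR: "trace (c *\<^sub>R A) = c * trace (A :: real^'n^'n)"
  by (simp add: trace_def sum_distrib_left)

text \<open>Scaling the matrix by \<open>\<rho> / \<rho>'\<close> compensates the change of the
  parameter in every constraint, so only the trace grows. Hence the optimal value cannot change fast
  with \<open>\<rho>\<close>.\<close>

lemma relaxed_value_rescale: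
  assumes "0 < \<rho>'" "\<rho>' \<le> \<rho>" "psd A"
  shows "relaxed_value K Xb xc \<rho>' ((\<rho> / \<rho>') *\<^sub>R A) \<le> \<rho> / \<rho>' * relaxed_value K Xb xc \<rho> A"
proof -
  define S where "S = (\<Sum>k=1..K. max 0 (1 - \<rho> * ((Xb k - xc) \<bullet> (A *v (Xb k - xc))))) / (9 * real K / 10)"
  have "0 \<le> S" by (auto simp: S_def intro!: sum_nonneg divide_nonneg_nonneg)
  then have "S \<le> \<rho> / \<rho>' * S" using assms mult_right_mono[of 1 "\<rho> / \<rho>'" S] by simp
  moreover have "relaxed_value K Xb xc \<rho>' ((\<rho> / \<rho>') *\<^sub>R A) = \<rho> / \<rho>' * trace A + S"
    using assms by (simp add: relaxed_value_def S_def trace_scaleR scaleR_matrix_vector_assoc[symmetric])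
  moreover have "relaxed_value K Xb xc \<rho> A = trace A + S" by (simp add: relaxed_value_def S_def)
  ultimately show ?thesis by (simp add: distrib_left)
qed

lemma psd_outer: "psd (outer v)"
proof -
  have "transpose (outer v) = outer v" by (simp add: transpose_def outer_def vec_eq_iff mult.commute)
  then show ?thesis by (simp add: psd_def outer_quad)
qed

lemma trace_outer: "trace (outer v) = v \<bullet> v"
  by (simp add: trace_def outer_def inner_vec_def)

text \<open>In an eigenbasis this seminorm is the Euclidean norm of the coordinates weighted by
  \<open>sqrt (l b)\<close>.\<close>

lemma psd_sqrt_triangle:
  assumes "psd A"
  shows "sqrt ((x + y) \<bullet> (A *v (x + y))) \<le> sqrt (x \<bullet> (A *v x)) + sqrt (y \<bullet> (A *v y))"
proof -
  obtain E l where E: "orthonormal_basis E" and "\<forall>b\<in>E. A *v b = l b *\<^sub>R b"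
    and l: "\<forall>b\<in>E. 0 \<le> l b" "\<forall>x. x \<bullet> (A *v x) = (\<Sum>b\<in>E. l b * (x \<bullet> b)\<^sup>2)" "trace A = sum l E"
    by (rule psd_spectral[OF assms])
  have *: "sqrt (x \<bullet> (A *v x)) = L2_set (\<lambda>b. sqrt (l b) * (x \<bullet> b)) E" for x
  proof -
    have "(\<Sum>b\<in>E. l b * (x \<bullet> b)\<^sup>2) = (\<Sum>b\<in>E. (sqrt (l b) * (x \<bullet> b))\<^sup>2)"
      using l(1) by (intro sum.cong) (auto simp: power_mult_distrib)
    then show ?thesis using l(2) by (simp add: L2_set_def)
  qed
  show ?thesis unfolding * unfolding inner_add_left distrib_left by (rule L2_set_triangle_ineq)
qed

lemma card_ge_1: "1 \<le> real CARD('n::finite)"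
  using zero_less_card_finite[where 'a = 'n] by linarith

section \<open>The covering program for a fixed sample in the good event\<close>

locale central_sample =
  fixes K :: nat and Xb :: "nat \<Rightarrow> real^'n" and \<mu> :: "real^'n" and R :: real
  assumes K: "1 \<le> K" and R: "0 \<le> R" and central: "central_blocks K Xb \<mu> R"
begin

lemma few_outside: "norm v = 1 \<Longrightarrow> 100 * card {k\<in>{1..K}. R < \<bar>(Xb k - \<mu>) \<bullet> v\<bar>} \<le> K"
  using central by (simp add: central_blocks_def)

lemma card_split: "card {k\<in>{1..K}. P k} + card {k\<in>{1..K}. \<not> P k} = K"
proof -
  have "card {k\<in>{1..K}. P k} + card {k\<in>{1..K}. \<not> P k} = card ({k\<in>{1..K}. P k} \<union> {k\<in>{1..K}. \<not> P k})"
    by (intro card_Un_disjoint[symmetric]) auto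
  also have "{k\<in>{1..K}. P k} \<union> {k\<in>{1..K}. \<not> P k} = {1..K}" by auto
  finally show ?thesis by simp
qed

lemma majority_inside:
  assumes "norm v = 1"
  shows "K < 2 * card {k\<in>{1..K}. \<bar>(Xb k - \<mu>) \<bullet> v\<bar> \<le> R}"
  using card_split[of "\<lambda>k. R < \<bar>(Xb k - \<mu>) \<bullet> v\<bar>"] few_outside[OF assms] K by (simp add: not_less)

text \<open>Rounding turns one percent into 0.01 / 0.32 = 1/32 of the blocks, which is below
  1/25.\<close>

lemma few_outside_psd:
  assumes "psd A" "trace A = 1"
  shows "25 * card {k\<in>{1..K}. 64 * R\<^sup>2 < (Xb k - \<mu>) \<bullet> (A *v (Xb k - \<mu>))} \<le> K"
proof -
  have "0.32 * real (card {k\<in>{1..K}. 64 * R\<^sup>2 < (Xb k - \<mu>) \<bullet> (A *v (Xb k - \<mu>))}) \<le> real K / 100"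
    using few_outside by (intro psd_rounding assms R) force+
  then show ?thesis by (subst of_nat_le_iff[symmetric, where 'a = real]) simp
qed

text \<open>The one-dimensional median replaces the component of \<open>xc - \<mu>\<close> along
  \<open>v\<close> by an error \<open>\<xi>\<close> of size at most \<open>R\<close> and leaves the
  orthogonal component unchanged.\<close>

lemma median_step:
  assumes v: "norm v = 1"
  shows "(norm (xc - (- Med K (\<lambda>k. (Xb k - xc) \<bullet> v)) *\<^sub>R v - \<mu>))\<^sup>2 \<le> (norm (xc - \<mu>))\<^sup>2 - ((xc - \<mu>) \<bullet> v)\<^sup>2 + R\<^sup>2"
proof -
  define e where "e = xc - \<mu>"
  define \<xi> where "\<xi> = Med K (\<lambda>k. (Xb k - xc) \<bullet> v) - (- (e \<bullet> v))"
  have eq: "(Xb k - xc) \<bullet> v + e \<bullet> v = (Xb k - \<mu>) \<bullet> v" for k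
    by (simp add: e_def inner_diff_left)
  have "\<bar>\<xi>\<bar> \<le> R"
    unfolding \<xi>_def using majority_inside[OF v] by (intro Med_close) (simp add: eq)
  then have xi: "\<xi>\<^sup>2 \<le> R\<^sup>2" using R by (simp add: abs_le_square_iff[symmetric])
  have vv: "v \<bullet> v = 1" using v by (simp add: norm_eq_1)
  have A: "xc - (- Med K (\<lambda>k. (Xb k - xc) \<bullet> v)) *\<^sub>R v - \<mu> = e + (\<xi> - e \<bullet> v) *\<^sub>R v"
    by (simp add: e_def \<xi>_def algebra_simps)
  have B: "(norm (e + (\<xi> - e \<bullet> v) *\<^sub>R v))\<^sup>2 = (norm e)\<^sup>2 - (e \<bullet> v)\<^sup>2 + \<xi>\<^sup>2"
    unfolding power2_norm_eq_inner
    by (simp add: inner_add_left inner_add_right vv inner_commute[of v e] power2_eq_square algebra_simps)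
  show ?thesis unfolding A e_def[symmetric] B using xi by linarith
qed

text \<open>The test matrix is a multiple of the projection onto the direction of
  \<open>xc - \<mu>\<close>, scaled to satisfy the constraints of all blocks within \<open>R\<close>
  of \<open>\<mu>\<close> in this direction. The remaining one percent costs at most (1/100) /
  (9/10) = 1/90.\<close>

lemma relaxed_value_small:
  assumes \<rho>: "0 < \<rho>" and D: "R < norm (xc - \<mu>)"
  obtains A where "psd A" "relaxed_value K Xb xc \<rho> A \<le> 1 / (\<rho> * (norm (xc - \<mu>) - R)\<^sup>2) + 1 / 90"
proof -
  define D where "D = norm (xc - \<mu>)"
  define w where "w = (1 / D) *\<^sub>R (xc - \<mu>)"
  have D: "0 < D" "R < D" using assms R by (auto simp: D_def)
  have w: "norm w = 1" using D by (simp add: w_def D_def)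
  have we: "(xc - \<mu>) \<bullet> w = D" using D by (simp add: w_def dot_square_norm D_def[symmetric] power2_eq_square)
  define \<tau> where "\<tau> = 1 / (\<rho> * (D - R)\<^sup>2)"
  have \<tau>: "0 < \<tau>" "\<rho> * \<tau> * (D - R)\<^sup>2 = 1" using \<rho> D by (auto simp: \<tau>_def)
  define A where "A = \<tau> *\<^sub>R outer w"
  have A: "psd A" "trace A = \<tau>"
    using \<tau> w by (auto simp: A_def psd_scaleR psd_outer trace_scaleR trace_outer norm_eq_1)
  have quad: "x \<bullet> (A *v x) = \<tau> * (w \<bullet> x)\<^sup>2" for x
    by (simp add: A_def scaleR_matrix_vector_assoc[symmetric] outer_quad)
  have summand: "max 0 (1 - \<rho> * ((Xb k - xc) \<bullet> (A *v (Xb k - xc)))) \<le> (if R < \<bar>(Xb k - \<mu>) \<bullet> w\<bar> then 1 else 0)" for k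
  proof (cases "R < \<bar>(Xb k - \<mu>) \<bullet> w\<bar>")
    case True
    then show ?thesis using \<rho> \<tau> by (simp add: quad)
  next
    case False
    have "(xc - Xb k) \<bullet> w = D - (Xb k - \<mu>) \<bullet> w" using we by (simp add: inner_diff_left)
    then have "D - R \<le> \<bar>w \<bullet> (Xb k - xc)\<bar>" using False by (simp add: inner_commute inner_diff_right)
    then have "(D - R)\<^sup>2 \<le> (w \<bullet> (Xb k - xc))\<^sup>2" using D power_mono[of "D - R" "\<bar>w \<bullet> (Xb k - xc)\<bar>" 2] by simp
    then have "\<rho> * \<tau> * (D - R)\<^sup>2 \<le> \<rho> * \<tau> * (w \<bullet> (Xb k - xc))\<^sup>2" using \<rho> \<tau> by (intro mult_left_mono) auto
    then show ?thesis using False \<tau> by (simp add: quad mult.assoc)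
  qed
  have "(\<Sum>k=1..K. max 0 (1 - \<rho> * ((Xb k - xc) \<bullet> (A *v (Xb k - xc))))) \<le> (\<Sum>k=1..K. if R < \<bar>(Xb k - \<mu>) \<bullet> w\<bar> then 1 else 0)"
    by (intro sum_mono summand)
  also have "\<dots> = real (card {k\<in>{1..K}. R < \<bar>(Xb k - \<mu>) \<bullet> w\<bar>})" by (simp add: sum.If_cases Int_def)
  also have "\<dots> \<le> real K / 100" using few_outside[OF w] by linarith
  finally have "(\<Sum>k=1..K. max 0 (1 - \<rho> * ((Xb k - xc) \<bullet> (A *v (Xb k - xc))))) / (9 * real K / 10) \<le> real K / 100 / (9 * real K / 10)"
    using K by (intro divide_right_mono) auto
  also have "\<dots> = 1 / 90" using K by simp
  finally have "relaxed_value K Xb xc \<rho> A \<le> \<tau> + 1 / 90" by (simp add: relaxed_value_def A)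
  then show ?thesis using that[OF A(1)] by (simp add: \<tau>_def D_def)
qed

text \<open>Normalise \<open>A\<close> to trace one. By the triangle inequality for its seminorm,
  24/25 of the blocks have a constraint value at most \<open>\<rho> * trace A\<close> times the
  square in the conclusion. A value at most 1 limits the total slack to 9/10 of \<open>K\<close>
  times \<open>1 - trace A\<close>. Since 24/25 > 9/10, the square times \<open>\<rho>\<close> must
  reach 1.\<close>

lemma relaxed_value_le_1:
  assumes \<rho>: "0 < \<rho>" and A: "psd A" and le: "relaxed_value K Xb xc \<rho> A \<le> 1"
  defines "e \<equiv> xc - \<mu>"
  shows "0 < trace A"
    and "1 \<le> \<rho> * (sqrt (e \<bullet> (((1 / trace A) *\<^sub>R A) *v e)) + 8 * R)\<^sup>2"
proof -
  define t where "t = trace A"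
  define S where "S = (\<Sum>k=1..K. max 0 (1 - \<rho> * ((Xb k - xc) \<bullet> (A *v (Xb k - xc)))))"
  have S: "0 \<le> S" by (auto simp: S_def intro!: sum_nonneg)
  have tS: "t + S / (9 * real K / 10) \<le> 1" using le by (simp add: relaxed_value_def t_def S_def)
  then have tS': "S \<le> 0.9 * real K * (1 - t)" using K by (simp add: field_simps)
  have t0: "0 \<le> t" using psd_trace_nonneg[OF A] by (simp add: t_def)
  have t1: "t \<le> 1" proof -
    have "0 \<le> S / (9 * real K / 10)" using S by simp
    then show ?thesis using tS by linarith
  qed
  \<comment> \<open>With trace 0 the form vanishes and every block has slack 1, more than the
    permitted \<open>0.9 * K\<close>.\<close>
  show tpos: "0 < trace A"
  proof (rule ccontr)
    assume "\<not> 0 < trace A"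
    then have "t = 0" using t0 by (simp add: t_def)
    then have "x \<bullet> (A *v x) \<le> 0" for x using psd_quad_le_trace[OF A, of x] by (simp add: t_def)
    then have "x \<bullet> (A *v x) = 0" for x using A by (simp add: psd_def order.antisym)
    then have "S = real K" by (simp add: S_def)
    then show False using tS' \<open>t = 0\<close> K by simp
  qed
  define M where "M = (1 / t) *\<^sub>R A"
  have tp: "0 < t" using tpos by (simp add: t_def)
  have M: "psd M" "trace M = 1" using A tp by (auto simp: M_def psd_scaleR trace_scaleR t_def[symmetric])
  have AM: "x \<bullet> (A *v x) = t * (x \<bullet> (M *v x))" for x
    using tp by (simp add: M_def scaleR_matrix_vector_assoc[symmetric])
  have Mnn: "0 \<le> x \<bullet> (M *v x)" for x using M by (simp add: psd_def)
  define a where "a = sqrt (e \<bullet> (M *v e)) + 8 * R"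
  have a0: "0 \<le> a" using Mnn R by (simp add: a_def)
  show "1 \<le> \<rho> * (sqrt (e \<bullet> (((1 / trace A) *\<^sub>R A) *v e)) + 8 * R)\<^sup>2"
    unfolding t_def[symmetric] M_def[symmetric] a_def[symmetric]
  proof (cases "1 < \<rho> * t * a\<^sup>2")
    case True
    have "\<rho> * t * a\<^sup>2 \<le> \<rho> * 1 * a\<^sup>2" using t1 \<rho> by (intro mult_right_mono mult_left_mono) auto
    then show "1 \<le> \<rho> * a\<^sup>2" using True by simp
  next
    case False
    define G where "G = {k\<in>{1..K}. \<not> 64 * R\<^sup>2 < (Xb k - \<mu>) \<bullet> (M *v (Xb k - \<mu>))}"
    have G: "24 * K \<le> 25 * card G"
      using few_outside_psd[OF M] card_split[of "\<lambda>k. 64 * R\<^sup>2 < (Xb k - \<mu>) \<bullet> (M *v (Xb k - \<mu>))"]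
      by (simp add: G_def)
    have summand: "1 - \<rho> * t * a\<^sup>2 \<le> max 0 (1 - \<rho> * ((Xb k - xc) \<bullet> (A *v (Xb k - xc))))" if k: "k \<in> G" for k
    proof -
      have "sqrt ((Xb k - \<mu>) \<bullet> (M *v (Xb k - \<mu>))) \<le> sqrt ((8 * R)\<^sup>2)"
        using k by (intro real_sqrt_le_mono) (simp add: G_def power_mult_distrib)
      then have 8: "sqrt ((Xb k - \<mu>) \<bullet> (M *v (Xb k - \<mu>))) \<le> 8 * R" using R unfolding real_sqrt_abs by simp
      have split: "Xb k - xc = (Xb k - \<mu>) + (- e)" by (simp add: e_def)
      have "sqrt ((Xb k - xc) \<bullet> (M *v (Xb k - xc))) \<le> sqrt ((Xb k - \<mu>) \<bullet> (M *v (Xb k - \<mu>))) + sqrt ((- e) \<bullet> (M *v (- e)))"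
        unfolding split by (rule psd_sqrt_triangle[OF M(1)])
      also have "(- e) \<bullet> (M *v (- e)) = e \<bullet> (M *v e)" by (simp add: linear_neg[OF quad_form_linear])
      finally have "sqrt ((Xb k - xc) \<bullet> (M *v (Xb k - xc))) \<le> a" using 8 by (simp add: a_def)
      then have "(sqrt ((Xb k - xc) \<bullet> (M *v (Xb k - xc))))\<^sup>2 \<le> a\<^sup>2" using Mnn by (intro power_mono) auto
      then have "(Xb k - xc) \<bullet> (M *v (Xb k - xc)) \<le> a\<^sup>2" using Mnn by simp
      then have "\<rho> * t * ((Xb k - xc) \<bullet> (M *v (Xb k - xc))) \<le> \<rho> * t * a\<^sup>2"
        using \<rho> tp by (intro mult_left_mono) auto
      then show ?thesis by (simp add: AM mult.assoc)
    qed
    have "24 / 25 * real K * (1 - \<rho> * t * a\<^sup>2) \<le> real (card G) * (1 - \<rho> * t * a\<^sup>2)"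
      using G False by (intro mult_right_mono) auto
    also have "\<dots> = (\<Sum>k\<in>G. 1 - \<rho> * t * a\<^sup>2)" by simp
    also have "\<dots> \<le> (\<Sum>k\<in>G. max 0 (1 - \<rho> * ((Xb k - xc) \<bullet> (A *v (Xb k - xc)))))" by (intro sum_mono summand)
    also have "\<dots> \<le> S" unfolding S_def by (intro sum_mono2) (auto simp: G_def)
    also note tS'
    finally have "real K * (24 / 25 * (1 - \<rho> * t * a\<^sup>2)) \<le> real K * (0.9 * (1 - t))" by (simp add: mult_ac)
    then have "24 / 25 * (1 - \<rho> * t * a\<^sup>2) \<le> 0.9 * (1 - t)" using K by simp
    then have "t * 1 \<le> t * (\<rho> * a\<^sup>2)" using t1 by (simp add: mult_ac)
    then show "1 \<le> \<rho> * a\<^sup>2" using tp by (simp only: mult_le_cancel_left_pos)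
  qed
qed

lemma relaxed_value_le_1_imp:
  assumes "0 < \<rho>" "psd A" "relaxed_value K Xb xc \<rho> A \<le> 1"
  shows "1 \<le> \<rho> * (norm (xc - \<mu>) + 8 * R)\<^sup>2"
proof -
  define e where "e = xc - \<mu>"
  define M where "M = (1 / trace A) *\<^sub>R A"
  note * = relaxed_value_le_1[OF assms, folded e_def M_def]
  have M: "psd M" "trace M = 1" using assms(2) *(1) by (auto simp: M_def psd_scaleR trace_scaleR)
  have "sqrt (e \<bullet> (M *v e)) \<le> sqrt (e \<bullet> e)"
    using psd_quad_le_trace[OF M(1), of e] M(2) by simp
  then have "sqrt (e \<bullet> (M *v e)) \<le> norm e" by (simp add: norm_eq_sqrt_inner)
  moreover have "0 \<le> e \<bullet> (M *v e)" using M by (simp add: psd_def)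
  ultimately have "(sqrt (e \<bullet> (M *v e)) + 8 * R)\<^sup>2 \<le> (norm e + 8 * R)\<^sup>2"
    using R by (intro power_mono) auto
  then have "\<rho> * (sqrt (e \<bullet> (M *v e)) + 8 * R)\<^sup>2 \<le> \<rho> * (norm e + 8 * R)\<^sup>2"
    using assms(1) by (intro mult_left_mono) auto
  then show ?thesis using *(2) by (simp add: e_def)
qed

text \<open>Near-optimality against \<open>relaxed_value_small\<close> bounds \<open>\<rho>\<close>
  from above, and \<open>relaxed_value_le_1\<close> bounds it from below. Together they force the
  trace-one matrix to have form at least 0.588 in the direction \<open>w\<close> of the error, so
  the top eigenvector captures 0.299 of the squared error. With \<open>D > 40 * R\<close> what
  remains is at most 1 - 0.299 + 1/1600 of it, below 0.81.\<close>

lemma median_step_contracts: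
  assumes \<rho>: "0 < \<rho>" and p: "solved K Xb xc \<rho> p" "objective K p \<in> {0.9981..1}"
    and v: "unit_top_eigenvector ((1 / trace (fst p)) *\<^sub>R fst p) v"
    and D: "40 * R < norm (xc - \<mu>)"
  shows "norm (xc - (- Med K (\<lambda>k. (Xb k - xc) \<bullet> v)) *\<^sub>R v - \<mu>) \<le> 0.9 * norm (xc - \<mu>)"
proof -
  define e where "e = xc - \<mu>"
  define D where "D = norm e"
  have D: "40 * R < D" "0 < D" using assms(5) R by (auto simp: D_def e_def)
  define M where "M = (1 / trace (fst p)) *\<^sub>R fst p"
  have feas: "cov_feasible K Xb xc \<rho> p" and opt: "\<And>A. psd A \<Longrightarrow> objective K p \<le> 1.0001 * relaxed_value K Xb xc \<rho> A"
    using p(1) by (auto simp: solved_def)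
  have psdp: "psd (fst p)" using feas by (simp add: cov_feasible_def)
  have le1: "relaxed_value K Xb xc \<rho> (fst p) \<le> 1"
    using relaxed_value_le_objective[OF K feas] p(2) by simp
  note * = relaxed_value_le_1[OF \<rho> psdp le1, folded e_def M_def]
  have M: "psd M" "trace M = 1" using psdp *(1) by (auto simp: M_def psd_scaleR trace_scaleR)
  have DR: "0 < D - R" using D R by linarith
  then have "R < norm (xc - \<mu>)" by (simp add: D_def e_def)
  then obtain A where A: "psd A" "relaxed_value K Xb xc \<rho> A \<le> 1 / (\<rho> * (norm (xc - \<mu>) - R)\<^sup>2) + 1 / 90"
    by (rule relaxed_value_small[OF \<rho>])
  then have "0.9981 \<le> 1.0001 * (1 / (\<rho> * (D - R)\<^sup>2) + 1 / 90)"
    using opt[OF A(1)] p(2) by (simp add: D_def e_def)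
  \<comment> \<open>This holds because 0.9981/1.0001 - 1/90 > 0.986.\<close>
  then have "(493/500) \<le> 1 / (\<rho> * (D - R)\<^sup>2)" by simp
  moreover have "0 < \<rho> * (D - R)\<^sup>2" using \<rho> DR by simp
  ultimately have low: "(493/500) * (\<rho> * (D - R)\<^sup>2) \<le> 1" by (simp add: le_divide_eq)
  define b where "b = sqrt (e \<bullet> (M *v e))"
  have Mnn: "0 \<le> x \<bullet> (M *v x)" for x using M by (simp add: psd_def)
  have b0: "0 \<le> b" using Mnn by (simp add: b_def)
  have "\<rho> * ((493/500) * (D - R)\<^sup>2) \<le> \<rho> * (b + 8 * R)\<^sup>2" using low *(2) by (simp add: b_def mult_ac)
  then have "(493/500) * (D - R)\<^sup>2 \<le> (b + 8 * R)\<^sup>2" using \<rho> by simp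
  moreover have "((124/125) * (D - R))\<^sup>2 \<le> (493/500) * (D - R)\<^sup>2"
    unfolding power_mult_distrib by (intro mult_right_mono) (auto simp: power2_eq_square)
  ultimately have "((124/125) * (D - R))\<^sup>2 \<le> (b + 8 * R)\<^sup>2" by linarith
  then have "(124/125) * (D - R) \<le> b + 8 * R" by (rule power2_le_imp_le) (use b0 R in simp)
  then have "124 * D \<le> 125 * b + 1124 * R" by simp
  then have bD: "(767/1000) * D \<le> b" using D by simp
  define w where "w = (1 / D) *\<^sub>R e"
  have w: "norm w = 1" using D by (simp add: w_def D_def[symmetric])
  define s where "s = w \<bullet> (M *v w)"
  have "s = (b / D)\<^sup>2"
    using Mnn D by (simp add: s_def w_def b_def matrix_vector_mult_scaleR power_divide power2_eq_square[of D])
  moreover have "(767/1000) \<le> b / D" using bD D by (simp add: le_divide_eq)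
  ultimately have s: "(147/250) \<le> s" using power_mono[of "767/1000" "b / D" 2] by (simp add: power2_eq_square)
  define c where "c = w \<bullet> v"
  have "2 * s - 1 \<le> s * c\<^sup>2"
    unfolding s_def c_def using v w M by (intro top_eigenvector_alignment) (auto simp: M_def)
  \<comment> \<open>The alignment bound reads \<open>c\<^sup>2 \<ge> 2 - 1 / s\<close>, which
    increases with \<open>s\<close> and exceeds 0.299 at 0.588.\<close>
  then have c: "(299/1000) \<le> c\<^sup>2"
  proof -
    assume h: "2 * s - 1 \<le> s * c\<^sup>2"
    have "s * (299/1000) \<le> 2 * s - 1" using s by simp
    then have "s * (299/1000) \<le> s * c\<^sup>2" using h by linarith
    then show ?thesis using s by (subst (asm) mult_le_cancel_left_pos) auto
  qed
  have vn: "norm v = 1" using v by (simp add: unit_top_eigenvector_def)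
  have "e \<bullet> v = D * c" using D by (simp add: c_def w_def)
  then have "(norm (xc - (- Med K (\<lambda>k. (Xb k - xc) \<bullet> v)) *\<^sub>R v - \<mu>))\<^sup>2 \<le> D\<^sup>2 - D\<^sup>2 * c\<^sup>2 + R\<^sup>2"
    using median_step[OF vn, of xc] by (simp add: D_def e_def power_mult_distrib)
  also have "\<dots> \<le> D\<^sup>2 - D\<^sup>2 * (299/1000) + D\<^sup>2 / 1600"
  proof -
    have "R\<^sup>2 \<le> (D / 40)\<^sup>2" using D R by (intro power_mono) auto
    moreover have "D\<^sup>2 * (299/1000) \<le> D\<^sup>2 * c\<^sup>2" by (intro mult_left_mono c) auto
    ultimately show ?thesis by (simp add: power_divide)
  qed
  also have "\<dots> \<le> (0.9 * D)\<^sup>2" using D by (simp add: power_mult_distrib power2_eq_square)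
  finally show ?thesis unfolding D_def e_def by (rule power2_le_imp_le) simp
qed

section \<open>The coordinate-wise median and the spread of the block means around it\<close>

lemma coord_median_close: "norm (coord_median K Xb - \<mu>) \<le> sqrt (real CARD('n)) * R"
proof -
  have comp: "\<bar>(coord_median K Xb - \<mu>) $ i\<bar> \<le> R" for i
  proof -
    have "(Xb k - \<mu>) \<bullet> axis i 1 = Xb k $ i - \<mu> $ i" for k
      by (simp add: inner_axis)
    then show ?thesis
      using majority_inside[of "axis i 1"] by (simp add: coord_median_def Med_close)
  qed
  have "(norm (coord_median K Xb - \<mu>))\<^sup>2 = (\<Sum>i\<in>UNIV. ((coord_median K Xb - \<mu>) $ i)\<^sup>2)"
    by (simp add: norm_vec_def L2_set_def sum_nonneg)
  also have "\<dots> \<le> (\<Sum>i\<in>(UNIV::'n set). R\<^sup>2)"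
    using comp R by (intro sum_mono) (simp add: abs_le_square_iff[symmetric])
  also have "\<dots> = (sqrt (real CARD('n)) * R)\<^sup>2" by (simp add: power_mult_distrib)
  finally show ?thesis by (rule power2_le_imp_le) (use R in simp)
qed

abbreviation m where "m \<equiv> coord_median K Xb"
abbreviation \<delta> where "\<delta> \<equiv> Med K (\<lambda>k. norm (Xb k - m))"

lemma delta_nonneg: "0 \<le> \<delta>"
  using K by (intro Med_nonneg) auto

text \<open>Half of the block means lie within \<open>\<delta>\<close> of \<open>m\<close>, and a
  strict majority lies within \<open>R\<close> of \<open>\<mu>\<close> in the direction of
  \<open>m - \<mu>\<close>; one block does both. Thus \<open>m\<close> is a good estimate whenever
  \<open>\<delta>\<close> is small.\<close>

lemma coord_median_close_delta: "norm (m - \<mu>) \<le> \<delta> + R"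
proof (cases "m = \<mu>")
  case False
  define w where "w = (1 / norm (m - \<mu>)) *\<^sub>R (m - \<mu>)"
  have w: "norm w = 1" using False by (simp add: w_def)
  have mw: "(m - \<mu>) \<bullet> w = norm (m - \<mu>)" using False by (simp add: w_def dot_square_norm power2_eq_square)
  have "\<exists>k\<in>{1..K}. norm (Xb k - m) \<le> \<delta> \<and> \<bar>(Xb k - \<mu>) \<bullet> w\<bar> \<le> R"
  proof (rule ccontr)
    assume "\<not> ?thesis"
    then have "card {k\<in>{1..K}. norm (Xb k - m) \<le> \<delta>} + card {k\<in>{1..K}. \<bar>(Xb k - \<mu>) \<bullet> w\<bar> \<le> R} =
       card ({k\<in>{1..K}. norm (Xb k - m) \<le> \<delta>} \<union> {k\<in>{1..K}. \<bar>(Xb k - \<mu>) \<bullet> w\<bar> \<le> R})"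
      by (intro card_Un_disjoint[symmetric]) auto
    also have "\<dots> \<le> card {1..K}" by (intro card_mono) auto
    finally show False using half_le_Med[of K "\<lambda>k. norm (Xb k - m)"] majority_inside[OF w] K
      unfolding card_atLeastAtMost by linarith
  qed
  then obtain k where k: "norm (Xb k - m) \<le> \<delta>" "\<bar>(Xb k - \<mu>) \<bullet> w\<bar> \<le> R" by blast
  have "norm (m - \<mu>) = (Xb k - \<mu>) \<bullet> w - (Xb k - m) \<bullet> w" using mw by (simp add: inner_diff_left)
  moreover have "\<bar>(Xb k - m) \<bullet> w\<bar> \<le> \<delta>" using Cauchy_Schwarz_ineq2[of "Xb k - m" w] w k(1) by simp
  ultimately show ?thesis using k(2) by linarith
qed (use delta_nonneg R in simp)

text \<open>The trace-one matrix \<open>1 / d\<close> times the identity turns the weighted bound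
  \<open>8 * R\<close> into a Euclidean one. The consequence is that
  \<open>d / \<delta>\<^sup>2\<close> is a large enough starting value for the binary
  search.\<close>

lemma delta_le: "\<delta> \<le> 9 * sqrt (real CARD('n)) * R"
proof (rule Med_le)
  define A :: "real^'n^'n" where "A = (1 / real CARD('n)) *\<^sub>R mat 1"
  have A: "psd A" "trace A = 1"
    by (auto simp: A_def psd_def trace_scaleR trace_I transpose_scalar transpose_mat
        scaleR_matrix_vector_assoc[symmetric])
  have "K < 2 * card {k\<in>{1..K}. \<not> 64 * R\<^sup>2 < (Xb k - \<mu>) \<bullet> (A *v (Xb k - \<mu>))}"
    using few_outside_psd[OF A] K card_split[of "\<lambda>k. 64 * R\<^sup>2 < (Xb k - \<mu>) \<bullet> (A *v (Xb k - \<mu>))"] by linarith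
  also have "card {k\<in>{1..K}. \<not> 64 * R\<^sup>2 < (Xb k - \<mu>) \<bullet> (A *v (Xb k - \<mu>))} \<le> card {k\<in>{1..K}. norm (Xb k - m) \<le> 9 * sqrt (real CARD('n)) * R}"
  proof (intro card_mono subsetI)
    fix k assume k: "k \<in> {k\<in>{1..K}. \<not> 64 * R\<^sup>2 < (Xb k - \<mu>) \<bullet> (A *v (Xb k - \<mu>))}"
    then have "(1 / real CARD('n)) * (norm (Xb k - \<mu>))\<^sup>2 \<le> 64 * R\<^sup>2"
      by (simp add: A_def scaleR_matrix_vector_assoc[symmetric] power2_norm_eq_inner)
    then have "(norm (Xb k - \<mu>))\<^sup>2 \<le> (8 * sqrt (real CARD('n)) * R)\<^sup>2"
    proof -
      assume "(1 / real CARD('n)) * (norm (Xb k - \<mu>))\<^sup>2 \<le> 64 * R\<^sup>2"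
      then have "(norm (Xb k - \<mu>))\<^sup>2 \<le> 64 * R\<^sup>2 * real CARD('n)"
        using card_ge_1[where 'n = 'n] by (simp add: divide_le_eq)
      also have "\<dots> = (8 * sqrt (real CARD('n)) * R)\<^sup>2" by (simp add: power_mult_distrib)
      finally show ?thesis .
    qed
    then have "norm (Xb k - \<mu>) \<le> 8 * sqrt (real CARD('n)) * R" by (rule power2_le_imp_le) (use R in simp)
    moreover have "norm (Xb k - m) \<le> norm (Xb k - \<mu>) + norm (m - \<mu>)" using norm_triangle_ineq4[of "Xb k - \<mu>" "m - \<mu>"] by simp
    ultimately show "k \<in> {k\<in>{1..K}. norm (Xb k - m) \<le> 9 * sqrt (real CARD('n)) * R}" using coord_median_close k by simp
  qed auto
  finally show "K < 2 * card {k\<in>{1..K}. norm (Xb k - m) \<le> 9 * sqrt (real CARD('n)) * R}" by simp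
qed

end

section \<open>Binary search and the main loop\<close>

text \<open>A fixed number of guarded steps replaces \<open>while\<close>: it agrees with the loop
  once the loop has stopped, and it allows induction on the number of steps for invariants,
  measurability and dependence on seeds.\<close>

definition guarded :: "('s \<Rightarrow> bool) \<Rightarrow> ('s \<Rightarrow> 's) \<Rightarrow> 's \<Rightarrow> 's" where
  "guarded b c s = (if b s then c s else s)"

lemma guarded_step: "b s \<Longrightarrow> guarded b c s = c s"
  by (simp add: guarded_def)

lemma guarded_fixed: "\<not> b s \<Longrightarrow> (guarded b c ^^ n) s = s"
  by (induction n) (auto simp: guarded_def)

lemma while_eq_guarded_funpow:
  assumes "\<not> b ((guarded b c ^^ n) s)"
  shows "while b c s = (guarded b c ^^ n) s"
  using assms
proof (induction n arbitrary: s)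
  case (Suc n)
  show ?case
  proof (cases "b s")
    case True
    have "while b c s = while b c (c s)" using True by (simp add: while_unfold)
    also have "\<dots> = (guarded b c ^^ n) (c s)"
      using Suc True by (simp add: funpow_Suc_right guarded_step del: funpow.simps)
    finally show ?thesis using True by (simp add: funpow_Suc_right guarded_step del: funpow.simps)
  qed (simp add: guarded_fixed while_unfold del: funpow.simps)
qed (simp add: while_unfold)

section \<open>States of the binary search\<close>

type_synonym 'n search_state = "real \<times> real \<times> ((real^'n^'n) \<times> (nat \<Rightarrow> real)) \<times> nat"

definition search_active :: "nat \<Rightarrow> real \<Rightarrow> 'n::finite search_state \<Rightarrow> bool" where
  "search_active K T = (\<lambda>(\<rho>m, \<rho>M, p, i). objective K p \<notin> {0.9981..1} \<and> real i < T)"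

text \<open>The parameter of the next call is the midpoint of the updated interval. It is read off
  the current state, hence it is determined before the seed of that call is used.\<close>

definition next_rho :: "nat \<Rightarrow> 'n::finite search_state \<Rightarrow> real" where
  "next_rho K = (\<lambda>(\<rho>m, \<rho>M, p, i).
     if objective K p < 0.9981 then (\<rho>m + (\<rho>M + \<rho>m) / 2) / 2 else ((\<rho>M + \<rho>m) / 2 + \<rho>M) / 2)"

definition search_step :: "(real \<Rightarrow> 's \<Rightarrow> (real^'n::finite^'n) \<times> (nat \<Rightarrow> real)) \<Rightarrow> nat \<Rightarrow> (nat \<Rightarrow> 's)
    \<Rightarrow> 'n search_state \<Rightarrow> 'n search_state" where
  "search_step run K s = (\<lambda>(\<rho>m, \<rho>M, p, i).
     (if objective K p < 0.9981 then \<rho>m else (\<rho>M + \<rho>m) / 2,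
      if objective K p < 0.9981 then (\<rho>M + \<rho>m) / 2 else \<rho>M,
      run (next_rho K (\<rho>m, \<rho>M, p, i)) (s (Suc i)), Suc i))"

definition search_state :: "(real \<Rightarrow> 's \<Rightarrow> (real^'n::finite^'n) \<times> (nat \<Rightarrow> real)) \<Rightarrow> nat \<Rightarrow> real \<Rightarrow> real
    \<Rightarrow> (nat \<Rightarrow> 's) \<Rightarrow> nat \<Rightarrow> 'n search_state" where
  "search_state run K \<rho>0 T s n =
     (guarded (search_active K T) (search_step run K s) ^^ n) (0, \<rho>0, run \<rho>0 (s 0), 0)"

lemma search_state_0: "search_state run K \<rho>0 T s 0 = (0, \<rho>0, run \<rho>0 (s 0), 0)"
  by (simp add: search_state_def)

lemma search_state_Suc:
  "search_state run K \<rho>0 T s (Suc n) =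
     guarded (search_active K T) (search_step run K s) (search_state run K \<rho>0 T s n)"
  by (simp add: search_state_def)

text \<open>While the search is active its counter equals the number of steps, so step
  \<open>n\<close> draws exactly the seed \<open>Suc n\<close>.\<close>

lemma search_state_count:
  "search_state run K \<rho>0 T s n = (\<rho>m, \<rho>M, p, i) \<Longrightarrow>
     i \<le> n \<and> (search_active K T (\<rho>m, \<rho>M, p, i) \<longrightarrow> i = n)"
proof (induction n arbitrary: \<rho>m \<rho>M p i)
  case (Suc n)
  obtain a b q j where st: "search_state run K \<rho>0 T s n = (a, b, q, j)" by (cases "search_state run K \<rho>0 T s n")
  from Suc.IH[OF st] Suc.prems show ?case
    by (auto simp: search_state_Suc st guarded_def search_step_def split: if_splits)
qed (auto simp: search_state_0)

lemma binary_search_eq: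
  assumes T: "nat \<lceil>T\<rceil> \<le> n" and st: "search_state run K \<rho>0 T s n = (\<rho>m, \<rho>M, p, i)"
  shows "binary_search run K \<rho>0 T s =
     (if i = 0 then (run ((\<rho>m + \<rho>M) / 2) (s 1), 2) else (p, Suc i))"
proof -
  have stop: "\<not> search_active K T (search_state run K \<rho>0 T s n)"
  proof
    assume act: "search_active K T (search_state run K \<rho>0 T s n)"
    then have "i = n" using search_state_count[OF st] st by simp
    then show False using act T st by (simp add: search_active_def)
  qed
  have "(\<lambda>(\<rho>m, \<rho>M, p, i). let (\<rho>m', \<rho>M') = (if objective K p < 0.9981 then (\<rho>m, (\<rho>M + \<rho>m) / 2) else ((\<rho>M + \<rho>m) / 2, \<rho>M))
             in (\<rho>m', \<rho>M', run ((\<rho>m' + \<rho>M') / 2) (s (Suc i)), Suc i)) = search_step run K s"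
    by (auto simp: search_step_def next_rho_def fun_eq_iff)
  then have "binary_search run K \<rho>0 T s = (let (\<rho>m, \<rho>M, p, i) =
     while (search_active K T) (search_step run K s) (0, \<rho>0, run \<rho>0 (s 0), 0)
      in if i = 0 then (run ((\<rho>m + \<rho>M) / 2) (s 1), 2) else (p, Suc i))"
    unfolding binary_search_def search_active_def by simp
  also have "while (search_active K T) (search_step run K s) (0, \<rho>0, run \<rho>0 (s 0), 0) = search_state run K \<rho>0 T s n"
    unfolding search_state_def using stop by (intro while_eq_guarded_funpow) (simp add: search_state_def)
  finally show ?thesis by (simp add: st)
qed

definition search_length :: "'n::finite itself \<Rightarrow> real \<Rightarrow> nat" where
  "search_length _ C = nat \<lceil>log 2 (C * real CARD('n) ^ 4)\<rceil>"

text \<open>Some calls that may not be made are included, so that each call has an input not depending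
  on its own seed.\<close>

definition pass_solved :: "('n::finite, 's) solver \<Rightarrow> real \<Rightarrow> nat \<Rightarrow> (nat \<Rightarrow> real^'n) \<Rightarrow> nat \<Rightarrow> real^'n
    \<Rightarrow> (nat \<Rightarrow> 's) \<Rightarrow> bool" where
  "pass_solved alg C K Xb u xc s \<longleftrightarrow>
     (let d = real CARD('n); \<delta> = Med K (\<lambda>k. norm (Xb k - coord_median K Xb));
          ok = (\<lambda>\<rho> i. 0 < \<rho> \<longrightarrow> solved K Xb xc \<rho> (alg u K Xb xc \<rho> (s i)));
          T = log 2 (C * d ^ 4); n = search_length TYPE('n) C
      in ok (d / \<delta>\<^sup>2) 0 \<and> ok (d / \<delta>\<^sup>2 / 2) 1 \<and>
         (\<forall>i<n. ok (next_rho K (search_state (alg u K Xb xc) K (d / \<delta>\<^sup>2) T s i)) (Suc i)) \<and>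
         (\<forall>i\<le>Suc n. ok (1 / (d * \<delta>)\<^sup>2) i))"

lemma search_length_ge:
  assumes "10 ^ 5 \<le> C"
  shows "1 \<le> search_length TYPE('n::finite) C" and "C * real CARD('n) ^ 4 \<le> 2 ^ search_length TYPE('n) C"
proof -
  have "1 \<le> real CARD('n)" by (rule card_ge_1)
  then have "1 \<le> real CARD('n) ^ 4" by simp
  then have ge: "10 ^ 5 \<le> C * real CARD('n) ^ 4" using assms mult_mono[of "10 ^ 5" C 1 "real CARD('n) ^ 4"] by simp
  then have "0 < log 2 (C * real CARD('n) ^ 4)" by simp
  then show "1 \<le> search_length TYPE('n) C" by (simp add: search_length_def Suc_le_eq)
  have "C * real CARD('n) ^ 4 = 2 powr (log 2 (C * real CARD('n) ^ 4))" using ge by simp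
  also have "\<dots> \<le> 2 powr (real (search_length TYPE('n) C))"
    unfolding search_length_def by (intro powr_mono) (auto intro: real_nat_ceiling_ge)
  also have "\<dots> = 2 ^ search_length TYPE('n) C" by (simp add: powr_realpow)
  finally show "C * real CARD('n) ^ 4 \<le> 2 ^ search_length TYPE('n) C" .
qed

lemma search_state_no_steps:
  "search_state run K \<rho>0 T s n = (\<rho>m, \<rho>M, p, 0) \<Longrightarrow>
     \<rho>m = 0 \<and> \<rho>M = \<rho>0 \<and> p = run \<rho>0 (s 0) \<and>
     (1 \<le> n \<longrightarrow> \<not> search_active K T (\<rho>m, \<rho>M, p, 0))"
proof (induction n arbitrary: \<rho>m \<rho>M p)
  case (Suc n)
  obtain a b q j where st: "search_state run K \<rho>0 T s n = (a, b, q, j)" by (cases "search_state run K \<rho>0 T s n")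
  have "\<not> search_active K T (a, b, q, j)"
    using Suc.prems by (auto simp: search_state_Suc st guarded_def search_step_def)
  moreover from this have "(a, b, q, j) = (\<rho>m, \<rho>M, p, 0)"
    using Suc.prems by (simp add: search_state_Suc st guarded_def)
  ultimately show ?case using Suc.IH st by simp
qed (simp add: search_state_0)

section \<open>States of the main loop\<close>

definition loop_bound :: "'n::finite itself \<Rightarrow> real" where
  "loop_bound _ = ln (8 * sqrt (real CARD('n))) / ln (1 / sqrt 0.81)"

definition loop_step :: "('n::finite, 's) solver \<Rightarrow> (real^'n^'n \<Rightarrow> real^'n) \<Rightarrow> real \<Rightarrow> nat
    \<Rightarrow> (nat \<Rightarrow> real^'n) \<Rightarrow> nat \<Rightarrow> (nat \<Rightarrow> nat \<Rightarrow> 's) \<Rightarrow> bool \<times> (real^'n) \<times> nat \<Rightarrow> bool \<times> (real^'n) \<times> nat" where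
  "loop_step alg eigv C K Xb u s = (\<lambda>(b, xc, t).
     case solve_sdp alg C K Xb xc u (s t) of
       Inl A \<Rightarrow> (True, xc - (- Med K (\<lambda>k. (Xb k - xc) \<bullet> eigv A)) *\<^sub>R eigv A, Suc t)
     | Inr z \<Rightarrow> (False, z, t))"

definition loop_active :: "bool \<times> (real^'n::finite) \<times> nat \<Rightarrow> bool" where
  "loop_active = (\<lambda>(b, xc, t). b \<and> real t < loop_bound TYPE('n))"

definition loop_state :: "('n::finite, 's) solver \<Rightarrow> (real^'n^'n \<Rightarrow> real^'n) \<Rightarrow> real \<Rightarrow> nat
    \<Rightarrow> (nat \<Rightarrow> real^'n) \<Rightarrow> nat \<Rightarrow> (nat \<Rightarrow> nat \<Rightarrow> 's) \<Rightarrow> nat \<Rightarrow> bool \<times> (real^'n) \<times> nat" where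
  "loop_state alg eigv C K Xb u s n =
     (guarded loop_active (loop_step alg eigv C K Xb u s) ^^ n) (True, coord_median K Xb, 0)"

lemma loop_state_0: "loop_state alg eigv C K Xb u s 0 = (True, coord_median K Xb, 0)"
  by (simp add: loop_state_def)

lemma loop_state_Suc:
  "loop_state alg eigv C K Xb u s (Suc n) =
     guarded loop_active (loop_step alg eigv C K Xb u s) (loop_state alg eigv C K Xb u s n)"
  by (simp add: loop_state_def)

definition loop_length :: "'n::finite itself \<Rightarrow> nat" where
  "loop_length _ = nat \<lceil>loop_bound TYPE('n)\<rceil>"

lemma loop_state_count:
  "loop_state alg eigv C K Xb u s n = (b, xc, t) \<Longrightarrow> t \<le> n \<and> (loop_active (b, xc, t) \<longrightarrow> t = n)"
proof (induction n arbitrary: b xc t)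
  case (Suc n)
  obtain b' x' t' where st: "loop_state alg eigv C K Xb u s n = (b', x', t')" by (cases "loop_state alg eigv C K Xb u s n")
  from Suc.IH[OF st] Suc.prems show ?case
    by (auto simp: loop_state_Suc st guarded_def loop_step_def loop_active_def split: if_splits sum.splits)
qed (auto simp: loop_state_0)

lemma loop_state_final: "\<not> loop_active (loop_state alg eigv C K (Xb :: nat \<Rightarrow> real^'n::finite) u s (loop_length TYPE('n)))"
proof
  assume act: "loop_active (loop_state alg eigv C K Xb u s (loop_length TYPE('n)))"
  obtain b x t where st: "loop_state alg eigv C K Xb u s (loop_length TYPE('n)) = (b, x, t)"
    by (cases "loop_state alg eigv C K Xb u s (loop_length TYPE('n))")
  then have "t = loop_length TYPE('n)" using loop_state_count[OF st] act by simp
  then have "loop_bound TYPE('n) \<le> real t" unfolding loop_length_def by (simp add: real_nat_ceiling_ge)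
  then show False using act st by (simp add: loop_active_def)
qed

lemma cov_sdp_of_means_eq:
  fixes alg :: "('n::finite, 's) solver"
  shows "cov_sdp_of_means alg eigv C B x K u s =
     fst (snd (loop_state alg eigv C K (block_means K B x) u s (loop_length TYPE('n))))"
proof -
  let ?Xb = "block_means K B x"
  have "cov_sdp_of_means alg eigv C B x K u s =
     (let (b, xc, t) = while loop_active (loop_step alg eigv C K ?Xb u s) (True, coord_median K ?Xb, 0) in xc)"
    unfolding cov_sdp_of_means_def loop_active_def loop_step_def loop_bound_def Let_def by simp
  also have "while loop_active (loop_step alg eigv C K ?Xb u s) (True, coord_median K ?Xb, 0)
      = loop_state alg eigv C K ?Xb u s (loop_length TYPE('n))"
    unfolding loop_state_def using loop_state_final unfolding loop_state_def by (intro while_eq_guarded_funpow)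
  finally show ?thesis by (simp add: case_prod_beta)
qed

section \<open>The outcome of one pass and the error of the main loop in the good event\<close>

context central_sample
begin

lemma solved_le_test:
  assumes "0 < \<rho>" "solved K Xb xc \<rho> p" "R < norm (xc - \<mu>)"
  shows "objective K p \<le> 1.0001 * (1 / (\<rho> * (norm (xc - \<mu>) - R)\<^sup>2) + 1 / 90)"
proof -
  obtain A where A: "psd A" "relaxed_value K Xb xc \<rho> A \<le> 1 / (\<rho> * (norm (xc - \<mu>) - R)\<^sup>2) + 1 / 90"
    by (rule relaxed_value_small[OF assms(1,3)])
  have "objective K p \<le> 1.0001 * relaxed_value K Xb xc \<rho> A" using assms(2) A by (simp add: solved_def)
  also have "\<dots> \<le> 1.0001 * (1 / (\<rho> * (norm (xc - \<mu>) - R)\<^sup>2) + 1 / 90)" using A by (intro mult_left_mono) auto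
  finally show ?thesis .
qed

lemma solved_objective_le_1:
  assumes "0 < \<rho>" "solved K Xb xc \<rho> p" "objective K p \<le> 1"
  shows "1 \<le> \<rho> * (norm (xc - \<mu>) + 8 * R)\<^sup>2"
proof -
  have "cov_feasible K Xb xc \<rho> p" using assms by (simp add: solved_def)
  then show ?thesis using relaxed_value_le_objective[OF K] assms
    by (intro relaxed_value_le_1_imp[of \<rho> "fst p"]) (force simp: cov_feasible_def)+
qed

lemma next_rho_pos: "0 \<le> \<rho>m \<Longrightarrow> \<rho>m < \<rho>M \<Longrightarrow> 0 < next_rho K' (\<rho>m, \<rho>M, p, i)"
  unfolding next_rho_def by (simp add: add_nonneg_pos)

lemma search_state_solved:
  assumes \<rho>0: "0 < \<rho>0" and 0: "solved K Xb xc \<rho>0 (run \<rho>0 (s 0))"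
    and calls: "\<And>i. i < n \<Longrightarrow> 0 < next_rho K (search_state run K \<rho>0 T s i) \<Longrightarrow>
      solved K Xb xc (next_rho K (search_state run K \<rho>0 T s i)) (run (next_rho K (search_state run K \<rho>0 T s i)) (s (Suc i)))"
    and st: "search_state run K \<rho>0 T s n = (\<rho>m, \<rho>M, p, i)"
  shows "0 \<le> \<rho>m" "\<rho>m < \<rho>M" "\<exists>\<rho>>0. solved K Xb xc \<rho> p"
proof -
  have "0 \<le> \<rho>m \<and> \<rho>m < \<rho>M \<and> (\<exists>\<rho>>0. solved K Xb xc \<rho> p)"
    using calls st
  proof (induction n arbitrary: \<rho>m \<rho>M p i)
    case 0
    then show ?case using assms by (auto simp: search_state_0)
  next
    case (Suc n)
    obtain a b q j where st: "search_state run K \<rho>0 T s n = (a, b, q, j)" by (cases "search_state run K \<rho>0 T s n")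
    have IH: "0 \<le> a \<and> a < b \<and> (\<exists>\<rho>>0. solved K Xb xc \<rho> q)" using Suc.IH[OF Suc.prems(1) st] by simp
    show ?case
    proof (cases "search_active K T (a, b, q, j)")
      case True
      then have "j = n" using search_state_count[OF st] by simp
      have pos: "0 < next_rho K (a, b, q, j)" using IH by (simp add: next_rho_pos)
      have "solved K Xb xc (next_rho K (a, b, q, j)) (run (next_rho K (a, b, q, j)) (s (Suc n)))"
        using Suc.prems(1)[of n] pos by (simp add: st)
      then show ?thesis
        using Suc.prems(2) True IH \<open>j = n\<close> pos
        by (auto simp: search_state_Suc st guarded_def search_step_def split: if_splits)
    next
      case False
      then show ?thesis using Suc.prems(2) IH by (simp add: search_state_Suc st guarded_def)
    qed
  qed
  then show "0 \<le> \<rho>m" "\<rho>m < \<rho>M" "\<exists>\<rho>>0. solved K Xb xc \<rho> p" by auto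
qed

text \<open>The first step halves \<open>\<rho>\<^sub>M\<close> without a call there, which is harmless since \<open>\<rho>\<^sub>0 / 2\<close> is still
  large compared with \<open>1 / \<bar>xc - \<mu>\<bar>\<^sup>2\<close>.\<close>

lemma search_state_bracket:
  assumes \<rho>0: "0 < \<rho>0"
    and half: "\<exists>A. psd A \<and> relaxed_value K Xb xc (\<rho>0 / 2) A < 0.9981"
    and obj0: "objective K (run \<rho>0 (s 0)) < 0.9981"
    and T: "0 < T"
    and calls: "\<And>i. i < n \<Longrightarrow> 0 < next_rho K (search_state run K \<rho>0 T s i) \<Longrightarrow>
      solved K Xb xc (next_rho K (search_state run K \<rho>0 T s i)) (run (next_rho K (search_state run K \<rho>0 T s i)) (s (Suc i)))"
    and n: "1 \<le> n" and st: "search_state run K \<rho>0 T s n = (\<rho>m, \<rho>M, p, i)"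
    and out: "objective K p \<notin> {0.9981..1}" and i: "i = n"
  shows "\<rho>M - \<rho>m = \<rho>0 / 2 ^ n \<and> (\<exists>A. psd A \<and> relaxed_value K Xb xc \<rho>M A < 0.9981) \<and>
    (\<rho>m = 0 \<or> 0 < \<rho>m \<and> (\<forall>A. psd A \<longrightarrow> 1 / 1.0001 < relaxed_value K Xb xc \<rho>m A)) \<and>
    solved K Xb xc ((\<rho>m + \<rho>M) / 2) p \<and> 0 \<le> \<rho>m \<and> \<rho>m < \<rho>M"
  using n calls st out i
proof (induction n arbitrary: \<rho>m \<rho>M p i rule: nat_induct_at_least)
  case base
  have act: "search_active K T (0, \<rho>0, run \<rho>0 (s 0), 0)"
    using T obj0 by (simp add: search_active_def)
  have nr: "next_rho K (0, \<rho>0, run \<rho>0 (s 0), 0) = \<rho>0 / 4"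
    using obj0 by (simp add: next_rho_def)
  have "(\<rho>m, \<rho>M, p, i) = search_step run K s (0, \<rho>0, run \<rho>0 (s 0), 0)"
    using base(2) act search_state_Suc[of run K \<rho>0 T s 0] by (simp add: search_state_0 guarded_step)
  then have eqs: "\<rho>m = 0" "\<rho>M = \<rho>0 / 2" "p = run (\<rho>0 / 4) (s 1)" "(\<rho>m + \<rho>M) / 2 = \<rho>0 / 4"
    using obj0 by (auto simp: search_step_def nr)
  have "solved K Xb xc (\<rho>0 / 4) (run (\<rho>0 / 4) (s 1))"
    using base(1)[of 0] \<rho>0 by (simp add: search_state_0 nr)
  then show ?case using half \<rho>0 unfolding eqs(4) unfolding eqs by simp
next
  case (Suc n)
  obtain a b q j where st: "search_state run K \<rho>0 T s n = (a, b, q, j)" by (cases "search_state run K \<rho>0 T s n")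
  have act: "search_active K T (a, b, q, j)"
  proof (rule ccontr)
    assume "\<not> ?thesis"
    then have "(\<rho>m, \<rho>M, p, i) = (a, b, q, j)" using Suc.prems(2) by (simp add: search_state_Suc st guarded_def)
    then show False using search_state_count[OF st] Suc.prems(4) by simp
  qed
  have j: "j = n" using search_state_count[OF st] act by simp
  have q: "objective K q \<notin> {0.9981..1}" using act by (simp add: search_active_def)
  have IH: "b - a = \<rho>0 / 2 ^ n" "\<exists>A. psd A \<and> relaxed_value K Xb xc b A < 0.9981"
    "a = 0 \<or> 0 < a \<and> (\<forall>A. psd A \<longrightarrow> 1 / 1.0001 < relaxed_value K Xb xc a A)"
    "solved K Xb xc ((a + b) / 2) q" "0 \<le> a" "a < b"
    using Suc.IH[OF _ st q j] Suc.prems(1) by auto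
  let ?\<rho> = "next_rho K (a, b, q, j)"
  have pos: "0 < ?\<rho>" using IH by (simp add: next_rho_pos)
  have sol: "solved K Xb xc ?\<rho> (run ?\<rho> (s (Suc n)))"
    using Suc.prems(1)[of n] pos by (simp add: st)
  have new: "(\<rho>m, \<rho>M, p, i) = search_step run K s (a, b, q, j)"
    using Suc.prems(2) act by (simp add: search_state_Suc st guarded_def)
  have feas: "cov_feasible K Xb xc ((a + b) / 2) q"
    and opt: "\<And>A. psd A \<Longrightarrow> objective K q \<le> 1.0001 * relaxed_value K Xb xc ((a + b) / 2) A"
    using IH(4) by (auto simp: solved_def)
  show ?case
  proof (cases "objective K q < 0.9981")
    case True
    \<comment> \<open>The computed matrix itself witnesses the small value at the new upper
      end.\<close>
    have "psd (fst q)" "relaxed_value K Xb xc ((a + b) / 2) (fst q) < 0.9981"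
      using feas relaxed_value_le_objective[OF K feas] True by (auto simp: cov_feasible_def)
    moreover have "\<rho>m = a" "\<rho>M = (a + b) / 2" "p = run ?\<rho> (s (Suc n))" "?\<rho> = (\<rho>m + \<rho>M) / 2"
      using new True j by (simp_all add: search_step_def next_rho_def add.commute)
    moreover have "(a + b) / 2 - a = \<rho>0 / 2 ^ Suc n" using IH(1) by (simp add: field_simps)
    moreover have "a < (a + b) / 2" using IH(6) by simp
    ultimately show ?thesis using IH(3,5) sol by metis
  next
    case False
    then have "1 < objective K q" using q by simp
    \<comment> \<open>An objective above 1 bounds all matrices from below, since the pair is optimal
      up to the factor 1.0001.\<close>
    then have "1 / 1.0001 < relaxed_value K Xb xc ((a + b) / 2) A" if "psd A" for A
      using opt[OF that] by simp
    moreover have "\<rho>m = (a + b) / 2" "\<rho>M = b" "p = run ?\<rho> (s (Suc n))" "?\<rho> = (\<rho>m + \<rho>M) / 2"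
      using new False j by (simp_all add: search_step_def next_rho_def add.commute)
    moreover have "b - (a + b) / 2 = \<rho>0 / 2 ^ Suc n" using IH(1) by (simp add: field_simps)
    moreover have "(a + b) / 2 < b" "0 < (a + b) / 2" "0 \<le> (a + b) / 2" using IH(5,6) by simp_all
    ultimately show ?thesis using IH(2) sol by metis
  qed
qed

text \<open>A value below 0.9981 at the upper end rescales to a value below
  \<open>0.9981 * (\<rho>M / \<rho>m)\<close> at the lower end, where every value exceeds 1/1.0001.
  So the quotient of the ends is at least about 1.0018, and the bracket has relative width at least
  0.0017.\<close>

lemma bracket_width:
  assumes "0 \<le> \<rho>m" "\<rho>m < \<rho>M" and M: "\<exists>A. psd A \<and> relaxed_value K Xb xc \<rho>M A < 0.9981"
    and m: "\<rho>m = 0 \<or> 0 < \<rho>m \<and> (\<forall>A. psd A \<longrightarrow> 1 / 1.0001 < relaxed_value K Xb xc \<rho>m A)"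
  shows "17 * \<rho>M \<le> 10000 * (\<rho>M - \<rho>m)" and "1 \<le> \<rho>M * (norm (xc - \<mu>) + 8 * R)\<^sup>2"
proof -
  obtain A where A: "psd A" "relaxed_value K Xb xc \<rho>M A < 0.9981" using M by blast
  then show "1 \<le> \<rho>M * (norm (xc - \<mu>) + 8 * R)\<^sup>2"
    using assms(1,2) by (intro relaxed_value_le_1_imp) auto
  show "17 * \<rho>M \<le> 10000 * (\<rho>M - \<rho>m)"
  proof (cases "\<rho>m = 0")
    case False
    then have pos: "0 < \<rho>m" using assms(1) by simp
    have "1 / 1.0001 < relaxed_value K Xb xc \<rho>m ((\<rho>M / \<rho>m) *\<^sub>R A)"
      using m False A psd_scaleR[OF A(1), of "\<rho>M / \<rho>m"] assms(1,2) by simp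
    also have "\<dots> \<le> \<rho>M / \<rho>m * relaxed_value K Xb xc \<rho>M A"
      using pos assms(2) A by (intro relaxed_value_rescale) auto
    also have "\<dots> \<le> \<rho>M / \<rho>m * 0.9981" using A pos assms(2) by (intro mult_left_mono) auto
    finally show ?thesis using pos by (simp add: field_simps)
  qed (use assms in simp)
qed

text \<open>A search that misses the target while \<open>xc\<close> is far shows that
  \<open>d * \<delta> \<le> 4 * R\<close> (\<open>far\<close>). The last test then decides between
  \<open>m\<close> and \<open>xc\<close>. An objective below 1 gives
  \<open>d * \<delta> \<le> 48 * R\<close>, by \<open>far\<close> or because \<open>xc\<close> is
  near, and \<open>m\<close> is within \<open>\<delta> + R\<close> of \<open>\<mu>\<close>. An
  objective at least 1 is incompatible with a far \<open>xc\<close>, so keeping \<open>xc\<close> is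
  safe.\<close>

lemma solve_sdp_outcome:
  fixes alg :: "('n, 's) solver"
  assumes \<delta>: "0 < \<delta>" and C: "10 ^ 5 \<le> C" and D: "norm (xc - \<mu>) \<le> 41 * (sqrt (real CARD('n)) * R)"
    and solved: "pass_solved alg C K Xb u xc s"
  shows "case solve_sdp alg C K Xb xc u s of
      Inl A \<Rightarrow> \<exists>\<rho>>0. \<exists>p. solved K Xb xc \<rho> p \<and> objective K p \<in> {0.9981..1} \<and> A = (1 / trace (fst p)) *\<^sub>R fst p
    | Inr z \<Rightarrow> norm (z - \<mu>) \<le> 49 * R"
proof -
  define d where "d = real CARD('n)"
  have d: "1 \<le> d" using card_ge_1[where 'n = 'n] by (simp add: d_def)
  define \<rho>0 where "\<rho>0 = d / \<delta>\<^sup>2"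
  have \<rho>0: "0 < \<rho>0" using \<delta> d by (simp add: \<rho>0_def)
  define \<rho>1 where "\<rho>1 = 1 / (d * \<delta>)\<^sup>2"
  have \<rho>1: "0 < \<rho>1" using \<delta> d by (simp add: \<rho>1_def)
  define T where "T = log 2 (C * d ^ 4)"
  define n where "n = search_length TYPE('n) C"
  have n: "1 \<le> n" "C * d ^ 4 \<le> 2 ^ n" "nat \<lceil>T\<rceil> = n"
    using search_length_ge[OF C, where 'n = 'n] by (auto simp: n_def d_def T_def search_length_def)
  have T: "0 < T" using n(1,3) by linarith
  define run where "run = alg u K Xb xc"
  have calls: "solved K Xb xc \<rho>0 (run \<rho>0 (s 0))" "solved K Xb xc (\<rho>0 / 2) (run (\<rho>0 / 2) (s 1))"
    "\<And>i. i < n \<Longrightarrow> 0 < next_rho K (search_state run K \<rho>0 T s i) \<Longrightarrow>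
      solved K Xb xc (next_rho K (search_state run K \<rho>0 T s i)) (run (next_rho K (search_state run K \<rho>0 T s i)) (s (Suc i)))"
    "\<And>i. i \<le> Suc n \<Longrightarrow> solved K Xb xc \<rho>1 (run \<rho>1 (s i))"
    using solved \<rho>0 \<rho>1 unfolding pass_solved_def Let_def \<rho>0_def \<rho>1_def T_def n_def run_def d_def by auto
  obtain \<rho>m \<rho>M p i where st: "search_state run K \<rho>0 T s n = (\<rho>m, \<rho>M, p, i)"
    by (cases "search_state run K \<rho>0 T s n")
  note st_solved = search_state_solved[OF \<rho>0 calls(1) calls(3) st]
  obtain q k where bs: "binary_search run K \<rho>0 T s = (q, k)" by (cases "binary_search run K \<rho>0 T s")
  have qk: "(q, k) = (if i = 0 then (run ((\<rho>m + \<rho>M) / 2) (s 1), 2) else (p, Suc i))"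
    using binary_search_eq[OF _ st] n(3) bs by simp
  have k: "k \<le> Suc n" using qk search_state_count[OF st] n(1) by (auto split: if_splits)
  have q: "\<exists>\<rho>>0. solved K Xb xc \<rho> q"
  proof (cases "i = 0")
    case True
    then show ?thesis using qk search_state_no_steps[of run K \<rho>0 T s n \<rho>m \<rho>M p] st calls(2) \<rho>0
      by (intro exI[of _ "\<rho>0 / 2"]) auto
  next
    case False
    then show ?thesis using qk st_solved by auto
  qed
  have far: "d * \<delta> \<le> 4 * R" if D40: "40 * R < norm (xc - \<mu>)" and out: "objective K q \<notin> {0.9981..1}"
  proof -
    have "0 < 9 * sqrt d * R" using \<delta> delta_le unfolding d_def by linarith
    then have Rpos: "0 < R" using d by (simp add: zero_less_mult_iff)
    define D where "D = norm (xc - \<mu>)"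
    have DR: "39 * R < D - R" "R < D" using D40 Rpos by (auto simp: D_def)
    have "\<delta>\<^sup>2 \<le> (9 * sqrt d * R)\<^sup>2" using delta_le delta_nonneg by (intro power_mono) (auto simp: d_def)
    then have "\<delta>\<^sup>2 \<le> 81 * d * R\<^sup>2" using d by (simp add: power_mult_distrib)
    then have "1 \<le> \<rho>0 * (81 * R\<^sup>2)" using \<delta> d by (simp add: \<rho>0_def field_simps)
    moreover have "(39 * R)\<^sup>2 \<le> (D - R)\<^sup>2" using DR Rpos by (intro power_mono) auto
    then have "\<rho>0 * (1521 * R\<^sup>2) \<le> \<rho>0 * (D - R)\<^sup>2" using \<rho>0 by (intro mult_left_mono) (auto simp: power_mult_distrib)
    \<comment> \<open>By \<open>delta_le\<close> and the distance the quotient is 1521/81 > 18; this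
      leaves room for testing \<open>\<rho>0 / 2\<close> as well.\<close>
    ultimately have big: "18 \<le> \<rho>0 * (D - R)\<^sup>2" by simp
    then have small: "1 / (\<rho>0 * (D - R)\<^sup>2) \<le> 1 / 18" "1 / (\<rho>0 / 2 * (D - R)\<^sup>2) \<le> 1 / 9"
      by (auto intro: divide_left_mono simp: field_simps)
    have obj0: "objective K (run \<rho>0 (s 0)) < 0.9981"
      using solved_le_test[OF \<rho>0 calls(1)] DR small(1) by (simp add: D_def)
    have half: "\<exists>A. psd A \<and> relaxed_value K Xb xc (\<rho>0 / 2) A < 0.9981"
    proof -
      obtain A where "psd A" "relaxed_value K Xb xc (\<rho>0 / 2) A \<le> 1 / (\<rho>0 / 2 * (norm (xc - \<mu>) - R)\<^sup>2) + 1 / 90"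
        by (rule relaxed_value_small[of "\<rho>0 / 2" xc]) (use \<rho>0 DR in \<open>auto simp: D_def\<close>)
      then show ?thesis using small(2) unfolding D_def[symmetric] by (intro exI[of _ A]) simp
    qed
    have i0: "i \<noteq> 0"
    proof
      assume "i = 0"
      then have "\<not> search_active K T (0, \<rho>0, run \<rho>0 (s 0), 0)"
        using search_state_no_steps[of run K \<rho>0 T s n \<rho>m \<rho>M p] st n(1) by blast
      then show False using obj0 T by (simp add: search_active_def)
    qed
    then have pq: "q = p" using qk by simp
    have "i = n"
    proof (rule ccontr)
      assume "i \<noteq> n"
      then have "i < n" "\<not> search_active K T (\<rho>m, \<rho>M, p, i)" using search_state_count[OF st] by auto
      then have "T \<le> real i" using out pq by (auto simp: search_active_def)
      then show False using \<open>i < n\<close> n(3) by linarith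
    qed
    \<comment> \<open>The search has made all its \<open>n\<close> halvings, so the width of the
      bracket is known and can be compared with \<open>bracket_width\<close>.\<close>
    note br0 = search_state_bracket[OF \<rho>0 half obj0 T calls(3) n(1) st out[unfolded pq] this]
    have br: "\<rho>M - \<rho>m = \<rho>0 / 2 ^ n" "0 \<le> \<rho>m" "\<rho>m < \<rho>M"
      "\<exists>A. psd A \<and> relaxed_value K Xb xc \<rho>M A < 0.9981"
      "\<rho>m = 0 \<or> 0 < \<rho>m \<and> (\<forall>A. psd A \<longrightarrow> 1 / 1.0001 < relaxed_value K Xb xc \<rho>m A)"
      using br0 by blast+
    note w = bracket_width[of \<rho>m \<rho>M xc]
    have w: "17 * \<rho>M \<le> 10000 * (\<rho>M - \<rho>m)" "1 \<le> \<rho>M * (D + 8 * R)\<^sup>2"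
      using w br by (auto simp: D_def)
    have pos: "0 < \<rho>M" using br by linarith
    have "R \<le> sqrt d * R" using d Rpos mult_right_mono[of 1 "sqrt d" R] by simp
    then have "D + 8 * R \<le> 49 * (sqrt d * R)" using assms(3) by (simp add: D_def d_def)
    then have "(D + 8 * R)\<^sup>2 \<le> (49 * (sqrt d * R))\<^sup>2" using Rpos by (intro power_mono) (auto simp: D_def)
    then have "\<rho>M * (D + 8 * R)\<^sup>2 \<le> \<rho>M * (2401 * d * R\<^sup>2)"
      using pos d by (intro mult_left_mono) (auto simp: power_mult_distrib)
    then have "17 \<le> (17 * \<rho>M) * (2401 * d * R\<^sup>2)" using w(2) by simp
    also have "\<dots> \<le> (10000 * (\<rho>0 / (10 ^ 5 * d ^ 4))) * (2401 * d * R\<^sup>2)"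
    proof (intro mult_right_mono)
      have "10 ^ 5 * d ^ 4 \<le> C * d ^ 4" using C d by (intro mult_right_mono) auto
      also have "\<dots> \<le> 2 ^ n" by (rule n(2))
      finally have "\<rho>0 / 2 ^ n \<le> \<rho>0 / (10 ^ 5 * d ^ 4)" using \<rho>0 d by (intro divide_left_mono) auto
      then have "10000 * (\<rho>0 / 2 ^ n) \<le> 10000 * (\<rho>0 / (10 ^ 5 * d ^ 4))" by (intro mult_left_mono) auto
      then show "17 * \<rho>M \<le> 10000 * (\<rho>0 / (10 ^ 5 * d ^ 4))" using w(1) unfolding br(1) by (rule order_trans[rotated])
    qed (use d in auto)
    \<comment> \<open>One \<open>d\<close> from \<open>\<rho>0\<close> and one from the squared
      radius leave \<open>d\<^sup>2\<close> of the \<open>d ^ 4\<close> in the iteration bound, just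
      what \<open>(d * \<delta>)\<^sup>2\<close> requires.\<close>
    also have "\<dots> = 240.1 * R\<^sup>2 / (d * \<delta>)\<^sup>2"
      using d \<delta> by (simp add: \<rho>0_def field_simps power2_eq_square power4_eq_xxxx)
    finally have "17 * (d * \<delta>)\<^sup>2 \<le> 240.1 * R\<^sup>2" using d \<delta> by (simp add: le_divide_eq)
    then have "170 * (d * \<delta>)\<^sup>2 \<le> 2401 * R\<^sup>2" by simp
    then have "(d * \<delta>)\<^sup>2 \<le> 16 * R\<^sup>2" using zero_le_power2[of R] by linarith
    then have "(d * \<delta>)\<^sup>2 \<le> (4 * R)\<^sup>2" by (simp only: power_mult_distrib) simp
    then show ?thesis by (rule power2_le_imp_le) (use Rpos in simp)
  qed
  have delta_bound: "\<delta> \<le> d * \<delta>" using d delta_nonneg mult_right_mono[of 1 d \<delta>] by simp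
  have unfold: "solve_sdp alg C K Xb xc u s = (if objective K q \<in> {0.9981..1} then Inl ((1 / trace (fst q)) *\<^sub>R fst q)
         else if objective K (run \<rho>1 (s k)) < 1 then Inr m else Inr xc)"
    using bs unfolding solve_sdp_def Let_def run_def \<rho>0_def \<rho>1_def T_def d_def by simp
  show ?thesis
  proof (cases "objective K q \<in> {0.9981..1}")
    case True
    then show ?thesis using q unfolding unfold by (simp only: if_True sum.case) blast
  next
    case False
    note sol = calls(4)[OF k]
    have "norm ((if objective K (run \<rho>1 (s k)) < 1 then m else xc) - \<mu>) \<le> 49 * R"
    proof (cases "objective K (run \<rho>1 (s k)) < 1")
      case True
      have "d * \<delta> \<le> 48 * R"
      proof (cases "40 * R < norm (xc - \<mu>)")
        case True
        then show ?thesis using far False R by simp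
      next
        case near: False
        have "1 \<le> \<rho>1 * (norm (xc - \<mu>) + 8 * R)\<^sup>2" using solved_objective_le_1[OF \<rho>1 sol] True by simp
        then have "(d * \<delta>)\<^sup>2 \<le> (norm (xc - \<mu>) + 8 * R)\<^sup>2" using d \<delta> by (simp add: \<rho>1_def le_divide_eq)
        then have "d * \<delta> \<le> norm (xc - \<mu>) + 8 * R" by (rule power2_le_imp_le) (use R in simp)
        then show ?thesis using near by simp
      qed
      then show ?thesis using True delta_bound coord_median_close_delta by simp
    next
      case ge: False
      have "\<not> 40 * R < norm (xc - \<mu>)"
      proof
        assume D40: "40 * R < norm (xc - \<mu>)"
        define D where "D = norm (xc - \<mu>)"
        have DR: "39 * R \<le> D - R" "R < D" using D40 R by (auto simp: D_def)
        have le: "(d * \<delta>)\<^sup>2 \<le> (4 * R)\<^sup>2" using far[OF D40 False] d \<delta> by (intro power_mono) auto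
        moreover have "(39 * R)\<^sup>2 \<le> (D - R)\<^sup>2" using DR R by (intro power_mono) auto
        moreover have "(4 * R)\<^sup>2 = 16 * R\<^sup>2" "(39 * R)\<^sup>2 = 1521 * R\<^sup>2" by (simp_all add: power_mult_distrib)
        \<comment> \<open>Since 1521/16 > 90, the objective of the last test would be at most 1.0001
          * (1/90 + 1/90), far below 1.\<close>
        ultimately have "90 * (d * \<delta>)\<^sup>2 \<le> (D - R)\<^sup>2" using zero_le_power2[of R] by linarith
        then have "1 / (\<rho>1 * (D - R)\<^sup>2) \<le> 1 / 90" using DR d \<delta> by (simp add: \<rho>1_def divide_le_eq)
        then show False using solved_le_test[OF \<rho>1 sol] DR ge by (simp add: D_def)
      qed
      then show ?thesis using ge R by simp
    qed
    then show ?thesis using False unfolding unfold by auto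
  qed
qed

text \<open>Inside radius \<open>40 * R\<close> no contraction is available, but a step adds at most
  \<open>R\<^sup>2\<close> to the squared error, and 1601 < 41^2.\<close>

lemma median_step_le:
  assumes "unit_top_eigenvector A v" "norm (xc - \<mu>) \<le> 40 * R"
  shows "norm (xc - (- Med K (\<lambda>k. (Xb k - xc) \<bullet> v)) *\<^sub>R v - \<mu>) \<le> 41 * R"
proof (rule power2_le_imp_le)
  have "norm v = 1" using assms(1) by (simp add: unit_top_eigenvector_def)
  from median_step[OF this, of xc]
  have "(norm (xc - (- Med K (\<lambda>k. (Xb k - xc) \<bullet> v)) *\<^sub>R v - \<mu>))\<^sup>2 \<le> (norm (xc - \<mu>))\<^sup>2 + R\<^sup>2"
    using zero_le_power2[of "(xc - \<mu>) \<bullet> v"] by linarith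
  also have "\<dots> \<le> (40 * R)\<^sup>2 + R\<^sup>2" using assms(2) by (intro add_right_mono power_mono) auto
  also have "\<dots> \<le> (41 * R)\<^sup>2" by (simp add: power_mult_distrib)
  finally show "(norm (xc - (- Med K (\<lambda>k. (Xb k - xc) \<bullet> v)) *\<^sub>R v - \<mu>))\<^sup>2 \<le> (41 * R)\<^sup>2" .
qed (use R in simp)

text \<open>For \<open>\<delta> = 0\<close> a strict majority of the block means equals
  \<open>m\<close>, so every median step is 0, and both answers of a stopping pass are
  \<open>m\<close>. This holds whatever the solver returns.\<close>

lemma loop_state_delta_zero:
  fixes alg :: "('n, 's) solver"
  assumes \<delta>: "\<delta> = 0"
  shows "fst (snd (loop_state alg eigv C K Xb u s n)) = m"
proof (induction n)
  case (Suc n)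
  obtain b xc t where st: "loop_state alg eigv C K Xb u s n = (b, xc, t)" by (cases "loop_state alg eigv C K Xb u s n")
  then have xc: "xc = m" using Suc by simp
  have "K < 2 * card {k\<in>{1..K}. norm (Xb k - m) \<le> 0}"
    using K \<delta> by (intro Med_zero_imp_majority_zero) auto
  then have maj: "K < 2 * card {k\<in>{1..K}. Xb k = m}" by simp
  have "Med K (\<lambda>k. (Xb k - m) \<bullet> v) = 0" for v
  proof -
    have "card {k\<in>{1..K}. Xb k = m} \<le> card {k\<in>{1..K}. \<bar>(Xb k - m) \<bullet> v - 0\<bar> \<le> 0}"
      by (intro card_mono) auto
    then have "\<bar>Med K (\<lambda>k. (Xb k - m) \<bullet> v) - 0\<bar> \<le> 0" using maj by (intro Med_close) linarith
    then show ?thesis by simp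
  qed
  moreover have "z = m" if "solve_sdp alg C K Xb m u (s t) = Inr z" for z
    using that by (auto simp: solve_sdp_def Let_def split: if_splits prod.splits)
  ultimately show ?case
    by (auto simp: loop_state_Suc st xc guarded_def loop_step_def split: sum.splits)
qed (simp add: loop_state_0)

text \<open>While the loop runs, \<open>bound\<close> controls the error; a stopping pass leaves it
  within \<open>49 * R\<close> by \<open>solve_sdp_outcome\<close>.\<close>

theorem loop_state_error:
  fixes alg :: "('n, 's) solver"
  assumes C: "10 ^ 5 \<le> C" and eigv: "\<And>A. transpose A = A \<Longrightarrow> unit_top_eigenvector A (eigv A)"
    and solved: "\<And>n. n < loop_length TYPE('n) \<Longrightarrow>
      pass_solved alg C K Xb u (fst (snd (loop_state alg eigv C K Xb u s n))) (s n)"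
  shows "norm (fst (snd (loop_state alg eigv C K Xb u s (loop_length TYPE('n)))) - \<mu>) \<le> 49 * R"
proof (cases "\<delta> = 0")
  case True
  then show ?thesis
    using loop_state_delta_zero[OF True, of alg eigv C u s "loop_length TYPE('n)"] coord_median_close_delta R by simp
next
  case False
  then have \<delta>: "0 < \<delta>" using delta_nonneg by simp
  define d where "d = real CARD('n)"
  have d: "1 \<le> d" using card_ge_1[where 'n = 'n] by (simp add: d_def)
  \<comment> \<open>The geometric term describes contraction from the initial error of the
    coordinate-wise median, and \<open>41 * R\<close> is the radius that a step from the near region
    cannot leave.\<close>
  define bound where "bound t = max (0.9 ^ t * (sqrt d * R)) (41 * R)" for t :: nat
  have inv: "(b \<longrightarrow> norm (xc - \<mu>) \<le> bound t) \<and> (\<not> b \<longrightarrow> norm (xc - \<mu>) \<le> 49 * R)"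
    if "n \<le> loop_length TYPE('n)" "loop_state alg eigv C K Xb u s n = (b, xc, t)" for n b xc t
    using that
  proof (induction n arbitrary: b xc t)
    case 0
    then show ?case using coord_median_close by (simp add: loop_state_0 bound_def d_def)
  next
    case (Suc n)
    obtain b' xc' t' where st: "loop_state alg eigv C K Xb u s n = (b', xc', t')" by (cases "loop_state alg eigv C K Xb u s n")
    note IH = Suc.IH[OF _ st]
    show ?case
    proof (cases "loop_active (b', xc', t')")
      case True
      then have t': "t' = n" and b': "b'" using loop_state_count[OF st] by (auto simp: loop_active_def)
      have le: "norm (xc' - \<mu>) \<le> bound t'" using IH b' Suc.prems by simp
      have "0 \<le> sqrt d * R" "R \<le> sqrt d * R" using d R mult_right_mono[of 1 "sqrt d" R] by auto
      moreover have "0.9 ^ t' * (sqrt d * R) \<le> 1 * (sqrt d * R)"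
        using \<open>0 \<le> sqrt d * R\<close> by (intro mult_right_mono power_le_one) auto
      ultimately have "bound t' \<le> 41 * (sqrt d * R)" unfolding bound_def by (intro max.boundedI) linarith+
      then have D: "norm (xc' - \<mu>) \<le> 41 * (sqrt (real CARD('n)) * R)" using le by (simp add: d_def)
      have "pass_solved alg C K Xb u xc' (s t')" using solved[of n] Suc.prems st t' by simp
      note out = solve_sdp_outcome[OF \<delta> C D this]
      have new: "(b, xc, t) = loop_step alg eigv C K Xb u s (b', xc', t')"
        using Suc.prems st True by (simp add: loop_state_Suc guarded_step)
      show ?thesis
      proof (cases "solve_sdp alg C K Xb xc' u (s t')")
        case (Inl A)
        then obtain \<rho> p where p: "0 < \<rho>" "solved K Xb xc' \<rho> p" "objective K p \<in> {0.9981..1}" "A = (1 / trace (fst p)) *\<^sub>R fst p"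
          using out by auto
        have "psd (fst p)" using p(2) by (simp add: solved_def cov_feasible_def)
        then have "transpose A = A" unfolding p(4) by (simp add: psd_def transpose_scalar)
        then have v: "unit_top_eigenvector A (eigv A)" by (rule eigv)
        have "norm (xc - \<mu>) \<le> bound t"
        proof (cases "40 * R < norm (xc' - \<mu>)")
          case True
          then have "norm (xc - \<mu>) \<le> 0.9 * norm (xc' - \<mu>)"
            using median_step_contracts[OF p(1-3) v[unfolded p(4)] True] new Inl p(4) by (simp add: loop_step_def)
          also have "\<dots> \<le> 0.9 * bound t'" using le by (intro mult_left_mono) auto
          also have "\<dots> \<le> bound t"
          proof -
            have t: "t = Suc t'" using new Inl by (simp add: loop_step_def)
            have "bound t' = 0.9 ^ t' * (sqrt d * R) \<or> bound t' = 41 * R" by (auto simp: bound_def max_def)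
            then show ?thesis
            proof
              assume "bound t' = 0.9 ^ t' * (sqrt d * R)"
              then have "0.9 * bound t' = 0.9 ^ t * (sqrt d * R)" by (simp add: t)
              then show ?thesis unfolding bound_def by linarith
            next
              assume "bound t' = 41 * R"
              moreover have "0.9 * (41 * R) \<le> 41 * R" using R by simp
              ultimately show ?thesis unfolding bound_def by linarith
            qed
          qed
          finally show ?thesis .
        next
          case False
          then have "norm (xc - \<mu>) \<le> 41 * R"
            using median_step_le[OF v, of xc'] new Inl by (simp add: loop_step_def)
          then show ?thesis by (simp add: bound_def)
        qed
        then show ?thesis using new Inl by (simp add: loop_step_def)
      next
        case (Inr z)
        then show ?thesis using new out by (simp add: loop_step_def)
      qed
    next
      case False
      then show ?thesis using IH Suc.prems by (simp add: loop_state_Suc st guarded_def)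
    qed
  qed
  obtain b xc t where st: "loop_state alg eigv C K Xb u s (loop_length TYPE('n)) = (b, xc, t)"
    by (cases "loop_state alg eigv C K Xb u s (loop_length TYPE('n))")
  have "norm (xc - \<mu>) \<le> 49 * R"
  proof (cases b)
    case True
    \<comment> \<open>The loop has used up its passes. Their number is chosen so that the geometric
      term has fallen to \<open>R / 8\<close>, hence \<open>41 * R\<close> dominates.\<close>
    then have "loop_bound TYPE('n) \<le> real t"
      using loop_state_final[of alg eigv C K Xb u s] st by (simp add: loop_active_def)
    moreover have "sqrt 0.81 = (0.9 :: real)" by (rule real_sqrt_unique) (auto simp: power2_eq_square)
    then have "1 / sqrt 0.81 = (10 / 9 :: real)" by (simp only:) simp
    ultimately have "ln (8 * sqrt d) / ln (10 / 9) \<le> real t" unfolding loop_bound_def d_def by (simp only:)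
    then have "ln (8 * sqrt d) \<le> real t * ln (10 / 9)" by (simp add: pos_divide_le_eq)
    also have "\<dots> = ln ((10 / 9) ^ t)" by (simp add: ln_realpow)
    finally have "8 * sqrt d \<le> (10 / 9) ^ t" using d by (subst (asm) ln_le_cancel_iff) auto
    then have "0.9 ^ t * (8 * sqrt d) \<le> 0.9 ^ t * (10 / 9) ^ t" by (intro mult_left_mono) auto
    also have "\<dots> = 1" by (simp flip: power_mult_distrib)
    finally have "(0.9 ^ t * sqrt d) * R \<le> (1 / 8) * R" using R by (intro mult_right_mono) auto
    then have "bound t \<le> 41 * R" using R by (simp add: bound_def mult.assoc)
    then show ?thesis using inv[OF _ st] True R by simp
  next
    case False
    then show ?thesis using inv[OF _ st] by simp
  qed
  then show ?thesis by (simp add: st)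
qed

end

section \<open>Measurability and failure of the solver\<close>

abbreviation pair_space :: "nat \<Rightarrow> ((real^'n^'n) \<times> (nat \<Rightarrow> real)) measure" where
  "pair_space K \<equiv> borel \<Otimes>\<^sub>M PiM {1..K} (\<lambda>_. borel)"

abbreviation sample_space :: "nat \<Rightarrow> (nat \<Rightarrow> real^'n) measure" where
  "sample_space K \<equiv> PiM {1..K} (\<lambda>_. borel)"

lemma vec_lambda_measurable:
  fixes f :: "'n::finite \<Rightarrow> 'a \<Rightarrow> real"
  assumes "\<And>i. f i \<in> borel_measurable N"
  shows "(\<lambda>w. \<chi> i. f i w) \<in> borel_measurable N"
proof -
  have "(\<lambda>w. \<chi> i. f i w) = (\<lambda>w. \<Sum>i\<in>UNIV. f i w *\<^sub>R axis i 1)"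
    by (simp add: fun_eq_iff vec_eq_iff axis_def if_distrib[of "(*\<^sub>R) _"] if_distrib cong: if_cong)
  then show ?thesis using assms by simp
qed

lemma continuous_matrix_quad: "continuous_on UNIV (\<lambda>p :: (real^'n^'n) \<times> (real^'n). snd p \<bullet> (fst p *v snd p))"
  unfolding matrix_vector_mult_def inner_vec_def
  by (intro continuous_intros continuous_on_vec_lambda)

lemma quad_measurable [measurable]:
  fixes A :: "'a \<Rightarrow> real^'n^'n"
  assumes [measurable]: "A \<in> borel_measurable N" "x \<in> borel_measurable N"
  shows "(\<lambda>w. x w \<bullet> (A w *v x w)) \<in> borel_measurable N"
  using borel_measurable_continuous_on[OF continuous_matrix_quad, of "\<lambda>w. (A w, x w)" N] by simp

lemma trace_measurable [measurable]: "trace \<in> borel_measurable (borel :: (real^'n^'n) measure)"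
  unfolding trace_def by (intro borel_measurable_continuous_onI continuous_intros)

lemma closed_psd: "closed {A :: real^'n^'n. psd A}"
proof -
  have "{A :: real^'n^'n. psd A} = (\<Inter>i. \<Inter>j. {A. A $ j $ i = A $ i $ j}) \<inter> (\<Inter>v. {A. 0 \<le> v \<bullet> (A *v v)})"
    by (auto simp: psd_def transpose_def vec_eq_iff)
  moreover have "continuous_on UNIV (\<lambda>A :: real^'n^'n. v \<bullet> (A *v v))" for v
    using bounded_linear_quad by (intro linear_continuous_on)
  then have "closed {A :: real^'n^'n. 0 \<le> v \<bullet> (A *v v)}" for v
    by (intro closed_Collect_le continuous_on_const)
  moreover have "closed {A :: real^'n^'n. A $ j $ i = A $ i $ j}" for i j
    by (intro closed_Collect_eq continuous_intros)
  ultimately show ?thesis by (simp add: closed_Int closed_INT)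
qed

lemma psd_measurable [measurable]: "Measurable.pred borel (psd :: real^'n^'n \<Rightarrow> bool)"
  using borel_closed[OF closed_psd] by (simp add: pred_def)

lemma measurable_PiM_component:
  assumes "f \<in> measurable N (PiM I M)" "k \<in> I"
  shows "(\<lambda>w. f w k) \<in> measurable N (M k)"
  using measurable_compose[OF assms(1) measurable_component_singleton[OF assms(2)]] by simp

lemma objective_measurable:
  assumes [measurable]: "p \<in> measurable N (pair_space K)"
  shows "(\<lambda>w. objective K (p w)) \<in> borel_measurable N"
proof -
  have "(\<lambda>w. snd (p w)) \<in> measurable N (PiM {1..K} (\<lambda>_. borel))" by measurable
  from measurable_PiM_component[OF this] have [measurable]: "k \<in> {1..K} \<Longrightarrow> (\<lambda>w. snd (p w) k) \<in> borel_measurable N" for k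
    by simp
  show ?thesis unfolding objective_def by measurable
qed

lemma coord_median_measurable:
  fixes Xb :: "'w \<Rightarrow> nat \<Rightarrow> real^'n"
  assumes K: "1 \<le> K" and Xb: "Xb \<in> measurable N (sample_space K)"
  shows "(\<lambda>w. coord_median K (Xb w)) \<in> borel_measurable N"
proof -
  have comp: "k \<in> {1..K} \<Longrightarrow> (\<lambda>w. Xb w k) \<in> borel_measurable N" for k
    using measurable_PiM_component[OF Xb] by simp
  have "(\<lambda>x :: real^'n. x $ i) \<in> borel_measurable borel" for i
    by (intro borel_measurable_continuous_onI continuous_intros)
  then have "k \<in> {1..K} \<Longrightarrow> (\<lambda>w. Xb w k $ i) \<in> borel_measurable N" for k i
    using measurable_compose[OF comp] by blast
  then show ?thesis
    unfolding coord_median_def using K by (intro vec_lambda_measurable borel_measurable_Med) auto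
qed

lemma delta_measurable:
  fixes Xb :: "'w \<Rightarrow> nat \<Rightarrow> real^'n"
  assumes K: "1 \<le> K" and Xb: "Xb \<in> measurable N (sample_space K)"
  shows "(\<lambda>w. Med K (\<lambda>k. norm (Xb w k - coord_median K (Xb w)))) \<in> borel_measurable N"
proof -
  have [measurable]: "k \<in> {1..K} \<Longrightarrow> (\<lambda>w. Xb w k) \<in> borel_measurable N" for k
    using measurable_PiM_component[OF Xb] by simp
  note [measurable] = coord_median_measurable[OF assms]
  show ?thesis using K by (intro borel_measurable_Med) auto
qed

lemma continuous_relaxed_value: "continuous_on UNIV (relaxed_value K Xb xc \<rho>)"
proof -
  have "continuous_on UNIV (\<lambda>A :: real^'n^'n. v \<bullet> (A *v v))" for v
    using bounded_linear_quad by (intro linear_continuous_on)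
  then show ?thesis
    unfolding relaxed_value_def trace_def divide_inverse
    by (intro continuous_on_add continuous_on_mult continuous_on_sum continuous_on_max continuous_on_diff
        continuous_on_const continuous_on_component continuous_on_id)
qed

text \<open>For fixed data the condition on \<open>A\<close> is closed, so it passes from
  \<open>D\<close> to its closure. With countable \<open>D\<close> it becomes a countable
  conjunction.\<close>

lemma solved_iff_dense:
  assumes "D \<subseteq> {A. psd A}" "{A. psd A} \<subseteq> closure D"
  shows "solved K Xb xc \<rho> p \<longleftrightarrow> cov_feasible K Xb xc \<rho> p \<and>
     (\<forall>A\<in>D. objective K p \<le> 1.0001 * relaxed_value K Xb xc \<rho> A)"
proof -
  have "objective K p \<le> 1.0001 * relaxed_value K Xb xc \<rho> A"
    if D: "\<forall>A\<in>D. objective K p \<le> 1.0001 * relaxed_value K Xb xc \<rho> A" and A: "psd A" for A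
  proof -
    have "closed {A. objective K p \<le> 1.0001 * relaxed_value K Xb xc \<rho> A}"
      by (intro closed_Collect_le continuous_intros continuous_relaxed_value)
    then have "closure D \<subseteq> {A. objective K p \<le> 1.0001 * relaxed_value K Xb xc \<rho> A}"
      using D by (intro closure_minimal) auto
    then show ?thesis using A assms(2) by auto
  qed
  then show ?thesis using assms(1) by (auto simp: solved_def)
qed

lemma solved_measurable:
  fixes Xb :: "'a \<Rightarrow> nat \<Rightarrow> real^'n"
  assumes Xb: "Xb \<in> measurable N (sample_space K)" and [measurable]: "xc \<in> borel_measurable N" "\<rho> \<in> borel_measurable N"
    and p: "p \<in> measurable N (pair_space K)"
  shows "Measurable.pred N (\<lambda>w. solved K (Xb w) (xc w) (\<rho> w) (p w))"
proof -
  obtain D :: "(real^'n^'n) set" where D: "countable D" "D \<subseteq> {A. psd A}" "{A. psd A} \<subseteq> closure D"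
    using separable[of "{A :: real^'n^'n. psd A}"] by blast
  have [measurable]: "k \<in> {1..K} \<Longrightarrow> (\<lambda>w. Xb w k) \<in> borel_measurable N" for k
    using measurable_PiM_component[OF Xb] by simp
  have "(\<lambda>w. snd (p w)) \<in> measurable N (PiM {1..K} (\<lambda>_. borel))" using p by measurable
  from measurable_PiM_component[OF this] have [measurable]: "k \<in> {1..K} \<Longrightarrow> (\<lambda>w. snd (p w) k) \<in> borel_measurable N" for k
    by simp
  have [measurable]: "(\<lambda>w. fst (p w)) \<in> borel_measurable N" using p by measurable
  note [measurable] = objective_measurable[OF p]
  have [measurable]: "(\<lambda>w. relaxed_value K (Xb w) (xc w) (\<rho> w) A) \<in> borel_measurable N" for A
    unfolding relaxed_value_def by measurable
  have [measurable]: "Measurable.pred N (\<lambda>w. psd (fst (p w)))"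
    by (rule measurable_compose[OF _ psd_measurable]) measurable
  have "Measurable.pred N (\<lambda>w. cov_feasible K (Xb w) (xc w) (\<rho> w) (p w))"
    unfolding cov_feasible_def by measurable
  moreover have "Measurable.pred N (\<lambda>w. \<forall>A\<in>D. objective K (p w) \<le> 1.0001 * relaxed_value K (Xb w) (xc w) (\<rho> w) A)"
  proof -
    \<comment> \<open>The enumeration \<open>from_nat_into\<close> requires a nonempty set, and the
      zero matrix lies in the closure of \<open>D\<close>.\<close>
    have "psd (0 :: real^'n^'n)" by (simp add: psd_def transpose_def vec_eq_iff)
    then have "D \<noteq> {}" using D(3) by auto
    then have "(\<forall>A\<in>D. P A) \<longleftrightarrow> (\<forall>i. P (from_nat_into D i))" for P
      using range_from_nat_into[OF _ D(1)] by (metis rangeE rangeI)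
    then show ?thesis by simp
  qed
  ultimately show ?thesis unfolding solved_iff_dense[OF D(2,3)] by measurable
qed

lemma solver_measurable:
  fixes alg :: "('n::finite, 's) solver"
  assumes solver: "covering_solver S alg"
    and [measurable]: "Xb \<in> measurable N (sample_space K)" "xc \<in> borel_measurable N" "\<rho> \<in> borel_measurable N" "s \<in> measurable N S"
  shows "(\<lambda>w. alg u K (Xb w) (xc w) (\<rho> w) (s w)) \<in> measurable N (pair_space K)"
proof -
  have *: "(\<lambda>((Xb, xc, \<rho>), s). alg u K Xb xc \<rho> s)
        \<in> measurable ((PiM {1..K} (\<lambda>_. borel) \<Otimes>\<^sub>M (borel \<Otimes>\<^sub>M borel)) \<Otimes>\<^sub>M S) (pair_space K)"
    using solver by (simp add: covering_solver_def)
  have "(\<lambda>w. ((Xb w, xc w, \<rho> w), s w)) \<in> measurable N ((PiM {1..K} (\<lambda>_. borel) \<Otimes>\<^sub>M (borel \<Otimes>\<^sub>M borel)) \<Otimes>\<^sub>M S)"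
    by measurable
  from measurable_compose[OF this *] show ?thesis by simp
qed

text \<open>Each relaxed value is attained by a feasible pair and so bounds \<open>cov_opt\<close>
  from above. Hence near-optimality with respect to the infimum implies
  \<open>solved\<close>.\<close>

lemma solver_failure_probability:
  fixes alg :: "('n::finite, 's) solver"
  assumes solver: "covering_solver S alg" and K: "1 \<le> K" and Xb: "Xb \<in> space (sample_space K)" and \<rho>: "0 < \<rho>"
  shows "measure S {s \<in> space S. \<not> solved K Xb xc \<rho> (alg u K Xb xc \<rho> s)} \<le> (1 / 10) ^ (u + 10) / real CARD('n)"
proof -
  interpret S: prob_space S using solver by (simp add: covering_solver_def)
  let ?G = "{s \<in> space S. cov_feasible K Xb xc \<rho> (alg u K Xb xc \<rho> s) \<and>
            objective K (alg u K Xb xc \<rho> s) \<le> (1 + 0.0001) * cov_opt K Xb xc \<rho>}"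
  have ext: "Xb \<in> extensional {1..K}" using Xb by (auto simp: space_PiM PiE_def)
  have G: "1 - (1 / 10) ^ (u + 10) / real CARD('n) < measure S ?G"
    using solver K ext \<rho> by (auto simp: covering_solver_def)
  have Xbc: "(\<lambda>_. Xb) \<in> measurable S (sample_space K)" using Xb by simp
  have "Measurable.pred S (\<lambda>s. solved K Xb xc \<rho> (alg u K Xb xc \<rho> s))"
    by (rule solved_measurable[OF Xbc _ _ solver_measurable[OF solver Xbc]]) auto
  then have meas: "{s \<in> space S. solved K Xb xc \<rho> (alg u K Xb xc \<rho> s)} \<in> S.events" by (simp add: pred_def)
  have "?G \<subseteq> {s \<in> space S. solved K Xb xc \<rho> (alg u K Xb xc \<rho> s)}"
  proof safe
    fix s assume feas: "cov_feasible K Xb xc \<rho> (alg u K Xb xc \<rho> s)"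
      and opt: "objective K (alg u K Xb xc \<rho> s) \<le> (1 + 0.0001) * cov_opt K Xb xc \<rho>"
    have "cov_opt K Xb xc \<rho> \<le> relaxed_value K Xb xc \<rho> A" if A: "psd A" for A
    proof -
      obtain q where q: "cov_feasible K Xb xc \<rho> q" "objective K q = relaxed_value K Xb xc \<rho> A"
        by (rule relaxed_value_attained[OF K A])
      have "bdd_below (objective K ` {p. cov_feasible K Xb xc \<rho> p})"
        by (intro bdd_belowI[of _ 0])
          (auto simp: objective_def cov_feasible_def intro!: add_nonneg_nonneg psd_trace_nonneg sum_nonneg)
      then show ?thesis unfolding cov_opt_def q(2)[symmetric] using q(1) by (intro cInf_lower) auto
    qed
    then have "objective K (alg u K Xb xc \<rho> s) \<le> 1.0001 * relaxed_value K Xb xc \<rho> A" if "psd A" for A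
      using opt that by fastforce
    then show "solved K Xb xc \<rho> (alg u K Xb xc \<rho> s)" using feas by (simp add: solved_def)
  qed
  then have "measure S ?G \<le> measure S {s \<in> space S. solved K Xb xc \<rho> (alg u K Xb xc \<rho> s)}"
    by (rule S.finite_measure_mono[OF _ meas])
  moreover have "measure S {s \<in> space S. \<not> solved K Xb xc \<rho> (alg u K Xb xc \<rho> s)} = 1 - measure S {s \<in> space S. solved K Xb xc \<rho> (alg u K Xb xc \<rho> s)}"
    using S.prob_neg[OF meas] by simp
  ultimately show ?thesis using G by linarith
qed

text \<open>A seed independent of the input of the call may be redrawn before the call.\<close>

lemma fresh_seed_probability:
  fixes f :: "'w \<times> ('i \<Rightarrow> 's) \<Rightarrow> 'y"
  assumes M: "prob_space M" and S: "prob_space S"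
    and f: "f \<in> measurable (M \<Otimes>\<^sub>M PiM UNIV (\<lambda>_. S)) Y"
    and fresh: "\<And>w s z. f (w, s(a := z)) = f (w, s)"
    and A: "A \<in> sets (Y \<Otimes>\<^sub>M S)"
    and small: "\<And>y. y \<in> space Y \<Longrightarrow> measure S {z \<in> space S. (y, z) \<in> A} \<le> \<epsilon>"
  shows "measure (M \<Otimes>\<^sub>M PiM UNIV (\<lambda>_. S)) {x \<in> space (M \<Otimes>\<^sub>M PiM UNIV (\<lambda>_. S)). (f x, snd x a) \<in> A} \<le> \<epsilon>"
proof -
  let ?P = "PiM UNIV (\<lambda>_ :: 'i. S)"
  interpret M: prob_space M by fact
  interpret S: prob_space S by fact
  interpret P: prob_space ?P by (intro prob_space_PiM S)
  interpret MP: pair_prob_space M ?P ..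
  interpret SP: pair_prob_space S ?P ..
  let ?E = "{x \<in> space (M \<Otimes>\<^sub>M ?P). (f x, snd x a) \<in> A}"
  have fa: "(\<lambda>x. (f x, snd x a)) \<in> measurable (M \<Otimes>\<^sub>M ?P) (Y \<Otimes>\<^sub>M S)" using f by measurable
  have E: "?E \<in> sets (M \<Otimes>\<^sub>M ?P)" using measurable_sets[OF fa A] by (simp add: vimage_def Int_def conj_commute)
  have upd [measurable]: "(\<lambda>(z, s). s(a := z)) \<in> measurable (S \<Otimes>\<^sub>M ?P) ?P"
    unfolding split_def by (intro measurable_fun_upd[where J = UNIV]) auto
  \<comment> \<open>The product law is invariant under replacing coordinate \<open>a\<close> by an
    independent copy.\<close>
  have distr: "distr (S \<Otimes>\<^sub>M ?P) ?P (\<lambda>(z, s). s(a := z)) = ?P"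
    using distr_pair_PiM_eq_PiM[of UNIV "\<lambda>_. S" a] S by (simp add: insert_absorb)
  have inner: "(\<integral>\<^sup>+s. indicator ?E (w, s) \<partial>?P) \<le> ennreal \<epsilon>" if w: "w \<in> space M" for w
  proof -
    have sec [measurable]: "(\<lambda>s. indicator ?E (w, s) :: ennreal) \<in> borel_measurable ?P"
      using E w by measurable
    have "(\<integral>\<^sup>+s. indicator ?E (w, s) \<partial>?P) = (\<integral>\<^sup>+s. indicator ?E (w, s) \<partial>distr (S \<Otimes>\<^sub>M ?P) ?P (\<lambda>(z, s). s(a := z)))"
      by (simp only: distr)
    also have "\<dots> = (\<integral>\<^sup>+x. indicator ?E (w, (snd x)(a := fst x)) \<partial>(S \<Otimes>\<^sub>M ?P))"
      by (subst nn_integral_distr) (auto simp: split_def)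
    also have "\<dots> = (\<integral>\<^sup>+s. \<integral>\<^sup>+z. indicator ?E (w, s(a := z)) \<partial>S \<partial>?P)"
    proof (subst SP.nn_integral_snd[symmetric])
      show "(\<lambda>x. indicator ?E (w, (snd x)(a := fst x)) :: ennreal) \<in> borel_measurable (S \<Otimes>\<^sub>M ?P)"
        using measurable_compose[OF upd sec] by (simp add: split_def)
    qed simp
    also have "\<dots> \<le> (\<integral>\<^sup>+s. ennreal \<epsilon> \<partial>?P)"
    proof (rule nn_integral_mono)
      fix s assume s: "s \<in> space ?P"
      have fy: "f (w, s) \<in> space Y" using measurable_space[OF f, of "(w, s)"] w s by (simp add: space_pair_measure)
      have Az: "{z \<in> space S. (f (w, s), z) \<in> A} \<in> sets S"
      proof -
        have "{z \<in> space S. (f (w, s), z) \<in> A} = Pair (f (w, s)) -` A"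
          using sets.sets_into_space[OF A] by (auto simp: space_pair_measure)
        then show ?thesis using sets_Pair1[OF A, of "f (w, s)"] by simp
      qed
      have "(\<integral>\<^sup>+z. indicator ?E (w, s(a := z)) \<partial>S) = (\<integral>\<^sup>+z. indicator {z \<in> space S. (f (w, s), z) \<in> A} z \<partial>S)"
      proof (rule nn_integral_cong)
        fix z assume z: "z \<in> space S"
        have "s(a := z) \<in> space ?P" using s z by (auto simp: space_PiM)
        then show "indicator ?E (w, s(a := z)) = (indicator {z \<in> space S. (f (w, s), z) \<in> A} z :: ennreal)"
          using w z fresh by (auto simp: indicator_def space_pair_measure)
      qed
      also have "\<dots> = ennreal (measure S {z \<in> space S. (f (w, s), z) \<in> A})"
        using Az by (simp add: S.emeasure_eq_measure)
      also have "\<dots> \<le> ennreal \<epsilon>" by (intro ennreal_leI small fy)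
      finally show "(\<integral>\<^sup>+z. indicator ?E (w, s(a := z)) \<partial>S) \<le> ennreal \<epsilon>" .
    qed
    also have "\<dots> = ennreal \<epsilon>" by (simp add: P.emeasure_space_1)
    finally show ?thesis .
  qed
  obtain w where w: "w \<in> space M" using M.not_empty by blast
  obtain s where s: "s \<in> space ?P" using P.not_empty by blast
  have "f (w, s) \<in> space Y" using measurable_space[OF f, of "(w, s)"] w s by (simp add: space_pair_measure)
  then have \<epsilon>: "0 \<le> \<epsilon>" using small[of "f (w, s)"] measure_nonneg order_trans by blast
  have "emeasure (M \<Otimes>\<^sub>M ?P) ?E = (\<integral>\<^sup>+w. \<integral>\<^sup>+s. indicator ?E (w, s) \<partial>?P \<partial>M)"
    using E by (subst P.emeasure_pair_measure) auto
  also have "\<dots> \<le> (\<integral>\<^sup>+w. ennreal \<epsilon> \<partial>M)" by (intro nn_integral_mono inner)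
  also have "\<dots> = ennreal \<epsilon>" by (simp add: M.emeasure_space_1)
  finally show ?thesis using \<epsilon> by (simp add: MP.emeasure_eq_measure)
qed

text \<open>The state after \<open>n\<close> steps uses the seeds 0 to \<open>n\<close> only, which
  makes the seed \<open>Suc n\<close> of the next call fresh.\<close>

lemma search_state_cong:
  assumes "\<And>i. i \<le> n \<Longrightarrow> s i = s' i"
  shows "search_state run K \<rho>0 T s n = search_state run K \<rho>0 T s' n"
  using assms
proof (induction n)
  case (Suc n)
  obtain a b q j where st: "search_state run K \<rho>0 T s n = (a, b, q, j)" by (cases "search_state run K \<rho>0 T s n")
  have "guarded (search_active K T) (search_step run K s) (a, b, q, j) = guarded (search_active K T) (search_step run K s') (a, b, q, j)"
    using search_state_count[OF st] Suc.prems by (simp add: guarded_def search_step_def)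
  then show ?case using Suc st by (simp add: search_state_Suc)
qed (simp add: search_state_0)

text \<open>The point at which pass \<open>n\<close> starts depends on earlier passes only, so it is
  independent of all seeds of that pass.\<close>

lemma loop_state_cong:
  assumes "\<And>t. t < n \<Longrightarrow> s t = s' t"
  shows "loop_state alg eigv C K Xb u s n = loop_state alg eigv C K Xb u s' n"
  using assms
proof (induction n)
  case (Suc n)
  obtain b x t where st: "loop_state alg eigv C K Xb u s n = (b, x, t)" by (cases "loop_state alg eigv C K Xb u s n")
  have "guarded loop_active (loop_step alg eigv C K Xb u s) (b, x, t) = guarded loop_active (loop_step alg eigv C K Xb u s') (b, x, t)"
    using loop_state_count[OF st] Suc.prems by (simp add: guarded_def loop_step_def)
  then show ?case using Suc st by (simp add: loop_state_Suc)
qed (simp add: loop_state_0)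

lemma seed_at_count_measurable:
  assumes "\<And>i :: nat. (\<lambda>w. s w i) \<in> measurable N S" "k \<in> measurable N (count_space UNIV)"
  shows "(\<lambda>w. s w (k w)) \<in> measurable N S"
  using measurable_compose_countable[of "\<lambda>i w. s w i" N S k] assms by simp

lemma real_count_measurable:
  assumes "k \<in> measurable N (count_space UNIV)"
  shows "(\<lambda>w. real (k w)) \<in> borel_measurable N"
  by (rule measurable_compose[OF assms]) simp

section \<open>Measurability of the states of the algorithm\<close>

abbreviation search_space :: "nat \<Rightarrow> 'n::finite search_state measure" where
  "search_space K \<equiv> borel \<Otimes>\<^sub>M (borel \<Otimes>\<^sub>M (pair_space K \<Otimes>\<^sub>M count_space UNIV))"

lemma next_rho_measurable:
  assumes [measurable]: "st \<in> measurable N (search_space K)"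
  shows "(\<lambda>w. next_rho K (st w)) \<in> borel_measurable N"
proof -
  have [measurable]: "(\<lambda>w. objective K (fst (snd (snd (st w))))) \<in> borel_measurable N"
    by (rule objective_measurable) measurable
  show ?thesis unfolding next_rho_def case_prod_beta by measurable
qed

lemma search_state_measurable:
  fixes alg :: "('n::finite, 's) solver"
  assumes solver: "covering_solver S alg"
    and Xb [measurable]: "Xb \<in> measurable N (sample_space K)" and xc [measurable]: "xc \<in> borel_measurable N"
    and \<rho>0 [measurable]: "\<rho>0 \<in> borel_measurable N"
    and s: "\<And>i. (\<lambda>w. s w i) \<in> measurable N S"
  shows "(\<lambda>w. search_state (alg u K (Xb w) (xc w)) K (\<rho>0 w) T (s w) n) \<in> measurable N (search_space K)"
proof (induction n)
  case 0
  note [measurable] = solver_measurable[OF solver Xb xc \<rho>0 s]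
  show ?case unfolding search_state_0 by measurable
next
  case (Suc n)
  define st where "st w = search_state (alg u K (Xb w) (xc w)) K (\<rho>0 w) T (s w) n" for w
  have st [measurable]: "st \<in> measurable N (search_space K)" using Suc by (simp add: st_def[abs_def])
  have [measurable]: "(\<lambda>w. objective K (fst (snd (snd (st w))))) \<in> borel_measurable N"
    by (rule objective_measurable) measurable
  have i [measurable]: "(\<lambda>w. snd (snd (snd (st w)))) \<in> measurable N (count_space UNIV)" by measurable
  note [measurable] = real_count_measurable[OF i]
  have Si [measurable]: "(\<lambda>w. Suc (snd (snd (snd (st w))))) \<in> measurable N (count_space UNIV)" by measurable
  note [measurable] = solver_measurable[OF solver Xb xc next_rho_measurable[OF st] seed_at_count_measurable[OF s Si], of u]
  have "search_state (alg u K (Xb w) (xc w)) K (\<rho>0 w) T (s w) (Suc n) =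
      (if \<not> (0.9981 \<le> objective K (fst (snd (snd (st w)))) \<and> objective K (fst (snd (snd (st w)))) \<le> 1)
          \<and> real (snd (snd (snd (st w)))) < T
       then (if objective K (fst (snd (snd (st w)))) < 0.9981 then fst (st w) else (fst (snd (st w)) + fst (st w)) / 2,
          if objective K (fst (snd (snd (st w)))) < 0.9981 then (fst (snd (st w)) + fst (st w)) / 2 else fst (snd (st w)),
          alg u K (Xb w) (xc w) (next_rho K (st w)) (s w (Suc (snd (snd (snd (st w)))))), Suc (snd (snd (snd (st w)))))
       else st w)" for w
    by (simp add: search_state_Suc st_def[symmetric] guarded_def search_active_def search_step_def case_prod_beta)
  then show ?case by (simp only:) measurable
qed

lemma binary_search_measurable:
  fixes alg :: "('n::finite, 's) solver"
  assumes solver: "covering_solver S alg"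
    and Xb [measurable]: "Xb \<in> measurable N (sample_space K)" and xc [measurable]: "xc \<in> borel_measurable N"
    and \<rho>0 [measurable]: "\<rho>0 \<in> borel_measurable N"
    and s: "\<And>i. (\<lambda>w. s w i) \<in> measurable N S"
  shows "(\<lambda>w. binary_search (alg u K (Xb w) (xc w)) K (\<rho>0 w) T (s w)) \<in> measurable N (pair_space K \<Otimes>\<^sub>M count_space UNIV)"
proof -
  define st where "st w = search_state (alg u K (Xb w) (xc w)) K (\<rho>0 w) T (s w) (nat \<lceil>T\<rceil>)" for w
  have st [measurable]: "st \<in> measurable N (search_space K)"
    unfolding st_def[abs_def] by (rule search_state_measurable[OF assms])
  have mid: "(\<lambda>w. (fst (st w) + fst (snd (st w))) / 2) \<in> borel_measurable N" by measurable
  note [measurable] = solver_measurable[OF solver Xb xc mid s]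
  have "binary_search (alg u K (Xb w) (xc w)) K (\<rho>0 w) T (s w) =
     (if snd (snd (snd (st w))) = 0 then (alg u K (Xb w) (xc w) ((fst (st w) + fst (snd (st w))) / 2) (s w 1), 2)
      else (fst (snd (snd (st w))), Suc (snd (snd (snd (st w))))))" for w
    using binary_search_eq[of T "nat \<lceil>T\<rceil>" "alg u K (Xb w) (xc w)" K "\<rho>0 w" "s w"
        "fst (st w)" "fst (snd (st w))" "fst (snd (snd (st w)))" "snd (snd (snd (st w)))"]
    by (simp add: st_def)
  then show ?thesis by (simp only:) measurable
qed

abbreviation loop_space :: "(bool \<times> (real^'n::finite) \<times> nat) measure" where
  "loop_space \<equiv> count_space UNIV \<Otimes>\<^sub>M (borel \<Otimes>\<^sub>M count_space UNIV)"

lemma loop_state_measurable: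
  fixes alg :: "('n::finite, 's) solver"
  assumes solver: "covering_solver S alg" and K: "1 \<le> K"
    and eigv [measurable]: "eigv \<in> borel_measurable borel"
    and Xb [measurable]: "Xb \<in> measurable N (sample_space K)"
    and s: "\<And>t i. (\<lambda>w. s w t i) \<in> measurable N S"
  shows "(\<lambda>w. loop_state alg eigv C K (Xb w) u (s w) n) \<in> measurable N loop_space"
proof (induction n)
  case 0
  note [measurable] = coord_median_measurable[OF K Xb]
  show ?case unfolding loop_state_0 by measurable
next
  case (Suc n)
  define st where "st w = loop_state alg eigv C K (Xb w) u (s w) n" for w
  have st [measurable]: "st \<in> measurable N loop_space" using Suc by (simp add: st_def[abs_def])
  define xc where "xc w = fst (snd (st w))" for w
  define t where "t w = snd (snd (st w))" for w
  have xc [measurable]: "xc \<in> borel_measurable N" unfolding xc_def[abs_def] by measurable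
  have t [measurable]: "t \<in> measurable N (count_space UNIV)" unfolding t_def[abs_def] by measurable
  note [measurable] = real_count_measurable[OF t]
  have st': "(\<lambda>w. s w (t w) i) \<in> measurable N S" for i
    by (rule seed_at_count_measurable[OF s t])
  define \<delta> where "\<delta> w = Med K (\<lambda>k. norm (Xb w k - coord_median K (Xb w)))" for w
  have \<delta> [measurable]: "\<delta> \<in> borel_measurable N" unfolding \<delta>_def[abs_def] by (rule delta_measurable[OF K Xb])
  define \<rho>0 where "\<rho>0 w = real CARD('n) / (\<delta> w)\<^sup>2" for w
  define \<rho>1 where "\<rho>1 w = 1 / (real CARD('n) * \<delta> w)\<^sup>2" for w
  have \<rho>0 [measurable]: "\<rho>0 \<in> borel_measurable N" unfolding \<rho>0_def[abs_def] by measurable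
  have \<rho>1 [measurable]: "\<rho>1 \<in> borel_measurable N" unfolding \<rho>1_def[abs_def] by measurable
  define bs where "bs w = binary_search (alg u K (Xb w) (xc w)) K (\<rho>0 w) (log 2 (C * real CARD('n) ^ 4)) (s w (t w))" for w
  have bs [measurable]: "bs \<in> measurable N (pair_space K \<Otimes>\<^sub>M count_space UNIV)"
    unfolding bs_def[abs_def] by (rule binary_search_measurable[OF solver Xb xc \<rho>0 st'])
  have [measurable]: "(\<lambda>w. objective K (fst (bs w))) \<in> borel_measurable N"
    by (rule objective_measurable) measurable
  have kb: "(\<lambda>w. snd (bs w)) \<in> measurable N (count_space UNIV)" by measurable
  have [measurable]: "(\<lambda>w. objective K (alg u K (Xb w) (xc w) (\<rho>1 w) (s w (t w) (snd (bs w))))) \<in> borel_measurable N"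
    by (rule objective_measurable[OF solver_measurable[OF solver Xb xc \<rho>1 seed_at_count_measurable[OF st' kb]]])
  define A where "A w = (1 / trace (fst (fst (bs w)))) *\<^sub>R fst (fst (bs w))" for w
  have [measurable]: "A \<in> borel_measurable N" unfolding A_def[abs_def] by measurable
  have [measurable]: "k \<in> {1..K} \<Longrightarrow> (\<lambda>w. Xb w k) \<in> borel_measurable N" for k
    using measurable_PiM_component[OF Xb] by simp
  have [measurable]: "(\<lambda>w. Med K (\<lambda>k. (Xb w k - xc w) \<bullet> eigv (A w))) \<in> borel_measurable N"
    using K by (intro borel_measurable_Med) auto
  note [measurable] = coord_median_measurable[OF K Xb]
  have "loop_state alg eigv C K (Xb w) u (s w) (Suc n) =
     (if fst (st w) \<and> real (t w) < loop_bound TYPE('n)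
      then (if 0.9981 \<le> objective K (fst (bs w)) \<and> objective K (fst (bs w)) \<le> 1
            then (True, xc w - (- Med K (\<lambda>k. (Xb w k - xc w) \<bullet> eigv (A w))) *\<^sub>R eigv (A w), Suc (t w))
            else if objective K (alg u K (Xb w) (xc w) (\<rho>1 w) (s w (t w) (snd (bs w)))) < 1
            then (False, coord_median K (Xb w), t w) else (False, xc w, t w))
      else st w)" for w
  proof -
    have "solve_sdp alg C K (Xb w) (xc w) u (s w (t w)) =
      (if objective K (fst (bs w)) \<in> {0.9981..1} then Inl (A w)
       else if objective K (alg u K (Xb w) (xc w) (\<rho>1 w) (s w (t w) (snd (bs w)))) < 1
            then Inr (coord_median K (Xb w)) else Inr (xc w))"
      unfolding solve_sdp_def Let_def bs_def \<rho>0_def \<rho>1_def \<delta>_def A_def by (simp add: case_prod_beta)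
    then show ?thesis
      unfolding loop_state_Suc st_def[symmetric] guarded_def loop_active_def loop_step_def
      by (simp add: case_prod_beta xc_def[symmetric] t_def[symmetric])
  qed
  then show ?case by (simp only:) measurable
qed

section \<open>Numbers of passes and of halvings\<close>

lemma ln_ge_one_minus_inverse: "0 < x \<Longrightarrow> 1 - 1 / x \<le> ln x" for x :: real
  using ln_le_minus_one[of "1 / x"] by (simp add: ln_div)

text \<open>The logarithm is bounded by a multiple of the square root of the dimension. With the
  same rate for the search length, the product of the two is linear in the dimension and cancels
  against the \<open>1 / d\<close> of the solver guarantee.\<close>

lemma loop_length_le: "real (loop_length TYPE('n::finite)) \<le> 81 * sqrt (real CARD('n))"
proof -
  define x where "x = sqrt (real CARD('n))"
  have x: "1 \<le> x" using card_ge_1[where 'n = 'n] by (simp add: x_def)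
  have "sqrt 0.81 = (0.9 :: real)" by (rule real_sqrt_unique) (auto simp: power2_eq_square)
  then have s: "1 / sqrt 0.81 = (10 / 9 :: real)" by (simp only:) simp
  have l: "1 / 10 \<le> ln (10 / 9 :: real)" using ln_ge_one_minus_inverse[of "10 / 9"] by simp
  have "ln (8 * x) \<le> 8 * x" using ln_le_minus_one[of "8 * x"] x by simp
  moreover have "0 \<le> ln (8 * x)" using x by simp
  ultimately have "ln (8 * x) / ln (10 / 9) \<le> 8 * x / (1 / 10)" using l by (intro frac_le) auto
  then have "loop_bound TYPE('n) \<le> 80 * x" unfolding loop_bound_def s x_def[symmetric] by simp
  moreover have "0 \<le> loop_bound TYPE('n)"
    unfolding loop_bound_def s x_def[symmetric] using \<open>0 \<le> ln (8 * x)\<close> l by (intro divide_nonneg_nonneg) auto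
  ultimately have "real (loop_length TYPE('n)) \<le> 80 * x + 1" unfolding loop_length_def by linarith
  then show ?thesis using x by (simp add: x_def[symmetric])
qed

text \<open>The constant part comes from \<open>C < 10 ^ 6 < 2 ^ 20\<close>; the logarithm of the
  dimension is bounded through that of its square root.\<close>

lemma search_length_le:
  assumes "10 ^ 5 \<le> C" "C < 10 ^ 6"
  shows "real (search_length TYPE('n::finite) C) \<le> 37 * sqrt (real CARD('n))"
proof -
  define d where "d = real CARD('n)"
  have d: "1 \<le> d" using card_ge_1[where 'n = 'n] by (simp add: d_def)
  have C: "0 < C" using assms by (simp add: less_le_trans[of 0 "10 ^ 5"])
  have "log 2 C \<le> log 2 (2 ^ 20)" using assms C by simp
  then have C20: "log 2 C \<le> 20" by (simp only: log_pow_cancel[of 2 20] simp_thms)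
  have "ln (sqrt d) \<le> sqrt d" using ln_le_minus_one[of "sqrt d"] d by simp
  moreover have "1 / 2 \<le> ln (2 :: real)" using ln_ge_one_minus_inverse[of 2] by simp
  ultimately have "ln (sqrt d) / ln 2 \<le> sqrt d / (1 / 2)" using d by (intro frac_le) auto
  then have "log 2 (sqrt d) \<le> 2 * sqrt d" by (simp add: log_def)
  moreover have "log 2 (sqrt d) = log 2 d / 2" using d by (simp add: log_def ln_sqrt)
  ultimately have "log 2 d \<le> 4 * sqrt d" by simp
  moreover have "log 2 (C * d ^ 4) = log 2 C + 4 * log 2 d" using C d by (simp add: log_mult log_nat_power)
  ultimately have "log 2 (C * d ^ 4) \<le> 20 + 16 * sqrt d" using C20 by simp
  moreover have "0 \<le> log 2 (C * d ^ 4)"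
  proof -
    have "1 \<le> C" using assms(1) by simp
    then show ?thesis using d \<open>log 2 (C * d ^ 4) = log 2 C + 4 * log 2 d\<close> by simp
  qed
  ultimately have "real (search_length TYPE('n) C) \<le> 21 + 16 * sqrt d"
    unfolding search_length_def d_def[symmetric] by linarith
  moreover have "1 \<le> sqrt d" using d by simp
  ultimately show ?thesis unfolding d_def by linarith
qed

section \<open>Selection of the number of blocks\<close>

lemma block_means_measurable:
  fixes X :: "nat \<Rightarrow> 'w \<Rightarrow> real^'n"
  assumes "equal_blocks N L B" "\<And>i. i \<in> {1..N} \<Longrightarrow> X i \<in> borel_measurable M"
  shows "(\<lambda>w. block_means L B (\<lambda>i. X i w)) \<in> measurable M (sample_space L)"
proof -
  have X: "X i \<in> borel_measurable M" if "k \<in> {1..L}" "i \<in> B k" for k i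
    using assms that unfolding equal_blocks_def by blast
  show ?thesis unfolding block_means_def
    by (intro measurable_restrict borel_measurable_scaleR borel_measurable_const borel_measurable_sum X)
qed

text \<open>\<open>fresh_seed_probability\<close> with the sample, the point and the parameter as
  the input of the call. The condition \<open>0 < \<rho> x\<close> belongs to the event because the
  guarantee of the solver concerns positive parameters.\<close>

lemma bad_call_probability:
  fixes alg :: "('n::finite, 's) solver" and M :: "'w measure" and u :: nat
  assumes solver: "covering_solver S alg" and M: "prob_space M" and L: "1 \<le> L"
    and Xb: "Xb \<in> measurable M (sample_space L)"
    and xc: "xc \<in> borel_measurable (with_seeds M S)" and \<rho>: "\<rho> \<in> borel_measurable (with_seeds M S)"
    and fresh: "\<And>w s z. xc (w, s(a := z)) = xc (w, s)" "\<And>w s z. \<rho> (w, s(a := z)) = \<rho> (w, s)"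
  defines "E \<equiv> {x \<in> space (with_seeds M S). 0 < \<rho> x \<and>
      \<not> solved L (Xb (fst x)) (xc x) (\<rho> x) (alg u L (Xb (fst x)) (xc x) (\<rho> x) (snd x a))}"
  shows "E \<in> sets (with_seeds M S)" "measure (with_seeds M S) E \<le> (1 / 10) ^ (u + 10) / real CARD('n)"
proof -
  let ?P = "PiM UNIV (\<lambda>_ :: nat \<times> nat \<times> nat. S)"
  let ?Y = "sample_space L \<Otimes>\<^sub>M (borel \<Otimes>\<^sub>M borel) :: ((nat \<Rightarrow> real^'n) \<times> (real^'n) \<times> real) measure"
  have S: "prob_space S" using solver by (simp add: covering_solver_def)
  have Xb' [measurable]: "(\<lambda>x. Xb (fst x)) \<in> measurable (with_seeds M S) (sample_space L)"
    unfolding with_seeds_def using Xb by measurable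
  have seed [measurable]: "(\<lambda>x. snd x b) \<in> measurable (with_seeds M S) S" for b
    unfolding with_seeds_def by measurable
  note [measurable] = xc \<rho>
  have [measurable]: "Measurable.pred (with_seeds M S) (\<lambda>x. solved L (Xb (fst x)) (xc x) (\<rho> x) (alg u L (Xb (fst x)) (xc x) (\<rho> x) (snd x a)))"
    by (rule solved_measurable[OF Xb' xc \<rho> solver_measurable[OF solver Xb' xc \<rho> seed]])
  show "E \<in> sets (with_seeds M S)" unfolding E_def by measurable
  define A where "A = {y \<in> space (?Y \<Otimes>\<^sub>M S). 0 < snd (snd (fst y)) \<and>
    \<not> solved L (fst (fst y)) (fst (snd (fst y))) (snd (snd (fst y)))
        (alg u L (fst (fst y)) (fst (snd (fst y))) (snd (snd (fst y))) (snd y))}"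
  have c: "(\<lambda>y. fst (fst y)) \<in> measurable (?Y \<Otimes>\<^sub>M S) (sample_space L)"
    "(\<lambda>y. fst (snd (fst y))) \<in> borel_measurable (?Y \<Otimes>\<^sub>M S)"
    "(\<lambda>y. snd (snd (fst y))) \<in> borel_measurable (?Y \<Otimes>\<^sub>M S)"
    "snd \<in> measurable (?Y \<Otimes>\<^sub>M S) S"
    by measurable
  have [measurable]: "Measurable.pred (?Y \<Otimes>\<^sub>M S) (\<lambda>y. solved L (fst (fst y)) (fst (snd (fst y))) (snd (snd (fst y)))
        (alg u L (fst (fst y)) (fst (snd (fst y))) (snd (snd (fst y))) (snd y)))"
    by (rule solved_measurable[OF c(1-3) solver_measurable[OF solver c]])
  have A: "A \<in> sets (?Y \<Otimes>\<^sub>M S)" unfolding A_def by measurable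
  define f where "f x = (Xb (fst x), xc x, \<rho> x)" for x
  have f: "f \<in> measurable (M \<Otimes>\<^sub>M ?P) ?Y"
    unfolding f_def[abs_def] with_seeds_def[symmetric] by measurable
  have "measure (M \<Otimes>\<^sub>M ?P) {x \<in> space (M \<Otimes>\<^sub>M ?P). (f x, snd x a) \<in> A} \<le> (1 / 10) ^ (u + 10) / real CARD('n)"
  proof (rule fresh_seed_probability[OF M S f _ A])
    fix w s z show "f (w, s(a := z)) = f (w, s)" using fresh by (simp add: f_def)
  next
    fix y :: "(nat \<Rightarrow> real^'n) \<times> (real^'n) \<times> real" assume y: "y \<in> space ?Y"
    obtain b x r where b: "y = (b, x, r)" by (cases y)
    then have bsp: "b \<in> space (sample_space L)" using y by (simp add: space_pair_measure)
    show "measure S {z \<in> space S. (y, z) \<in> A} \<le> (1 / 10) ^ (u + 10) / real CARD('n)"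
    proof (cases "0 < r")
      case True
      have "{z \<in> space S. (y, z) \<in> A} = {z \<in> space S. \<not> solved L b x r (alg u L b x r z)}"
        using True y by (auto simp: A_def b space_pair_measure)
      then show ?thesis using solver_failure_probability[OF solver L bsp True] by simp
    next
      case False
      then show ?thesis by (simp add: A_def b)
    qed
  qed
  moreover have "{x \<in> space (M \<Otimes>\<^sub>M ?P). (f x, snd x a) \<in> A} = E"
    using measurable_space[OF f] measurable_space[OF seed[of a]]
    unfolding E_def A_def with_seeds_def by (auto simp: f_def space_pair_measure)
  ultimately show "measure (with_seeds M S) E \<le> (1 / 10) ^ (u + 10) / real CARD('n)"
    by (simp add: with_seeds_def)
qed

text \<open>A pass involves 2 calls at the start, \<open>n\<close> calls of the search, and
  \<open>n + 2\<close> candidates for the last test, whose seed index is random and is therefore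
  replaced by all its possible values. Summing \<open>2 * n + 4\<close> calls over all passes gives
  at most \<open>6318 * d\<close> failures of probability 10^(-u-10) / d each.\<close>

lemma stage_failure_probability:
  fixes alg :: "('n::finite, 's) solver" and M :: "'w measure" and u :: nat
  assumes solver: "covering_solver S alg" and M: "prob_space M" and L: "1 \<le> L"
    and Xb: "Xb \<in> measurable M (sample_space L)" and eigv: "eigv \<in> borel_measurable borel"
    and C: "10 ^ 5 \<le> C" "C < 10 ^ 6"
  obtains F where "F \<in> sets (with_seeds M S)" "measure (with_seeds M S) F \<le> (1 / 10) ^ u"
    "\<And>x t. x \<in> space (with_seeds M S) - F \<Longrightarrow> t < loop_length TYPE('n) \<Longrightarrow>
       pass_solved alg C L (Xb (fst x)) u
         (fst (snd (loop_state alg eigv C L (Xb (fst x)) u (\<lambda>t i. snd x (j, t, i)) t))) (\<lambda>i. snd x (j, t, i))"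
proof -
  let ?W = "with_seeds M S"
  interpret W: prob_space ?W
  proof -
    have S: "prob_space S" using solver by (simp add: covering_solver_def)
    interpret M: prob_space M by fact
    interpret P: prob_space "PiM UNIV (\<lambda>_ :: nat \<times> nat \<times> nat. S)" by (intro prob_space_PiM S)
    interpret MP: pair_prob_space M "PiM UNIV (\<lambda>_ :: nat \<times> nat \<times> nat. S)" ..
    show "prob_space ?W" unfolding with_seeds_def by (rule MP.prob_space_axioms)
  qed
  define \<epsilon> :: real where "\<epsilon> = (1 / 10) ^ (u + 10) / real CARD('n)"
  define n where "n = search_length TYPE('n) C"
  define T where "T = log 2 (C * real CARD('n) ^ 4)"
  have Xb' [measurable]: "(\<lambda>x. Xb (fst x)) \<in> measurable ?W (sample_space L)"
    unfolding with_seeds_def using Xb by measurable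
  have seed [measurable]: "(\<lambda>x. snd x b) \<in> measurable ?W S" for b
    unfolding with_seeds_def by measurable
  define xc where "xc t x = fst (snd (loop_state alg eigv C L (Xb (fst x)) u (\<lambda>t i. snd x (j, t, i)) t))" for t x
  define \<delta> where "\<delta> x = Med L (\<lambda>k. norm (Xb (fst x) k - coord_median L (Xb (fst x))))" for x :: "'w \<times> (nat \<times> nat \<times> nat \<Rightarrow> 's)"
  define \<rho>0 where "\<rho>0 x = real CARD('n) / (\<delta> x)\<^sup>2" for x
  define \<rho>h where "\<rho>h x = \<rho>0 x / 2" for x
  define \<rho>1 where "\<rho>1 x = 1 / (real CARD('n) * \<delta> x)\<^sup>2" for x
  define nr where "nr t i x = next_rho L (search_state (alg u L (Xb (fst x)) (xc t x)) L (\<rho>0 x) T (\<lambda>i. snd x (j, t, i)) i)" for t i x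
  have [measurable]: "(\<lambda>x. loop_state alg eigv C L (Xb (fst x)) u (\<lambda>t i. snd x (j, t, i)) t) \<in> measurable ?W loop_space" for t
    by (rule loop_state_measurable[OF solver L eigv Xb' seed])
  have xc: "xc t \<in> borel_measurable ?W" for t unfolding xc_def[abs_def] by measurable
  have [measurable]: "\<delta> \<in> borel_measurable ?W" unfolding \<delta>_def[abs_def] by (rule delta_measurable[OF L Xb'])
  have \<rho>: "\<rho>0 \<in> borel_measurable ?W" "\<rho>h \<in> borel_measurable ?W" "\<rho>1 \<in> borel_measurable ?W"
    unfolding \<rho>0_def[abs_def] \<rho>h_def[abs_def] \<rho>1_def[abs_def] by measurable
  have nr: "nr t i \<in> borel_measurable ?W" for t i
    unfolding nr_def[abs_def] by (rule next_rho_measurable[OF search_state_measurable[OF solver Xb' xc \<rho>(1) seed]])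
  \<comment> \<open>A pass starts from a point computed with the seeds of earlier passes.\<close>
  have fresh_xc: "xc t (w, s((j, t, i) := z)) = xc t (w, s)" for t i w s z
    unfolding xc_def by (simp, subst loop_state_cong[where s' = "\<lambda>t i. s (j, t, i)"]) auto
  have fresh_\<rho>: "\<rho>0 (w, s(a := z)) = \<rho>0 (w, s)" "\<rho>h (w, s(a := z)) = \<rho>h (w, s)" "\<rho>1 (w, s(a := z)) = \<rho>1 (w, s)" for w s a z
    by (simp_all add: \<rho>0_def \<rho>h_def \<rho>1_def \<delta>_def)
  have fresh_nr: "nr t i (w, s((j, t, Suc i) := z)) = nr t i (w, s)" for t i w s z
    unfolding nr_def fresh_xc fresh_\<rho> by (simp, subst search_state_cong[where s' = "\<lambda>i. s (j, t, i)"]) auto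
  define bad where "bad t \<rho> i = {x \<in> space ?W. 0 < \<rho> x \<and>
      \<not> solved L (Xb (fst x)) (xc t x) (\<rho> x) (alg u L (Xb (fst x)) (xc t x) (\<rho> x) (snd x (j, t, i)))}" for t \<rho> i
  have bad: "bad t \<rho> i \<in> sets ?W" "measure ?W (bad t \<rho> i) \<le> \<epsilon>"
    if "\<rho> \<in> borel_measurable ?W" "\<And>w s z. \<rho> (w, s((j, t, i) := z)) = \<rho> (w, s)" for t \<rho> i
    unfolding bad_def \<epsilon>_def using bad_call_probability[OF solver M L Xb xc that(1) fresh_xc that(2)] by auto
  note bad0 = bad[OF \<rho>(1) fresh_\<rho>(1)] and badh = bad[OF \<rho>(2) fresh_\<rho>(2)] and bad1 = bad[OF \<rho>(3) fresh_\<rho>(3)]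
    and badn = bad[OF nr fresh_nr]
  define F where "F t = bad t \<rho>0 0 \<union> (bad t \<rho>h 1 \<union> ((\<Union>i\<in>{..<n}. bad t (nr t i) (Suc i)) \<union> (\<Union>i\<in>{..Suc n}. bad t \<rho>1 i)))" for t
  have F_sets: "F t \<in> sets ?W" for t
    unfolding F_def using bad0 badh bad1 badn by (intro sets.Un sets.finite_UN) auto
  have F_le: "measure ?W (F t) \<le> (2 * real n + 4) * \<epsilon>" for t
  proof -
    have "measure ?W (\<Union>i\<in>{..<n}. bad t (nr t i) (Suc i)) \<le> (\<Sum>i\<in>{..<n}. measure ?W (bad t (nr t i) (Suc i)))"
      using badn by (intro W.finite_measure_subadditive_finite) auto
    also have "\<dots> \<le> (\<Sum>i\<in>{..<n}. \<epsilon>)" by (intro sum_mono badn)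
    also have "\<dots> = real n * \<epsilon>" by simp
    finally have 1: "measure ?W (\<Union>i\<in>{..<n}. bad t (nr t i) (Suc i)) \<le> real n * \<epsilon>" .
    have "measure ?W (\<Union>i\<in>{..Suc n}. bad t \<rho>1 i) \<le> (\<Sum>i\<in>{..Suc n}. measure ?W (bad t \<rho>1 i))"
      using bad1 by (intro W.finite_measure_subadditive_finite) auto
    also have "\<dots> \<le> (\<Sum>i\<in>{..Suc n}. \<epsilon>)" by (intro sum_mono bad1)
    also have "\<dots> = (real n + 2) * \<epsilon>" by simp
    finally have 2: "measure ?W (\<Union>i\<in>{..Suc n}. bad t \<rho>1 i) \<le> (real n + 2) * \<epsilon>" .
    have s: "(\<Union>i\<in>{..<n}. bad t (nr t i) (Suc i)) \<in> sets ?W" "(\<Union>i\<in>{..Suc n}. bad t \<rho>1 i) \<in> sets ?W"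
      using badn bad1 by (auto intro!: sets.finite_UN)
    have "measure ?W (F t) \<le> measure ?W (bad t \<rho>0 0) + (measure ?W (bad t \<rho>h 1) +
        (measure ?W (\<Union>i\<in>{..<n}. bad t (nr t i) (Suc i)) + measure ?W (\<Union>i\<in>{..Suc n}. bad t \<rho>1 i)))"
      unfolding F_def using bad0(1) badh(1) s
      by (intro order_trans[OF measure_Un_le] add_left_mono sets.Un) auto
    also have "\<dots> \<le> \<epsilon> + (\<epsilon> + (real n * \<epsilon> + (real n + 2) * \<epsilon>))"
      by (intro add_mono bad0 badh 1 2)
    finally show ?thesis by (simp add: algebra_simps)
  qed
  let ?F = "\<Union>t\<in>{..<loop_length TYPE('n)}. F t"
  show ?thesis
  proof (rule that)
    show "?F \<in> sets ?W" using F_sets by auto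
    define d where "d = real CARD('n)"
    have d: "1 \<le> d" using card_ge_1[where 'n = 'n] by (simp add: d_def)
    have "measure ?W ?F \<le> (\<Sum>t\<in>{..<loop_length TYPE('n)}. measure ?W (F t))"
      using F_sets by (intro W.finite_measure_subadditive_finite) auto
    also have "\<dots> \<le> (\<Sum>t\<in>{..<loop_length TYPE('n)}. (2 * real n + 4) * \<epsilon>)" by (intro sum_mono F_le)
    also have "\<dots> = real (loop_length TYPE('n)) * (2 * real n + 4) * \<epsilon>" by simp
    also have "\<dots> \<le> (81 * sqrt d) * (78 * sqrt d) * \<epsilon>"
    proof (intro mult_right_mono mult_mono)
      show "real (loop_length TYPE('n)) \<le> 81 * sqrt d" unfolding d_def by (rule loop_length_le)
      have "1 \<le> sqrt d" using d by simp
      \<comment> \<open>With the square root of \<open>d\<close> at least 1, the count is at most 2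
        * 37 + 4 = 78 times it.\<close>
      then show "2 * real n + 4 \<le> 78 * sqrt d"
        using search_length_le[OF C, where 'n = 'n] unfolding d_def n_def by linarith
    qed (use d in \<open>auto simp: \<epsilon>_def\<close>)
    also have "\<dots> = 6318 * (sqrt d * sqrt d) * \<epsilon>" by simp
    also have "\<dots> = 6318 * (1 / 10) ^ 10 * (1 / 10) ^ u"
      using d by (simp add: \<epsilon>_def d_def[symmetric] power_add)
    also have "\<dots> \<le> 1 * (1 / 10) ^ u" by (intro mult_right_mono) (auto simp: power_divide)
    finally show "measure ?W ?F \<le> (1 / 10) ^ u" by simp
  next
    fix x t assume x: "x \<in> space ?W - ?F" and t: "t < loop_length TYPE('n)"
    then have nF: "x \<in> space ?W" "x \<notin> F t" by auto
    have ok: "0 < \<rho> x \<longrightarrow> solved L (Xb (fst x)) (xc t x) (\<rho> x) (alg u L (Xb (fst x)) (xc t x) (\<rho> x) (snd x (j, t, i)))"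
      if "x \<notin> bad t \<rho> i" for \<rho> i using that nF(1) by (auto simp: bad_def)
    have 0: "x \<notin> bad t \<rho>0 0" "x \<notin> bad t \<rho>h 1" "\<And>i. i < n \<Longrightarrow> x \<notin> bad t (nr t i) (Suc i)" "\<And>i. i \<le> Suc n \<Longrightarrow> x \<notin> bad t \<rho>1 i"
      using nF(2) by (auto simp: F_def)
    show "pass_solved alg C L (Xb (fst x)) u
         (fst (snd (loop_state alg eigv C L (Xb (fst x)) u (\<lambda>t i. snd x (j, t, i)) t))) (\<lambda>i. snd x (j, t, i))"
      unfolding pass_solved_def Let_def xc_def[symmetric] \<delta>_def[symmetric] \<rho>0_def[symmetric] \<rho>1_def[symmetric]
        n_def[symmetric] T_def[symmetric] nr_def[symmetric] \<rho>h_def[symmetric]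
      using ok[OF 0(1)] ok[OF 0(2)] ok[OF 0(3)] ok[OF 0(4)] by blast
  qed
qed

section \<open>Lepski's selection rule\<close>

lemma num_blocks_le: "real N / 2 ^ j \<le> real L \<Longrightarrow> num_blocks N j \<le> L"
  by (simp add: num_blocks_def nat_le_iff ceiling_le_iff)

lemma num_blocks_bounds:
  assumes "1 \<le> N"
  shows "1 \<le> num_blocks N j" "num_blocks N j \<le> N"
proof -
  have pos: "0 < real N / 2 ^ j" using assms by simp
  then show "1 \<le> num_blocks N j" by (simp add: num_blocks_def Suc_le_eq)
  have "real N / 2 ^ j \<le> real N / 1" by (intro divide_left_mono) auto
  then show "num_blocks N j \<le> N" by (intro num_blocks_le) simp
qed

lemma mu_hat_eq:
  fixes alg :: "('n::finite, 's) solver"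
  shows "mu_hat alg eigv C B u N x s j = fst (snd (loop_state alg eigv C (num_blocks N j)
     (block_means (num_blocks N j) (B (num_blocks N j)) x) (u j) (\<lambda>t i. s (j, t, i)) (loop_length TYPE('n))))"
  by (simp add: mu_hat_def cov_sdp_of_means_eq)

lemma J_hat_set:
  assumes "1 \<le> N"
  shows "finite {J. real J \<le> log 2 (real N) \<and> P J}" and "real J \<le> log 2 (real N) \<longleftrightarrow> 2 ^ J \<le> N"
proof -
  have *: "real J \<le> log 2 (real N) \<longleftrightarrow> 2 ^ J \<le> N" for J
  proof -
    have "real J \<le> log 2 (real N) \<longleftrightarrow> 2 powr (real J) \<le> real N" using assms by (simp add: le_log_iff)
    also have "\<dots> \<longleftrightarrow> real (2 ^ J) \<le> real N" by (simp add: powr_realpow)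
    finally show ?thesis by (simp only: of_nat_le_iff)
  qed
  then show "real J \<le> log 2 (real N) \<longleftrightarrow> 2 ^ J \<le> N" .
  have "{J. real J \<le> log 2 (real N) \<and> P J} \<subseteq> {..N}"
  proof
    fix J assume "J \<in> {J. real J \<le> log 2 (real N) \<and> P J}"
    then have "2 ^ J \<le> N" using * by simp
    then have "J \<le> N" using less_exp[of J] by linarith
    then show "J \<in> {..N}" by simp
  qed
  then show "finite {J. real J \<le> log 2 (real N) \<and> P J}" by (rule finite_subset) simp
qed

text \<open>Index 0 is always admissible, so the maximum is taken over a nonempty finite
  set.\<close>

lemma J_hat_properties:
  fixes m :: "nat \<Rightarrow> real^'n"
  assumes "1 \<le> N"
  shows "real (J_hat \<Sigma> N m) \<le> log 2 (real N)"
    and "j < J_hat \<Sigma> N m \<Longrightarrow> dist (m j) (m (J_hat \<Sigma> N m))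
       \<le> r_star \<Sigma> N (num_blocks N (J_hat \<Sigma> N m)) + r_star \<Sigma> N (num_blocks N j)"
    and "real J \<le> log 2 (real N) \<Longrightarrow>
       (\<And>j. j < J \<Longrightarrow> dist (m j) (m J) \<le> r_star \<Sigma> N (num_blocks N J) + r_star \<Sigma> N (num_blocks N j)) \<Longrightarrow>
       J \<le> J_hat \<Sigma> N m"
proof -
  let ?A = "{J. real J \<le> log 2 (real N) \<and>
             m J \<in> (\<Inter>j\<in>{..<J}. cball (m j) (r_star \<Sigma> N (num_blocks N J) + r_star \<Sigma> N (num_blocks N j)))}"
  have fin: "finite ?A" by (rule J_hat_set[OF assms])
  have "0 \<in> ?A" using assms by simp
  then have "?A \<noteq> {}" by blast
  with fin have "Max ?A \<in> ?A" by (rule Max_in)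
  then have J: "J_hat \<Sigma> N m \<in> ?A" unfolding J_hat_def .
  show "real (J_hat \<Sigma> N m) \<le> log 2 (real N)" using J by simp
  show "dist (m j) (m (J_hat \<Sigma> N m)) \<le> r_star \<Sigma> N (num_blocks N (J_hat \<Sigma> N m)) + r_star \<Sigma> N (num_blocks N j)"
    if "j < J_hat \<Sigma> N m" using J that by auto
  show "J \<le> J_hat \<Sigma> N m" if "real J \<le> log 2 (real N)"
    "\<And>j. j < J \<Longrightarrow> dist (m j) (m J) \<le> r_star \<Sigma> N (num_blocks N J) + r_star \<Sigma> N (num_blocks N j)"
    unfolding J_hat_def using fin that by (intro Max_ge) auto
qed

lemma adaptive_estimator_measurable:
  fixes m :: "nat \<Rightarrow> 'w \<Rightarrow> real^'n"
  assumes N: "1 \<le> N" and m: "\<And>j. m j \<in> borel_measurable W"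
  shows "(\<lambda>w. m (J_hat \<Sigma> N (\<lambda>j. m j w)) w) \<in> borel_measurable W"
proof -
  note [measurable] = m
  have "Measurable.pred W (\<lambda>w. real J \<le> log 2 (real N) \<and>
      m J w \<in> (\<Inter>j\<in>{..<J}. cball (m j w) (r_star \<Sigma> N (num_blocks N J) + r_star \<Sigma> N (num_blocks N j))))" for J
    unfolding INT_iff mem_cball by measurable
  then have "(\<lambda>w. J_hat \<Sigma> N (\<lambda>j. m j w)) \<in> measurable W (count_space UNIV)"
    unfolding J_hat_def by (rule measurable_Max_nat)
  with m show ?thesis by (rule measurable_compose_countable)
qed

lemma rate_mono:
  assumes "K \<le> K'"
  shows "rate \<Sigma> N K \<le> rate \<Sigma> N K'"
  unfolding rate_def using assms op_norm_nonneg[of \<Sigma>]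
  by (intro add_left_mono real_sqrt_le_mono divide_right_mono mult_left_mono) auto

text \<open>Only the second term of the rate depends on the number of blocks; doubling that number
  costs it the square root of 2, and 2 < 1.42^2.\<close>

lemma rate_double:
  assumes psd: "psd \<Sigma>" and K: "K' \<le> 2 * K"
  shows "rate \<Sigma> N K' \<le> 1.42 * rate \<Sigma> N K"
proof -
  define a where "a = 1200 * sqrt (trace \<Sigma> / real N)"
  define b where "b = sqrt (1200 * op_norm \<Sigma> * real K / real N)"
  have a: "0 \<le> a" using psd_trace_nonneg[OF psd] by (simp add: a_def)
  have b: "0 \<le> b" using op_norm_nonneg[of \<Sigma>] by (simp add: b_def)
  have "sqrt (1200 * op_norm \<Sigma> * real K' / real N) \<le> sqrt (1.42\<^sup>2 * (1200 * op_norm \<Sigma> * real K / real N))"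
  proof (rule real_sqrt_le_mono)
    have "1200 * op_norm \<Sigma> * real K' / real N \<le> 1200 * op_norm \<Sigma> * (2 * real K) / real N"
      using K op_norm_nonneg[of \<Sigma>] by (intro divide_right_mono mult_left_mono) auto
    also have "\<dots> = 2 * (1200 * op_norm \<Sigma> * real K / real N)" by simp
    also have "\<dots> \<le> 1.42\<^sup>2 * (1200 * op_norm \<Sigma> * real K / real N)"
      using op_norm_nonneg[of \<Sigma>] by (intro mult_right_mono) (auto simp: power2_eq_square)
    finally show "1200 * op_norm \<Sigma> * real K' / real N \<le> 1.42\<^sup>2 * (1200 * op_norm \<Sigma> * real K / real N)" .
  qed
  also have "\<dots> = 1.42 * b" unfolding real_sqrt_mult b_def by simp
  finally show ?thesis using a by (simp add: rate_def a_def[symmetric] b_def[symmetric])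
qed

lemma r_star_eq: "r_star \<Sigma> N K = 808 * rate \<Sigma> N K"
  by (simp add: r_star_def rate_def)

text \<open>At most a factor \<open>1.42\<close> is lost by replacing \<open>K\<close> by the next smaller dyadic fraction of
  \<open>N\<close>; the proof uses that the estimators are more accurate than \<open>r\<^sup>*\<close>.\<close>

lemma lepski_selection:
  fixes m :: "nat \<Rightarrow> real^'n"
  assumes psd: "psd \<Sigma>" and K: "2 \<le> K" "K \<le> N"
    and J: "real K - 1 < real N / 2 ^ J" "real N / 2 ^ Suc J \<le> real K - 1"
    and err: "\<And>j. j \<le> J \<Longrightarrow> norm (m j - \<mu>) \<le> 245 * rate \<Sigma> N (num_blocks N j)"
  shows "norm (m (J_hat \<Sigma> N m) - \<mu>) \<le> 3 * r_star \<Sigma> N K"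
proof -
  define r where "r j = rate \<Sigma> N (num_blocks N j)" for j
  have r0: "0 \<le> r j" for j using rate_nonneg[OF psd] by (simp add: r_def)
  have rJ: "r J \<le> 1.42 * rate \<Sigma> N K"
  proof -
    have "real N / 2 ^ J \<le> 2 * (real K - 1)" using J(2) by simp
    then show ?thesis unfolding r_def by (intro rate_double[OF psd] num_blocks_le) simp
  qed
  have N: "1 \<le> N" using K by simp
  have JN: "real J \<le> log 2 (real N)"
  proof -
    have "1 < real N / 2 ^ J" using J(1) K by linarith
    then have "real (2 ^ J) < real N" by (simp add: less_divide_eq)
    then show ?thesis using J_hat_set(2)[OF N, of J] by (simp only: of_nat_less_iff)
  qed
  have "J \<le> J_hat \<Sigma> N m"
  proof (rule J_hat_properties(3)[OF N JN])
    fix j assume j: "j < J"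
    have "dist (m j) (m J) \<le> norm (m j - \<mu>) + norm (m J - \<mu>)"
      using dist_triangle2[of "m j" "m J" \<mu>] by (simp add: dist_norm)
    \<comment> \<open>Both estimators are within their radii of \<open>\<mu>\<close>, so stage
      \<open>J\<close> passes every comparison and the rule selects it or a later stage.\<close>
    also have "\<dots> \<le> 245 * r j + 245 * r J" using err[of j] err[of J] j by (simp add: r_def)
    also have "\<dots> \<le> r_star \<Sigma> N (num_blocks N J) + r_star \<Sigma> N (num_blocks N j)"
      using r0[of j] r0[of J] by (simp add: r_star_eq r_def)
    finally show "dist (m j) (m J) \<le> r_star \<Sigma> N (num_blocks N J) + r_star \<Sigma> N (num_blocks N j)" .
  qed
  then consider "J_hat \<Sigma> N m = J" | "J < J_hat \<Sigma> N m" by linarith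
  then show ?thesis
  proof cases
    case 1
    have "norm (m J - \<mu>) \<le> 245 * r J" using err[of J] by (simp add: r_def)
    also have "\<dots> \<le> 3 * r_star \<Sigma> N K" using rJ rate_nonneg[OF psd, of N K] by (simp add: r_star_eq)
    finally show ?thesis using 1 by simp
  next
    case 2
    define H where "H = J_hat \<Sigma> N m"
    have rH: "r H \<le> rate \<Sigma> N K"
    proof -
      have "Suc J \<le> H" using 2 by (simp add: H_def)
      then have "(2 :: real) ^ Suc J \<le> 2 ^ H" by (intro power_increasing) auto
      then have "real N / 2 ^ H \<le> real N / 2 ^ Suc J" by (intro divide_left_mono) auto
      then have "real N / 2 ^ H \<le> real K" using J(2) by linarith
      then show ?thesis unfolding r_def by (intro rate_mono num_blocks_le)
    qed
    have "norm (m H - \<mu>) \<le> dist (m J) (m H) + norm (m J - \<mu>)"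
      using dist_triangle3[of "m H" \<mu> "m J"] by (simp add: dist_norm)
    \<comment> \<open>A later stage may be inaccurate itself; it is controlled by having passed the
      comparison with stage \<open>J\<close>. The total is 808 + 1053 * 1.42 < 2424 rates.\<close>
    also have "\<dots> \<le> (808 * r H + 808 * r J) + 245 * r J"
      using J_hat_properties(2)[OF N, of J \<Sigma> m] 2 err[of J] by (simp add: H_def[symmetric] r_def r_star_eq)
    also have "\<dots> \<le> 3 * r_star \<Sigma> N K" using rJ rH rate_nonneg[OF psd, of N K] by (simp add: r_star_eq)
    finally show ?thesis by (simp add: H_def)
  qed
qed

lemma geometric_sum_le:
  fixes x :: real
  assumes "0 \<le> x" "x \<le> 1 / 2"
  shows "(\<Sum>i<n. x ^ Suc i) \<le> 2 * x"
proof -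
  have "(\<Sum>i<n. x ^ i) = (1 - x ^ n) / (1 - x)" using assms by (simp add: sum_gp_strict)
  also have "\<dots> \<le> 1 / (1 / 2)" using assms by (intro frac_le) auto
  finally have "x * (\<Sum>i<n. x ^ i) \<le> x * 2" using assms by (intro mult_left_mono) auto
  then show ?thesis by (simp add: sum_distrib_left)
qed


text \<open>\<open>J\<close> is the last stage with at least \<open>K\<close> blocks: the number of
  blocks is the ceiling of \<open>N / 2 ^ J\<close>, and it is at least \<open>K\<close> exactly
  when this quotient exceeds \<open>K - 1\<close>.\<close>

lemma dyadic_stage:
  assumes "2 \<le> K" "K \<le> N"
  obtains J where "real K - 1 < real N / 2 ^ J" "real N / 2 ^ Suc J \<le> real K - 1"
proof -
  have "\<exists>J. real N / 2 ^ Suc J \<le> real K - 1"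
  proof
    have "N \<le> 2 ^ Suc N" using less_exp[of "Suc N"] by linarith
    then have "real N \<le> real (2 ^ Suc N)" by (simp only: of_nat_le_iff)
    then have "real N \<le> 1 * 2 ^ Suc N" by simp
    also have "\<dots> \<le> (real K - 1) * 2 ^ Suc N" using assms by (intro mult_right_mono) auto
    finally show "real N / 2 ^ Suc N \<le> real K - 1" by (subst pos_divide_le_eq) auto
  qed
  then have ex: "real N / 2 ^ Suc (LEAST J. real N / 2 ^ Suc J \<le> real K - 1) \<le> real K - 1" by (rule LeastI_ex)
  define J where "J = (LEAST J. real N / 2 ^ Suc J \<le> real K - 1)"
  have "real K - 1 < real N / 2 ^ J"
  proof (cases J)
    case 0
    then show ?thesis using assms by simp
  next
    case (Suc J')
    then have "\<not> real N / 2 ^ Suc J' \<le> real K - 1" unfolding J_def by (intro not_less_Least) simp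
    then show ?thesis using Suc by simp
  qed
  then show ?thesis using that ex by (simp add: J_def)
qed

text \<open>Counting back from stage \<open>J\<close>, the numbers of blocks grow at least like
  \<open>2 ^ i * (K / 2)\<close>, hence at least like \<open>(i + 1) * (K / 2)\<close>, and the sum
  is dominated by a geometric series with quotient \<open>exp (- K / 4000)\<close>.\<close>

lemma stage_exponential_sum:
  assumes K: "180000 \<le> K" and J: "real K - 1 < real N / 2 ^ J"
  shows "(\<Sum>j\<le>J. exp (- real (num_blocks N j) / 2000)) \<le> 2 * exp (- real K / 360000)"
proof -
  define x where "x = exp (- real K / 4000)"
  have x: "0 \<le> x" "x \<le> 1 / 2"
  proof -
    have "x \<le> exp (- 1)" using K by (simp add: x_def)
    also have "\<dots> \<le> 1 / 2" using exp_ge_add_one_self[of 1] by (simp add: exp_minus inverse_eq_divide le_divide_eq divide_le_eq)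
    finally show "x \<le> 1 / 2" .
  qed (simp add: x_def)
  have term_le: "exp (- real (num_blocks N (J - i)) / 2000) \<le> x ^ Suc i" if i: "i \<le> J" for i
  proof -
    have "(2 :: real) ^ J = 2 ^ (J - i) * 2 ^ i" using i by (simp flip: power_add)
    then have "real N / 2 ^ (J - i) = 2 ^ i * (real N / 2 ^ J)" by simp
    moreover have "real (Suc i) \<le> 2 ^ i" using less_exp[of i] by (metis Suc_leI of_nat_le_iff of_nat_numeral of_nat_power)
    moreover have "real K / 2 \<le> real N / 2 ^ J" using J K by linarith
    ultimately have "real (Suc i) * (real K / 2) \<le> real N / 2 ^ (J - i)"
      by (simp only:) (intro mult_mono; simp)
    moreover have "real N / 2 ^ (J - i) \<le> real (num_blocks N (J - i))" unfolding num_blocks_def by linarith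
    ultimately have "real (Suc i) * (real K / 2) \<le> real (num_blocks N (J - i))" by linarith
    then have "exp (- real (num_blocks N (J - i)) / 2000) \<le> exp (real (Suc i) * (- real K / 4000))"
      by (simp add: mult.commute)
    also have "\<dots> = x ^ Suc i" unfolding x_def by (rule exp_of_nat_mult)
    finally show ?thesis .
  qed
  have "(\<Sum>j\<le>J. exp (- real (num_blocks N j) / 2000)) = (\<Sum>i<Suc J. exp (- real (num_blocks N (J - i)) / 2000))"
    using sum.nat_diff_reindex[of "\<lambda>j. exp (- real (num_blocks N j) / 2000)" "Suc J"] by (simp add: lessThan_Suc_atMost)
  also have "\<dots> \<le> (\<Sum>i<Suc J. x ^ Suc i)" by (intro sum_mono term_le) auto
  also have "\<dots> \<le> 2 * x" by (rule geometric_sum_le[OF x])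
  also have "\<dots> \<le> 2 * exp (- real K / 360000)" by (simp add: x_def)
  finally show ?thesis .
qed

theorem theorem4:
  fixes M :: "'w measure" and X :: "nat \<Rightarrow> 'w \<Rightarrow> real^'n"
    and \<mu> :: "real^'n" and \<Sigma> :: "real^'n^'n"
    and In Out :: "nat set" and N K :: nat
    and S :: "'s measure" and alg :: "('n, 's) solver"
    and eigv :: "real^'n^'n \<Rightarrow> real^'n" and C :: real
    and B :: "nat \<Rightarrow> nat \<Rightarrow> nat set" and u :: "nat \<Rightarrow> nat"
  assumes data: "contaminated_data M N In Out X \<mu> \<Sigma>"
    and solver: "covering_solver S alg"
    and eigv: "\<And>A. transpose A = A \<Longrightarrow> unit_top_eigenvector A (eigv A)"
    and eigv_meas: "eigv \<in> borel_measurable borel"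
    and C: "10 ^ 5 \<le> C" "C < 10 ^ 6"
    and blocks: "\<And>L. 1 \<le> L \<Longrightarrow> L \<le> N \<Longrightarrow> equal_blocks N L (B L)"
    and u: "\<And>j. real j \<le> log 2 (real N) \<Longrightarrow> 1 \<le> u j"
    and K: "1 \<le> K" "600 * card Out \<le> K" "K \<le> N"
  shows "measure (with_seeds M S)
           {(\<omega>, s) \<in> space (with_seeds M S).
              norm (adaptive_estimator alg eigv C B u \<Sigma> N (\<lambda>i. X i \<omega>) s - \<mu>) \<le> 3 * r_star \<Sigma> N K}
         \<ge> 1 - 2 * exp (- real K / 360000)
             - (\<Sum>j | real j \<le> log 2 (real N / (real K - 1)). (1 / 10) ^ u j)"
proof (cases "180000 \<le> K")
  \<comment> \<open>For small \<open>K\<close> the claimed probability is not positive, because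
    \<open>K / 360000 \<le> 1 / 2 \<le> ln 2\<close>.\<close>
  case False
  have "1 / 2 \<le> ln (2 :: real)" using ln_ge_one_minus_inverse[of 2] by simp
  moreover have "real K \<le> 180000" using False by simp
  ultimately have "- ln 2 \<le> - real K / 360000" by simp
  then have "exp (- ln 2) \<le> exp (- real K / 360000)" by simp
  then have "1 - 2 * exp (- real K / 360000) \<le> 0" by (simp add: exp_minus)
  moreover have "0 \<le> (\<Sum>j | real j \<le> log 2 (real N / (real K - 1)). (1 / 10 :: real) ^ u j)"
    by (intro sum_nonneg) simp
  moreover have "0 \<le> measure (with_seeds M S)
           {(\<omega>, s) \<in> space (with_seeds M S).
              norm (adaptive_estimator alg eigv C B u \<Sigma> N (\<lambda>i. X i \<omega>) s - \<mu>) \<le> 3 * r_star \<Sigma> N K}"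
    by (rule measure_nonneg)
  ultimately show ?thesis by linarith
next
  case big: True
  let ?W = "with_seeds M S" and ?P = "PiM UNIV (\<lambda>_ :: nat \<times> nat \<times> nat. S)"
  have M: "prob_space M" and psd: "psd \<Sigma>" and X: "\<And>i. i \<in> {1..N} \<Longrightarrow> X i \<in> borel_measurable M"
    using data by (auto simp: contaminated_data_def)
  have S: "prob_space S" using solver by (simp add: covering_solver_def)
  interpret M: prob_space M by fact
  interpret P: prob_space ?P by (intro prob_space_PiM S)
  interpret MP: pair_prob_space M ?P ..
  interpret W: prob_space ?W unfolding with_seeds_def by (rule MP.prob_space_axioms)
  have N: "1 \<le> N" and K2: "2 \<le> K" using K big by auto
  obtain J where J: "real K - 1 < real N / 2 ^ J" "real N / 2 ^ Suc J \<le> real K - 1"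
    by (rule dyadic_stage[OF K2 K(3)])
  define L where "L j = num_blocks N j" for j
  have L: "1 \<le> L j" "L j \<le> N" for j using num_blocks_bounds[OF N] by (auto simp: L_def)
  have dyadic: "real K - 1 < real N / 2 ^ j" if "j \<le> J" for j
  proof -
    have "real N / 2 ^ J \<le> real N / 2 ^ j" using that by (intro divide_left_mono power_increasing) auto
    then show ?thesis using J(1) by linarith
  qed
  \<comment> \<open>All stages up to \<open>J\<close> have at least \<open>K\<close> blocks, so the
    condition \<open>600 * card Out \<le> K\<close> carries over to each of them.\<close>
  have KL: "K \<le> L j" if "j \<le> J" for j
    using dyadic[OF that] unfolding L_def num_blocks_def by linarith
  define Xb where "Xb j w = block_means (L j) (B (L j)) (\<lambda>i. X i w)" for j w
  have Xb: "Xb j \<in> measurable M (sample_space (L j))" for j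
    unfolding Xb_def[abs_def] by (rule block_means_measurable[OF blocks[OF L] X])
  have "\<exists>A. A \<in> sets M \<and> 1 - exp (- real (L j) / 2000) \<le> measure M A \<and>
      (\<forall>w\<in>A. central_blocks (L j) (Xb j w) \<mu> (5 * rate \<Sigma> N (L j)))" if "j \<le> J" for j
  proof -
    have "600 \<le> L j" "600 * card Out \<le> L j" using KL[OF that] K big by auto
    then obtain A where "A \<in> sets M" "measure M A \<ge> 1 - exp (- real (L j) / 2000)"
      "\<And>w. w \<in> A \<Longrightarrow> central_blocks (L j) (block_means (L j) (B (L j)) (\<lambda>i. X i w)) \<mu> (5 * rate \<Sigma> N (L j))"
      using central_blocks_probability[OF data _ L(2) _ blocks[OF L]] by blast
    then show ?thesis by (auto simp: Xb_def)
  qed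
  then obtain A where A: "\<And>j. j \<le> J \<Longrightarrow> A j \<in> sets M" "\<And>j. j \<le> J \<Longrightarrow> 1 - exp (- real (L j) / 2000) \<le> measure M (A j)"
    "\<And>j w. j \<le> J \<Longrightarrow> w \<in> A j \<Longrightarrow> central_blocks (L j) (Xb j w) \<mu> (5 * rate \<Sigma> N (L j))"
    by metis
  have "\<exists>F. F \<in> sets ?W \<and> measure ?W F \<le> (1 / 10) ^ u j \<and>
    (\<forall>x\<in>space ?W - F. \<forall>t<loop_length TYPE('n).
       pass_solved alg C (L j) (Xb j (fst x)) (u j)
         (fst (snd (loop_state alg eigv C (L j) (Xb j (fst x)) (u j) (\<lambda>t i. snd x (j, t, i)) t))) (\<lambda>i. snd x (j, t, i)))" for j
    by (rule stage_failure_probability[OF solver M L(1) Xb eigv_meas C]) blast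
  then obtain F where F: "\<And>j. F j \<in> sets ?W" "\<And>j. measure ?W (F j) \<le> (1 / 10) ^ u j"
    "\<And>j x t. x \<in> space ?W - F j \<Longrightarrow> t < loop_length TYPE('n) \<Longrightarrow>
       pass_solved alg C (L j) (Xb j (fst x)) (u j)
         (fst (snd (loop_state alg eigv C (L j) (Xb j (fst x)) (u j) (\<lambda>t i. snd x (j, t, i)) t))) (\<lambda>i. snd x (j, t, i))"
    by metis
  define m where "m j x = mu_hat alg eigv C B u N (\<lambda>i. X i (fst x)) (snd x) j" for j x
  have m_eq: "m j x = fst (snd (loop_state alg eigv C (L j) (Xb j (fst x)) (u j) (\<lambda>t i. snd x (j, t, i)) (loop_length TYPE('n))))" for j x
    by (simp add: m_def mu_hat_eq L_def Xb_def)
  have m_meas: "m j \<in> borel_measurable ?W" for j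
  proof -
    have 1: "(\<lambda>x. Xb j (fst x)) \<in> measurable ?W (sample_space (L j))"
      unfolding with_seeds_def using Xb by measurable
    have 2: "(\<lambda>x. snd x b) \<in> measurable ?W S" for b unfolding with_seeds_def by measurable
    note [measurable] = loop_state_measurable[OF solver L(1) eigv_meas 1 2]
    show ?thesis unfolding m_eq[abs_def] by measurable
  qed
  have est: "adaptive_estimator alg eigv C B u \<Sigma> N (\<lambda>i. X i (fst x)) (snd x) = m (J_hat \<Sigma> N (\<lambda>j. m j x)) x" for x
    by (simp add: adaptive_estimator_def Let_def m_def)
  define G where "G = {(\<omega>, s) \<in> space ?W. norm (adaptive_estimator alg eigv C B u \<Sigma> N (\<lambda>i. X i \<omega>) s - \<mu>) \<le> 3 * r_star \<Sigma> N K}"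
  have G_eq: "G = {x \<in> space ?W. norm (m (J_hat \<Sigma> N (\<lambda>j. m j x)) x - \<mu>) \<le> 3 * r_star \<Sigma> N K}"
    unfolding G_def est[symmetric] by auto
  have G: "G \<in> sets ?W"
  proof -
    note [measurable] = adaptive_estimator_measurable[OF N m_meas, where \<Sigma> = \<Sigma>]
    show ?thesis unfolding G_eq by measurable
  qed
  define E where "E j = (space M - A j) \<times> space ?P" for j
  have E: "E j \<in> sets ?W" "measure ?W (E j) \<le> exp (- real (L j) / 2000)" if "j \<le> J" for j
  proof -
    have c: "space M - A j \<in> sets M" using A(1)[OF that] by auto
    then show "E j \<in> sets ?W" unfolding E_def with_seeds_def by auto
    have "emeasure ?W (E j) = emeasure M (space M - A j) * emeasure ?P (space ?P)"
      unfolding E_def with_seeds_def using c by (intro P.emeasure_pair_measure_Times) auto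
    then have "measure ?W (E j) = measure M (space M - A j)"
      by (simp add: P.emeasure_space_1 measure_def)
    then show "measure ?W (E j) \<le> exp (- real (L j) / 2000)"
      using M.prob_compl[OF A(1)[OF that]] A(2)[OF that] by simp
  qed
  \<comment> \<open>Only stages up to \<open>J\<close> enter the union bound, since the selection
    argument requires accuracy for these alone.\<close>
  have sub: "space ?W - G \<subseteq> (\<Union>j\<in>{..J}. E j) \<union> (\<Union>j\<in>{..J}. F j)"
  proof (rule ccontr)
    assume "\<not> ?thesis"
    then have "\<exists>x. x \<in> space ?W \<and> x \<notin> G \<and> (\<forall>j\<le>J. x \<notin> E j) \<and> (\<forall>j\<le>J. x \<notin> F j)" by blast
    then obtain x where x: "x \<in> space ?W" "x \<notin> G" "\<And>j. j \<le> J \<Longrightarrow> x \<notin> E j" "\<And>j. j \<le> J \<Longrightarrow> x \<notin> F j" by blast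
    have "norm (m j x - \<mu>) \<le> 245 * rate \<Sigma> N (num_blocks N j)" if j: "j \<le> J" for j
    proof -
      have "fst x \<in> A j" using x(1) x(3)[OF j] by (auto simp: E_def with_seeds_def space_pair_measure)
      then have "central_sample (L j) (Xb j (fst x)) \<mu> (5 * rate \<Sigma> N (L j))"
        using A(3)[OF j] L(1) rate_nonneg[OF psd] by unfold_locales auto
      then have "norm (m j x - \<mu>) \<le> 49 * (5 * rate \<Sigma> N (L j))"
        unfolding m_eq using x(1) x(4)[OF j]
        by (intro central_sample.loop_state_error[OF _ C(1) eigv] F(3)) auto
      then show ?thesis by (simp add: L_def)
    qed
    from lepski_selection[OF psd K2 K(3) J this] have "x \<in> G" using x(1) by (simp add: G_eq)
    then show False using x(2) by simp
  qed
  have "measure ?W (space ?W - G) \<le> measure ?W ((\<Union>j\<in>{..J}. E j) \<union> (\<Union>j\<in>{..J}. F j))"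
    using E(1) F(1) by (intro W.finite_measure_mono[OF sub] sets.Un sets.finite_UN) auto
  also have "\<dots> \<le> measure ?W (\<Union>j\<in>{..J}. E j) + measure ?W (\<Union>j\<in>{..J}. F j)"
    using E(1) F(1) by (intro measure_Un_le sets.finite_UN) auto
  also have "\<dots> \<le> (\<Sum>j\<le>J. measure ?W (E j)) + (\<Sum>j\<le>J. measure ?W (F j))"
    using E(1) F(1) by (intro add_mono W.finite_measure_subadditive_finite) auto
  also have "\<dots> \<le> (\<Sum>j\<le>J. exp (- real (num_blocks N j) / 2000)) + (\<Sum>j\<le>J. (1 / 10) ^ u j)"
    using E(2) F(2) by (intro add_mono sum_mono) (auto simp: L_def)
  also have "\<dots> \<le> 2 * exp (- real K / 360000) + (\<Sum>j | real j \<le> log 2 (real N / (real K - 1)). (1 / 10) ^ u j)"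
  proof (intro add_mono stage_exponential_sum big J sum_mono2)
    have iff: "real j \<le> log 2 (real N / (real K - 1)) \<longleftrightarrow> 2 ^ j * (real K - 1) \<le> real N" for j
    proof -
      have pos: "0 < real K - 1" "0 < real N / (real K - 1)" using K2 N by auto
      have "real j \<le> log 2 (real N / (real K - 1)) \<longleftrightarrow> 2 powr real j \<le> real N / (real K - 1)"
        using pos by (simp add: le_log_iff)
      then show ?thesis using pos by (simp add: powr_realpow pos_le_divide_eq)
    qed
    show "finite {j. real j \<le> log 2 (real N / (real K - 1))}"
    proof (rule finite_subset)
      show "{j. real j \<le> log 2 (real N / (real K - 1))} \<subseteq> {..N}"
      proof
        fix j assume "j \<in> {j. real j \<le> log 2 (real N / (real K - 1))}"
        then have "2 ^ j * (real K - 1) \<le> real N" using iff by simp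
        moreover have "2 ^ j * 1 \<le> 2 ^ j * (real K - 1)" using K2 by (intro mult_left_mono) auto
        ultimately have "2 ^ j \<le> real N" by linarith
        then have "real (2 ^ j) \<le> real N" unfolding of_nat_power of_nat_numeral .
        then have "2 ^ j \<le> N" by (simp only: of_nat_le_iff)
        then have "j \<le> N" using less_exp[of j] by linarith
        then show "j \<in> {..N}" by simp
      qed
    qed simp
    \<comment> \<open>The index set of the theorem consists of the \<open>j\<close> with
      \<open>N / 2 ^ j \<ge> K - 1\<close>, which contains every stage up to
      \<open>J\<close>.\<close>
    show "{..J} \<subseteq> {j. real j \<le> log 2 (real N / (real K - 1))}"
      using dyadic unfolding iff by (auto simp: less_divide_eq mult.commute less_imp_le)
  qed auto
  finally have "measure ?W (space ?W - G) \<le> 2 * exp (- real K / 360000)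
      + (\<Sum>j | real j \<le> log 2 (real N / (real K - 1)). (1 / 10) ^ u j)" .
  then show ?thesis unfolding G_def[symmetric] using W.prob_compl[OF G] by simp
qed

end
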